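(* Let $1<p\le q<\infty$, $\omega\in\mathcal{D}$, $\upsilon$ a positive Borel measure on $\mathbb{D}$, $\varphi,\psi\in S(\mathbb{D})$ and $u_0,u_1\in H(\mathbb{D})$. If $u_0C_\varphi+u_1D^{(1)}_\psi:A^p_\omega\to L^q_\upsilon$ is bounded, then $$\|u_0C_\varphi+u_1D^{(1)}_\psi\|_{e,A^p_\omega\to L^q_\upsilon}\approx\|u_0C_\varphi\|_{e,A^p_\omega\to L^q_\upsilon}+\|u_1D^{(1)}_\psi\|_{e,A^p_\omega\to L^q_\upsilon}.$$
   Context: $\mathbb{D}$ is the open unit disc, $dA$ the normalized area measure, $H(\mathbb{D})$ the analytic functions on $\mathbb{D}$, $S(\mathbb{D})$ the analytic self-maps of $\mathbb{D}$. For $u\in H(\mathbb{D})$, $\varphi\in S(\mathbb{D})$: $uC_\varphi f=u\,(f\circ\varphi)$ and $uD^{(1)}_\varphi f=u\,(f'\circ\varphi)$. A radial weight is a nonnegative $\omega\in L^1([0,1])$ extended by $\omega(z)=\omega(|z|)$; set $\hat\omega(r)=\int_r^1\omega(t)\,dt$, and assume $\hat\omega(r)>0$ for all $r<1$. $\hat{\mathcal{D}}$ is the class of radial weights with $\hat\omega(r)\le C\hat\omega(\frac{1+r}{2})$ for all $0\le r<1$ and some $C\ge1$; $\mathcal{D}$ is the class of $\omega\in\hat{\mathcal{D}}$ for which additionally there are $K>1$, $C>1$ with $\hat\omega(r)\ge C\hat\omega(1-\frac{1-r}{K})$ for all $0\le r<1$. $A^p_\omega$ is the space of $f\in H(\mathbb{D})$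 with $\|f\|^p_{A^p_\omega}=\int_{\mathbb{D}}|f|^p\omega\,dA<\infty$. $L^q_\upsilon=L^q(\mathbb{D},\upsilon)$. The essential norm of a bounded operator $T:X\to Y$ is $\|T\|_{e,X\to Y}=\inf\{\|T-K\|_{X\to Y}:K:X\to Y\text{ compact}\}$. $A\approx B$ means two-sided inequality with constants independent of $u_0,u_1,\varphi,\psi,\upsilon$. *)

theory Defs
  imports "HOL-Analysis.Analysis"
begin

definition disc :: "complex set" where
  "disc = ball 0 1"

definition self_map :: "(complex \<Rightarrow> complex) \<Rightarrow> bool" where
  "self_map \<phi> \<longleftrightarrow> \<phi> holomorphic_on disc \<and> \<phi> ` disc \<subseteq> disc"

definition omega_hat :: "(real \<Rightarrow> real) \<Rightarrow> real \<Rightarrow> real" where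
  "omega_hat \<omega> r = (\<integral>t\<in>{r..1}. \<omega> t \<partial>lborel)"

definition radial_weight :: "(real \<Rightarrow> real) \<Rightarrow> bool" where
  "radial_weight \<omega> \<longleftrightarrow> set_integrable lborel {0..1} \<omega> \<and> (\<forall>t\<in>{0..1}. 0 \<le> \<omega> t)
     \<and> (\<forall>r\<in>{0..<1}. 0 < omega_hat \<omega> r)"

definition weight_Dhat :: "(real \<Rightarrow> real) \<Rightarrow> bool" where
  "weight_Dhat \<omega> \<longleftrightarrow> radial_weight \<omega> \<and>
     (\<exists>C\<ge>1. \<forall>r\<in>{0..<1}. omega_hat \<omega> r \<le> C * omega_hat \<omega> ((1 + r) / 2))"

definition weight_D :: "(real \<Rightarrow> real) \<Rightarrow> bool" where
  "weight_D \<omega> \<longleftrightarrow> weight_Dhat \<omega> \<and>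
     (\<exists>K>1. \<exists>C>1. \<forall>r\<in>{0..<1}. omega_hat \<omega> r \<ge> C * omega_hat \<omega> (1 - (1 - r) / K))"

definition root_enn :: "ennreal \<Rightarrow> real \<Rightarrow> ennreal" where
  "root_enn I p = (if I = \<infinity> then \<infinity> else ennreal (enn2real I powr (1 / p)))"

text \<open>Weighted Bergman space A^p_omega with normalized area measure dA = dx dy / pi.\<close>
definition Ap_int :: "(real \<Rightarrow> real) \<Rightarrow> real \<Rightarrow> (complex \<Rightarrow> complex) \<Rightarrow> ennreal" where
  "Ap_int \<omega> p f = (\<integral>\<^sup>+ z\<in>disc. ennreal (norm (f z) powr p * \<omega> (norm z) / pi) \<partial>(lborel :: complex measure))"

definition Ap_norm :: "(real \<Rightarrow> real) \<Rightarrow> real \<Rightarrow> (complex \<Rightarrow> complex) \<Rightarrow> ennreal" where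
  "Ap_norm \<omega> p f = root_enn (Ap_int \<omega> p f) p"

definition Ap_space :: "(real \<Rightarrow> real) \<Rightarrow> real \<Rightarrow> (complex \<Rightarrow> complex) set" where
  "Ap_space \<omega> p = {f. f holomorphic_on disc \<and> Ap_int \<omega> p f < \<infinity>}"

text \<open>L^q(D, upsilon), upsilon a positive Borel measure (on the Borel sets of C, only its
  restriction to the disc matters).\<close>
definition Lq_int :: "complex measure \<Rightarrow> real \<Rightarrow> (complex \<Rightarrow> complex) \<Rightarrow> ennreal" where
  "Lq_int \<upsilon> q g = (\<integral>\<^sup>+ z\<in>disc. ennreal (norm (g z) powr q) \<partial>\<upsilon>)"

definition Lq_norm :: "complex measure \<Rightarrow> real \<Rightarrow> (complex \<Rightarrow> complex) \<Rightarrow> ennreal" where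
  "Lq_norm \<upsilon> q g = root_enn (Lq_int \<upsilon> q g) q"

definition Lq_space :: "complex measure \<Rightarrow> real \<Rightarrow> (complex \<Rightarrow> complex) set" where
  "Lq_space \<upsilon> q = {g. g \<in> borel_measurable \<upsilon> \<and> Lq_int \<upsilon> q g < \<infinity>}"

type_synonym opr = "(complex \<Rightarrow> complex) \<Rightarrow> (complex \<Rightarrow> complex)"

definition op_norm :: "(real \<Rightarrow> real) \<Rightarrow> real \<Rightarrow> complex measure \<Rightarrow> real \<Rightarrow> opr \<Rightarrow> ennreal" where
  "op_norm \<omega> p \<upsilon> q T = (SUP f\<in>{f\<in>Ap_space \<omega> p. Ap_norm \<omega> p f \<le> 1}. Lq_norm \<upsilon> q (T f))"

definition bounded_op :: "(real \<Rightarrow> real) \<Rightarrow> real \<Rightarrow> complex measure \<Rightarrow> real \<Rightarrow> opr \<Rightarrow> bool" where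
  "bounded_op \<omega> p \<upsilon> q T \<longleftrightarrow>
     (\<exists>M\<ge>0. \<forall>f\<in>Ap_space \<omega> p. Lq_norm \<upsilon> q (T f) \<le> ennreal M * Ap_norm \<omega> p f)"

definition compact_op :: "(real \<Rightarrow> real) \<Rightarrow> real \<Rightarrow> complex measure \<Rightarrow> real \<Rightarrow> opr \<Rightarrow> bool" where
  "compact_op \<omega> p \<upsilon> q K \<longleftrightarrow>
     (\<forall>f\<in>Ap_space \<omega> p. K f \<in> Lq_space \<upsilon> q) \<and>
     (\<forall>f\<in>Ap_space \<omega> p. \<forall>g\<in>Ap_space \<omega> p. \<forall>a b :: complex.
        K (\<lambda>z. a * f z + b * g z) = (\<lambda>z. a * K f z + b * K g z)) \<and>
     (\<forall>F. (\<forall>n. F n \<in> Ap_space \<omega> p \<and> Ap_norm \<omega> p (F n) \<le> 1) \<longrightarrow>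
        (\<exists>(r::nat \<Rightarrow> nat) h. strict_mono r \<and> h \<in> Lq_space \<upsilon> q \<and>
           ((\<lambda>n. Lq_norm \<upsilon> q (\<lambda>z. K (F (r n)) z - h z)) \<longlongrightarrow> 0) sequentially))"

definition ess_norm :: "(real \<Rightarrow> real) \<Rightarrow> real \<Rightarrow> complex measure \<Rightarrow> real \<Rightarrow> opr \<Rightarrow> ennreal" where
  "ess_norm \<omega> p \<upsilon> q T =
     (INF K\<in>{K. compact_op \<omega> p \<upsilon> q K}. op_norm \<omega> p \<upsilon> q (\<lambda>f z. T f z - K f z))"

definition wC :: "(complex \<Rightarrow> complex) \<Rightarrow> (complex \<Rightarrow> complex) \<Rightarrow> opr" where
  "wC u \<phi> = (\<lambda>f z. u z * f (\<phi> z))"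

definition wD :: "(complex \<Rightarrow> complex) \<Rightarrow> (complex \<Rightarrow> complex) \<Rightarrow> opr" where
  "wD u \<psi> = (\<lambda>f z. u z * deriv f (\<psi> z))"

end

theory Submission
  imports Defs "HOL-Complex_Analysis.Complex_Analysis"
begin

text \<open>
  The upper estimate is subadditivity of the essential norm. For the lower one write
  \<open>T = u\<^sub>0 C\<^sub>\<phi> + u\<^sub>1 D\<^sub>\<psi>\<close>, let \<open>K\<close> be compact, and test \<open>T\<close> on normalised powers
  \<open>((1 - |a|\<^sup>2) / (1 - cnj a z))\<^sup>n\<close> for three consecutive exponents \<open>n\<close>. They tend to \<open>0\<close> locally
  uniformly as \<open>|a| \<rightarrow> 1\<close>, so \<open>K\<close> becomes negligible on them (here \<open>p > 1\<close> enters), and a linear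
  combination of the three values of \<open>T\<close> isolates \<open>u\<^sub>0\<close> where \<open>\<phi>\<close> is near \<open>a\<close>, respectively
  \<open>u\<^sub>1 / (1 - |a|)\<close> where \<open>\<psi>\<close> is near \<open>a\<close>. Thus each pulled-back measure \<open>|u\<^sub>k|\<^sup>q d\<upsilon>\<close> satisfies a Carleson
  condition near the unit circle with constant controlled by the norm of \<open>T - K\<close>. Truncating
  \<open>u\<^sub>k f\<^sup>(\<^sup>k\<^sup>) \<circ> \<tau>\<close> to the set \<open>|\<tau>| \<le> R\<close> is a compact operator by Montel's theorem, and a Carleson embedding
  (here \<open>p \<le> q\<close> and \<open>\<omega> \<in> D\<close> enter) bounds the remainder.
\<close>

section \<open>Polar coordinates on the disc\<close>

text \<open>Neither summand is assumed bounded, so all information on \<open>u0\<close> and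
  \<open>u1\<close> has to be read off from \<open>T\<close>. Where one of \<phi>(z), \<psi>(z) is
  near \<open>a\<close>, the other may be anywhere in the disc; writing \<open>s\<close> and
  \<open>t\<close> for the base function of the powers at these two points, the determinant for two
  exponents, \<open>(m + 1) * t - m * s\<close>, may vanish. The third exponent removes this
  degeneracy. The first exponent \<open>m\<close> is dictated by the doubling constant of \<omega>:
  the powers must decay faster than \<open>omega_hat\<close> can, once to bound their norms by the
  gauge \<open>omega_hat \<omega> (norm a) * (1 - norm a)\<close> and once to make the normalised
  powers tend to 0 locally uniformly. Since \<omega> carries no pointwise information, local
  estimates are made with \<open>omega_hat \<omega> r / (1 - r)\<close>; passing to that weight
  rests on the monotonicity of circular means, which is why polar coordinates come first. All
  constants depend on \<omega>, p and q only.\<close>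

lemma lborel_complex_eq_distr:
  "lborel = distr (lborel \<Otimes>\<^sub>M lborel) borel (\<lambda>(x, y). Complex x y)"
proof (rule lborel_eqI)
  have [measurable]: "(\<lambda>(x, y). Complex x y) \<in> borel_measurable (lborel \<Otimes>\<^sub>M lborel)"
    unfolding Complex_eq by measurable
  fix l u :: complex
  assume le: "\<And>b. b \<in> Basis \<Longrightarrow> l \<bullet> b \<le> u \<bullet> b"
  have "(\<lambda>(x, y). Complex x y) -` box l u \<inter> space (lborel \<Otimes>\<^sub>M lborel)
      = {Re l<..<Re u} \<times> {Im l<..<Im u}"
    by (auto simp: box_def Basis_complex_def space_pair_measure)
  then show "emeasure (distr (lborel \<Otimes>\<^sub>M lborel) borel (\<lambda>(x, y). Complex x y)) (box l u)
      = (\<Prod>b\<in>Basis. (u - l) \<bullet> b)"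
    using le[of 1] le[of \<i>]
    by (subst emeasure_distr)
      (auto simp: lborel.emeasure_pair_measure_Times Basis_complex_def ennreal_mult complex_i_not_one)
qed simp

lemma nn_integral_complex_iterated:
  fixes F :: "complex \<Rightarrow> ennreal"
  assumes [measurable]: "F \<in> borel_measurable borel"
  shows "(\<integral>\<^sup>+z. F z \<partial>lborel) = (\<integral>\<^sup>+x. \<integral>\<^sup>+y. F (Complex x y) \<partial>lborel \<partial>lborel)" (is ?A)
    and "(\<integral>\<^sup>+z. F z \<partial>lborel) = (\<integral>\<^sup>+y. \<integral>\<^sup>+x. F (Complex x y) \<partial>lborel \<partial>lborel)" (is ?B)
proof -
  have m [measurable]: "(\<lambda>(x, y). Complex x y) \<in> borel_measurable (lborel \<Otimes>\<^sub>M lborel)"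
    unfolding Complex_eq by measurable
  have [measurable]: "(\<lambda>(x, y). F (Complex x y)) \<in> borel_measurable (lborel \<Otimes>\<^sub>M lborel)"
    using measurable_compose[OF m assms] by (simp add: case_prod_beta)
  have "(\<integral>\<^sup>+z. F z \<partial>lborel) = (\<integral>\<^sup>+z. F (case z of (x, y) \<Rightarrow> Complex x y) \<partial>(lborel \<Otimes>\<^sub>M lborel))"
    by (subst lborel_complex_eq_distr) (simp add: nn_integral_distr)
  also have "\<dots> = (\<integral>\<^sup>+(x, y). F (Complex x y) \<partial>(lborel \<Otimes>\<^sub>M lborel))"
    by (intro nn_integral_cong) (auto split: prod.split)
  finally have *: "(\<integral>\<^sup>+z. F z \<partial>lborel) = \<dots>" .
  show ?A unfolding * by (rule lborel.nn_integral_fst[symmetric, of "\<lambda>(x, y). F (Complex x y)", simplified]) measurable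
  show ?B unfolding * by (rule lborel_pair.nn_integral_snd[symmetric, of "\<lambda>(x, y). F (Complex x y)", simplified]) measurable
qed

text \<open>A shear translates each horizontal (or vertical) line along itself, so with that
  variable innermost the claim is translation invariance on the line.\<close>

lemma nn_integral_complex_shear:
  fixes F :: "complex \<Rightarrow> ennreal" and t :: real
  assumes [measurable]: "F \<in> borel_measurable borel"
  shows "(\<integral>\<^sup>+z. F (z + of_real (t * Im z)) \<partial>lborel) = (\<integral>\<^sup>+z. F z \<partial>lborel)" (is ?A)
    and "(\<integral>\<^sup>+z. F (z + \<i> * of_real (t * Re z)) \<partial>lborel) = (\<integral>\<^sup>+z. F z \<partial>lborel)" (is ?B)
proof -
  have m [measurable]: "(\<lambda>(x, y). Complex x y) \<in> borel_measurable (borel \<Otimes>\<^sub>M borel)"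
    unfolding Complex_eq by measurable
  have m1 [measurable]: "(\<lambda>x. Complex x y) \<in> borel_measurable borel" for y
    unfolding Complex_eq by measurable
  have m2 [measurable]: "(\<lambda>y. Complex x y) \<in> borel_measurable borel" for x
    unfolding Complex_eq by measurable
  have "(\<integral>\<^sup>+x. F (Complex x y) \<partial>lborel) = (\<integral>\<^sup>+x. F (Complex (x + t * y) y) \<partial>lborel)" for y
    by (subst nn_integral_real_affine[where c=1 and t="t*y"]) (auto simp: add.commute)
  moreover have "Complex x y + of_real (t * Im (Complex x y)) = Complex (x + t * y) y" for x y
    by (simp add: complex_eq_iff)
  ultimately show ?A
    by (simp add: nn_integral_complex_iterated(2))
  have "(\<integral>\<^sup>+y. F (Complex x y) \<partial>lborel) = (\<integral>\<^sup>+y. F (Complex x (y + t * x)) \<partial>lborel)" for x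
    by (subst nn_integral_real_affine[where c=1 and t="t*x"]) (auto simp: add.commute)
  moreover have "Complex x y + \<i> * of_real (t * Re (Complex x y)) = Complex x (y + t * x)" for x y
    by (simp add: complex_eq_iff)
  ultimately show ?B
    by (simp add: nn_integral_complex_iterated(1))
qed

text \<open>A rotation other than \<open>z \<mapsto> - z\<close> is a product of three shears.\<close>

lemma nn_integral_complex_rotate:
  fixes F :: "complex \<Rightarrow> ennreal"
  assumes F: "F \<in> borel_measurable borel" and w: "norm w = 1"
  shows "(\<integral>\<^sup>+z. F (w * z) \<partial>lborel) = (\<integral>\<^sup>+z. F z \<partial>lborel)"
proof -
  have *: "(\<integral>\<^sup>+z. G (v * z) \<partial>lborel) = (\<integral>\<^sup>+z. G z \<partial>lborel)"
    if [measurable]: "G \<in> borel_measurable borel" and v: "norm v = 1" "v \<noteq> -1" for G :: "complex \<Rightarrow> ennreal" and v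
  proof -
    have n: "(Re v)\<^sup>2 + (Im v)\<^sup>2 = 1"
      using v(1) by (metis cmod_power2 one_power2)
    have r: "1 + Re v \<noteq> 0"
    proof
      assume "1 + Re v = 0"
      then have "Re v = -1" by simp
      with n have "v = -1" by (simp add: complex_eq_iff)
      with v show False by simp
    qed
    \<comment> \<open>For \<open>v = cis x\<close> this is tan(x/2). Rotation by x is the horizontal
      shear by -tan(x/2), then the vertical shear by sin x, then the horizontal shear again;
      tan(x/2) is undefined exactly at v = -1, which is later reached as two quarter turns.\<close>
    define t where "t = Im v / (1 + Re v)"
    have ts: "t * Im v = 1 - Re v"
      using n r by (simp add: t_def field_simps power2_eq_square)
    have tc: "t * (1 + Re v) = Im v"
      using r by (simp add: t_def)
    define S where "S = (\<lambda>z. z + of_real ((-t) * Im z))"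
    define U where "U = (\<lambda>z. z + \<i> * of_real (Im v * Re z))"
    have [measurable]: "S \<in> borel_measurable borel" "U \<in> borel_measurable borel"
      unfolding S_def U_def by measurable
    have "v * z = S (U (S z))" for z
    proof -
      have "Im (v * z) = Im z + Im v * Re z - (t * Im v) * Im z"
        by (simp add: ts algebra_simps)
      then have im: "Im (v * z) = Im (U (S z))"
        by (simp add: S_def U_def algebra_simps)
      have "Re (S (U (S z))) = Re z - t * Im z - t * Im (U (S z))"
        by (simp add: S_def U_def algebra_simps)
      also have "\<dots> = Re z - t * Im z - t * (Re v * Im z + Im v * Re z)"
        by (simp add: im[symmetric])
      also have "\<dots> = Re z * (1 - t * Im v) - Im z * (t * (1 + Re v))"
        by (simp add: algebra_simps)
      also have "\<dots> = Re (v * z)" unfolding ts tc by (simp add: algebra_simps)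
      finally have "Re (v * z) = Re (S (U (S z)))" by simp
      moreover have "Im (S (U (S z))) = Im (U (S z))" by (simp add: S_def)
      ultimately show ?thesis using im by (simp add: complex_eq_iff)
    qed
    then have "(\<integral>\<^sup>+z. G (v * z) \<partial>lborel) = (\<integral>\<^sup>+z. G (S (U (S z))) \<partial>lborel)" by simp
    also have "\<dots> = (\<integral>\<^sup>+z. G (S (U z)) \<partial>lborel)"
      using nn_integral_complex_shear(1)[of "\<lambda>z. G (S (U z))" "-t"] by (simp add: S_def del: of_real_mult of_real_minus mult_minus_left)
    also have "\<dots> = (\<integral>\<^sup>+z. G (S z) \<partial>lborel)"
      using nn_integral_complex_shear(2)[of "\<lambda>z. G (S z)" "Im v"] by (simp add: U_def)
    also have "\<dots> = (\<integral>\<^sup>+z. G z \<partial>lborel)"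
      using nn_integral_complex_shear(1)[of "\<lambda>z. G z" "-t"] by (simp add: S_def)
    finally show ?thesis .
  qed
  show ?thesis
  proof (cases "w = -1")
    case True
    have "(\<integral>\<^sup>+z. F (w * z) \<partial>lborel) = (\<integral>\<^sup>+z. F (\<i> * (\<i> * z)) \<partial>lborel)"
      using True by (simp flip: mult.assoc)
    also have "\<dots> = (\<integral>\<^sup>+z. F (\<i> * z) \<partial>lborel)"
      by (rule *) (use F in \<open>auto simp: complex_eq_iff\<close>)
    also have "\<dots> = (\<integral>\<^sup>+z. F z \<partial>lborel)"
      by (rule *) (use F in \<open>auto simp: complex_eq_iff\<close>)
    finally show ?thesis .
  qed (use * F w in auto)
qed

text \<open>With \<open>w = cis a\<close> the angle runs through \<open>{a..<2*pi+a}\<close>; the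
  part beyond \<open>2*pi\<close> is moved back to \<open>{0..<a}\<close> by periodicity.\<close>

lemma nn_integral_circle_rotate:
  fixes F :: "complex \<Rightarrow> ennreal"
  assumes [measurable]: "F \<in> borel_measurable borel" and w: "norm w = 1"
  shows "(\<integral>\<^sup>+\<theta>\<in>{0..<2*pi}. F (w * cis \<theta>) \<partial>lborel) = (\<integral>\<^sup>+\<theta>\<in>{0..<2*pi}. F (cis \<theta>) \<partial>lborel)"
proof -
  define a where "a = Arg2pi w"
  have a: "0 \<le> a" "a < 2*pi" and wa: "w = cis a"
    using Arg2pi_ge_0[of w] Arg2pi_lt_2pi[of w] Arg2pi_eq[of w] w
    by (auto simp: a_def cis_conv_exp)
  have [measurable]: "cis \<in> borel_measurable borel"
    by (intro borel_measurable_continuous_onI continuous_intros)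
  have "(\<integral>\<^sup>+\<theta>\<in>{0..<2*pi}. F (w * cis \<theta>) \<partial>lborel)
      = (\<integral>\<^sup>+x. F (cis (a + 1 * x)) * indicator {a..<2*pi + a} (a + 1 * x) \<partial>lborel)"
    by (intro nn_integral_cong) (auto simp: wa cis_mult indicator_def)
  also have "\<dots> = (\<integral>\<^sup>+x. F (cis x) * indicator {a..<2*pi+a} x \<partial>lborel)"
    using nn_integral_real_affine[of "\<lambda>x. F (cis x) * indicator {a..<2*pi+a} x" 1 a] by simp
  also have "\<dots> = (\<integral>\<^sup>+x. F (cis x) * indicator {a..<2*pi} x + F (cis x) * indicator {2*pi..<2*pi+a} x \<partial>lborel)"
    using a by (intro nn_integral_cong) (auto simp: indicator_def)
  also have "\<dots> = (\<integral>\<^sup>+x. F (cis x) * indicator {a..<2*pi} x \<partial>lborel)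
                + (\<integral>\<^sup>+x. F (cis x) * indicator {2*pi..<2*pi+a} x \<partial>lborel)"
    by (rule nn_integral_add) measurable
  also have "(\<integral>\<^sup>+x. F (cis x) * indicator {2*pi..<2*pi+a} x \<partial>lborel)
      = (\<integral>\<^sup>+x. F (cis (2*pi + 1 * x)) * indicator {2*pi..<2*pi+a} (2*pi + 1 * x) \<partial>lborel)"
    using nn_integral_real_affine[of "\<lambda>x. F (cis x) * indicator {2*pi..<2*pi+a} x" 1 "2*pi"] by simp
  also have "\<dots> = (\<integral>\<^sup>+x. F (cis x) * indicator {0..<a} x \<partial>lborel)"
    by (intro nn_integral_cong) (auto simp: indicator_def simp flip: cis_mult)
  also have "(\<integral>\<^sup>+x. F (cis x) * indicator {a..<2*pi} x \<partial>lborel) + (\<integral>\<^sup>+x. F (cis x) * indicator {0..<a} x \<partial>lborel)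
     = (\<integral>\<^sup>+x. F (cis x) * indicator {a..<2*pi} x + F (cis x) * indicator {0..<a} x \<partial>lborel)"
    by (rule nn_integral_add[symmetric]) measurable
  also have "\<dots> = (\<integral>\<^sup>+\<theta>\<in>{0..<2*pi}. F (cis \<theta>) \<partial>lborel)"
    using a by (intro nn_integral_cong) (auto simp: indicator_def)
  finally show ?thesis .
qed

text \<open>Measures finite on the half-lines \<open>{x<..}\<close> are determined by them. The
  preimage of such a half-line is an annulus of area pi - pi y^2 with \<open>y = max 0 x\<close>,
  which is also the integral of 2 pi r over [y, 1].\<close>

lemma distr_norm_disc:
  "distr (restrict_space lborel (ball (0::complex) 1)) borel norm
     = density lborel (\<lambda>r. ennreal (2 * pi * r) * indicator {0..<1} r)" (is "?M = ?N")
proof (rule measure_eqI_lessThan)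
  have n: "norm \<in> borel_measurable (restrict_space lborel (ball (0::complex) 1))"
    by (rule measurable_restrict_space1) simp
  have M: "emeasure ?M {x<..} = emeasure lborel (ball (0::complex) 1 - cball 0 x)" for x
  proof -
    have "norm -` {x<..} \<inter> space (restrict_space lborel (ball (0::complex) 1)) = ball 0 1 - cball 0 x"
      by (auto simp: space_restrict_space)
    then show ?thesis
      by (simp add: emeasure_distr n emeasure_restrict_space)
  qed
  have vb: "emeasure lborel (ball (0::complex) 1) = ennreal pi"
    by (simp add: emeasure_ball unit_ball_vol_2)
  show "emeasure ?M {x<..} < \<infinity>" for x
  proof -
    have "emeasure lborel (ball (0::complex) 1 - cball 0 x) \<le> emeasure lborel (ball (0::complex) 1)"
      by (rule emeasure_mono) auto
    then show ?thesis unfolding M using vb by (simp add: order_le_less_trans)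
  qed
  show "emeasure ?M {x<..} = emeasure ?N {x<..}" for x
  proof -
    define y where "y = max 0 x"
    have N: "emeasure ?N {x<..} = (\<integral>\<^sup>+r. ennreal (2 * pi * r) * indicator {y..1} r \<partial>lborel)"
    proof -
      have ae: "AE r in lborel. r \<noteq> y \<and> r \<noteq> (1::real)"
        using AE_lborel_singleton[of y] AE_lborel_singleton[of "1::real"] by eventually_elim auto
      have "AE r in lborel. ennreal (2 * pi * r) * indicator {0..<1} r * indicator {x<..} r
          = ennreal (2 * pi * r) * indicator {y..1} r"
        using ae by eventually_elim (auto simp: indicator_def y_def max_def split: if_splits)
      then show ?thesis
        by (subst emeasure_density) (auto intro!: nn_integral_cong_AE)
    qed
    show ?thesis
    proof (cases "y < 1")
      case True
      have y: "0 \<le> y" by (simp add: y_def)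
      have eqb: "ball (0::complex) 1 - cball 0 x = (if x < 0 then ball 0 1 else ball 0 1 - cball 0 y)"
        by (auto simp: y_def)
      have "emeasure lborel (ball (0::complex) 1 - cball 0 y) = emeasure lborel (ball (0::complex) 1) - emeasure lborel (cball (0::complex) y)"
        using y True by (intro emeasure_Diff) (auto simp: emeasure_cball)
      also have "\<dots> = ennreal (pi - pi * y\<^sup>2)"
        using y by (subst vb) (simp add: emeasure_cball unit_ball_vol_2 ennreal_minus)
      finally have 1: "emeasure lborel (ball (0::complex) 1 - cball 0 x) = ennreal (pi - pi * y\<^sup>2)"
        unfolding eqb by (auto simp: vb y_def)
      have "(\<integral>\<^sup>+r. ennreal (2 * pi * r) * indicator {y..1} r \<partial>lborel) = ennreal (pi * 1\<^sup>2 - pi * y\<^sup>2)"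
        by (rule nn_integral_FTC_Icc) (use True y in \<open>auto intro!: derivative_eq_intros\<close>)
      then show ?thesis unfolding M N 1 by simp
    next
      case False
      have "ball (0::complex) 1 - cball 0 x = {}" using False by (auto simp: y_def max_def split: if_splits)
      moreover have "(\<integral>\<^sup>+r. ennreal (2 * pi * r) * indicator {y..1} r \<partial>lborel) = 0"
      proof -
        have "AE r in lborel. ennreal (2 * pi * r) * indicator {y..1} r = 0"
          using AE_lborel_singleton[of "1::real"] by eventually_elim (use False in \<open>auto simp: indicator_def\<close>)
        then show ?thesis by (subst nn_integral_0_iff_AE) auto
      qed
      ultimately show ?thesis unfolding M N by (simp only: emeasure_empty)
    qed
  qed
qed auto

lemma nn_integral_disc_radial:
  fixes g :: "real \<Rightarrow> ennreal"
  assumes [measurable]: "g \<in> borel_measurable borel"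
  shows "(\<integral>\<^sup>+z\<in>disc. g (norm z) \<partial>lborel) = (\<integral>\<^sup>+r\<in>{0..<1}. ennreal (2 * pi * r) * g r \<partial>lborel)"
proof -
  have n: "norm \<in> borel_measurable (restrict_space lborel (ball (0::complex) 1))"
    by (rule measurable_restrict_space1) simp
  have "(\<integral>\<^sup>+z\<in>disc. g (norm z) \<partial>lborel) = (\<integral>\<^sup>+z. g (norm z) \<partial>(restrict_space lborel (ball (0::complex) 1)))"
    by (simp add: disc_def nn_integral_restrict_space)
  also have "\<dots> = (\<integral>\<^sup>+r. g r \<partial>(distr (restrict_space lborel (ball (0::complex) 1)) borel norm))"
    by (simp add: nn_integral_distr n)
  also have "\<dots> = (\<integral>\<^sup>+r\<in>{0..<1}. ennreal (2 * pi * r) * g r \<partial>lborel)"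
    unfolding distr_norm_disc by (subst nn_integral_density) (auto simp: ac_simps)
  finally show ?thesis .
qed

text \<open>The integral over the disc equals its average over all rotated copies of
  \<open>F\<close>. Exchanging the two integrations puts the angular average \<open>J\<close>
  inside, which is a radial function, and the radial formula applies; both sides carry the factor 2
  pi, which is cancelled at the end.\<close>

lemma nn_integral_disc_polar:
  fixes F :: "complex \<Rightarrow> ennreal"
  assumes [measurable]: "F \<in> borel_measurable borel"
  shows "(\<integral>\<^sup>+z\<in>disc. F z \<partial>lborel)
    = (\<integral>\<^sup>+r\<in>{0..<1}. ennreal r * (\<integral>\<^sup>+\<theta>\<in>{0..<2*pi}. F (of_real r * cis \<theta>) \<partial>lborel) \<partial>lborel)"
proof -
  have [measurable]: "cis \<in> borel_measurable borel"
    by (intro borel_measurable_continuous_onI continuous_intros)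
  have [measurable]: "disc \<in> sets borel" by (simp add: disc_def)
  define J where "J = (\<lambda>z. \<integral>\<^sup>+\<theta>\<in>{0..<2*pi}. F (z * cis \<theta>) \<partial>lborel)"
  have J[measurable]: "J \<in> borel_measurable borel"
    unfolding J_def by measurable
  have Jr: "J z = J (of_real (norm z))" for z
  proof (cases "z = 0")
    case False
    define w where "w = z / of_real (norm z)"
    have w: "norm w = 1" "z = of_real (norm z) * w" using False by (auto simp: w_def norm_divide)
    have "J (of_real (norm z) * w) = J (of_real (norm z))"
      unfolding J_def mult.assoc using nn_integral_circle_rotate[of "\<lambda>v. F (of_real (norm z) * v)" w] w(1) by simp
    then show ?thesis using w(2) by simp
  qed simp
  have "ennreal (2*pi) * (\<integral>\<^sup>+z\<in>disc. F z \<partial>lborel) = (\<integral>\<^sup>+\<theta>\<in>{0..<2*pi}. (\<integral>\<^sup>+z\<in>disc. F z \<partial>lborel) \<partial>lborel)"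
    by (subst nn_integral_cmult_indicator) (auto simp: mult.commute)
  also have "\<dots> = (\<integral>\<^sup>+\<theta>\<in>{0..<2*pi}. (\<integral>\<^sup>+z\<in>disc. F (z * cis \<theta>) \<partial>lborel) \<partial>lborel)"
  proof (intro nn_integral_cong)
    fix \<theta>
    have "(\<integral>\<^sup>+z\<in>disc. F z \<partial>lborel) = (\<integral>\<^sup>+z. F (cis \<theta> * z) * indicator disc (cis \<theta> * z) \<partial>lborel)"
      by (subst nn_integral_complex_rotate) auto
    also have "\<dots> = (\<integral>\<^sup>+z\<in>disc. F (z * cis \<theta>) \<partial>lborel)"
      by (intro nn_integral_cong) (auto simp: indicator_def disc_def norm_mult mult.commute)
    finally show "(\<integral>\<^sup>+z\<in>disc. F z \<partial>lborel) * indicator {0..<2*pi} \<theta>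
       = (\<integral>\<^sup>+z\<in>disc. F (z * cis \<theta>) \<partial>lborel) * indicator {0..<2*pi} \<theta>" by simp
  qed
  also have "\<dots> = (\<integral>\<^sup>+\<theta>. (\<integral>\<^sup>+z. F (z * cis \<theta>) * indicator {0..<2*pi} \<theta> * indicator disc z \<partial>lborel) \<partial>lborel)"
    by (subst nn_integral_multc[symmetric]) (auto simp: ac_simps)
  also have "\<dots> = (\<integral>\<^sup>+z. (\<integral>\<^sup>+\<theta>. F (z * cis \<theta>) * indicator {0..<2*pi} \<theta> * indicator disc z \<partial>lborel) \<partial>lborel)"
    by (rule lborel_pair.Fubini') measurable
  also have "\<dots> = (\<integral>\<^sup>+z\<in>disc. J (of_real (norm z)) \<partial>lborel)"
    by (subst Jr[symmetric], subst nn_integral_multc) (auto simp: J_def)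
  also have "\<dots> = (\<integral>\<^sup>+r\<in>{0..<1}. ennreal (2 * pi * r) * J (of_real r) \<partial>lborel)"
    by (rule nn_integral_disc_radial) measurable
  also have "\<dots> = (\<integral>\<^sup>+r. ennreal (2 * pi) * (ennreal r * J (of_real r) * indicator {0..<1} r) \<partial>lborel)"
    by (intro nn_integral_cong) (auto simp: ennreal_mult indicator_def ac_simps)
  also have "\<dots> = ennreal (2 * pi) * (\<integral>\<^sup>+r\<in>{0..<1}. ennreal r * J (of_real r) \<partial>lborel)"
    by (rule nn_integral_cmult) measurable
  finally show ?thesis
    unfolding J_def
    by (subst (asm) ennreal_mult_cancel_left) (use pi_gt_zero in \<open>auto simp: ennreal_eq_0_iff\<close>)
qed

section \<open>Circular means of holomorphic functions\<close>

text \<open>Multiplied by w this function gives |w|^p, so composed with f it is the norming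
  functional of f on a circle. For p < 2 its second factor blows up at 0, but the product has
  modulus |w|^(p-1), which tends to 0 as p > 1.\<close>

lemma continuous_on_conj_powr:
  assumes "1 < (p::real)"
  shows "continuous_on UNIV (\<lambda>w::complex. cnj w * of_real (norm w powr (p - 2)))"
  unfolding continuous_on_eq_continuous_at[OF open_UNIV]
proof
  fix w :: complex
  show "isCont (\<lambda>w. cnj w * of_real (norm w powr (p - 2))) w"
  proof (cases "w = 0")
    case True
    have eq: "norm (cnj w * of_real (norm w powr (p - 2))) = norm w powr (p - 1)" for w :: complex
      by (cases "w = 0") (auto simp: norm_mult powr_mult_base)
    have "((\<lambda>w::complex. norm w powr (p - 1)) \<longlongrightarrow> norm (0::complex) powr (p - 1)) (at 0)"
      by (intro tendsto_intros) (use assms in auto)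
    then have "((\<lambda>w::complex. norm (cnj w * of_real (norm w powr (p - 2)))) \<longlongrightarrow> 0) (at 0)"
      unfolding eq using assms by simp
    then have "((\<lambda>w::complex. cnj w * of_real (norm w powr (p - 2))) \<longlongrightarrow> 0) (at 0)"
      by (rule tendsto_norm_zero_cancel)
    then show ?thesis using True by (simp add: isCont_def)
  next
    case False
    then show ?thesis by (intro continuous_intros) auto
  qed
qed

lemma Young_powr_minus_1:
  fixes a c p :: real
  assumes "1 < p" "0 \<le> a" "0 \<le> c"
  shows "a * c powr (p - 1) \<le> a powr p / p + (1 - 1/p) * c powr p"
proof -
  have "a * c powr (p - 1) \<le> a powr p / p + (c powr (p - 1)) powr (p / (p - 1)) / (p / (p - 1))"
    by (rule Youngs_inequality) (use assms in \<open>auto simp: field_simps\<close>)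
  also have "\<dots> = a powr p / p + (1 - 1/p) * c powr p"
  proof -
    have "(c powr (p - 1)) powr (p / (p - 1)) = c powr p" using assms by (simp add: powr_powr)
    then show ?thesis using assms by (simp add: field_simps)
  qed
  finally show ?thesis .
qed

definition circle_mean :: "real \<Rightarrow> (complex \<Rightarrow> complex) \<Rightarrow> real \<Rightarrow> ennreal" where
  "circle_mean p f r = (\<integral>\<^sup>+\<theta>\<in>{0..<2*pi}. ennreal (norm (f (of_real r * cis \<theta>)) powr p) \<partial>lborel)"

lemma continuous_on_circle_powr:
  assumes f: "f holomorphic_on ball 0 R" and z: "norm z < R" and p: "0 < p"
  shows "continuous_on A (\<lambda>\<theta>. norm (f (z * cis \<theta>)) powr p)"
proof -
  have "continuous_on A (\<lambda>\<theta>. f (z * cis \<theta>))"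
    by (rule continuous_on_compose2[OF holomorphic_on_imp_continuous_on[OF f]])
      (use z in \<open>auto intro!: continuous_intros simp: norm_mult\<close>)
  then show ?thesis
    by (intro continuous_on_powr' continuous_intros) (use p in auto)
qed

text \<open>The left side depends on \<open>norm z\<close> only. By rotation invariance the right
  side may start at any point of the circle, so it is constant on \<open>norm z = \<rho>\<close>;
  the maximum principle argument for circular means relies on this.\<close>

lemma circle_mean_eq_integral:
  assumes f: "f holomorphic_on ball 0 R" and z: "norm z < R" and p: "0 < p"
  shows "circle_mean p f (norm z) = ennreal (integral {0..2*pi} (\<lambda>\<theta>. norm (f (z * cis \<theta>)) powr p))"
proof -
  have c: "continuous_on A (\<lambda>\<theta>. norm (f (z * cis \<theta>)) powr p)" for A
    by (rule continuous_on_circle_powr[OF f z p])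
  have "((\<lambda>\<theta>. norm (f (z * cis \<theta>)) powr p) has_integral integral {0..2*pi} (\<lambda>\<theta>. norm (f (z * cis \<theta>)) powr p)) {0..2*pi}"
    using integrable_continuous_interval[OF c] by (rule integrable_integral)
  from nn_integral_has_integral_lebesgue'[OF _ this]
  have 1: "(\<integral>\<^sup>+\<theta>\<in>{0..2*pi}. ennreal (norm (f (z * cis \<theta>)) powr p) \<partial>lborel)
     = ennreal (integral {0..2*pi} (\<lambda>\<theta>. norm (f (z * cis \<theta>)) powr p))" by simp
  have "AE \<theta> in lborel. ennreal (norm (f (z * cis \<theta>)) powr p) * indicator {0..2*pi} \<theta>
     = ennreal (norm (f (z * cis \<theta>)) powr p) * indicator {0..<2*pi} \<theta>"
    using AE_lborel_singleton[of "2*pi"] by eventually_elim (auto simp: indicator_def)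
  then have 2: "(\<integral>\<^sup>+\<theta>\<in>{0..2*pi}. ennreal (norm (f (z * cis \<theta>)) powr p) \<partial>lborel)
     = (\<integral>\<^sup>+\<theta>\<in>{0..<2*pi}. ennreal (norm (f (z * cis \<theta>)) powr p) \<partial>lborel)"
    by (rule nn_integral_cong_AE)
  \<comment> \<open>Rotation invariance is stated for Borel functions on the plane, so the integrand
    is extended by 0 outside the closed unit disc.\<close>
  define F where "F = (\<lambda>v. ennreal (indicator (cball 0 1) v *\<^sub>R norm (f (of_real (norm z) * v)) powr p))"
  have "continuous_on (cball 0 1) (\<lambda>v. f (of_real (norm z) * v))"
  proof (rule continuous_on_compose2[OF holomorphic_on_imp_continuous_on[OF f]])
    show "(\<lambda>v. complex_of_real (norm z) * v) ` cball 0 1 \<subseteq> ball 0 R"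
    proof clarify
      fix v :: complex assume "v \<in> cball 0 1"
      then have "norm z * norm v \<le> norm z" by (intro mult_left_le) auto
      then show "complex_of_real (norm z) * v \<in> ball 0 R" using z by (simp add: norm_mult)
    qed
  qed (intro continuous_intros)
  then have "continuous_on (cball 0 1) (\<lambda>v. norm (f (of_real (norm z) * v)) powr p)"
    by (intro continuous_on_powr' continuous_intros) (use p in auto)
  then have F: "F \<in> borel_measurable borel"
    unfolding F_def by (intro measurable_compose[OF borel_measurable_continuous_on_indicator]) auto
  define w where "w = (if z = 0 then 1 else z / of_real (norm z))"
  have w: "norm w = 1" "z = of_real (norm z) * w" by (auto simp: w_def norm_divide)
  have "circle_mean p f (norm z) = (\<integral>\<^sup>+\<theta>\<in>{0..<2*pi}. F (cis \<theta>) \<partial>lborel)"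
    unfolding circle_mean_def F_def by (intro nn_integral_cong) (auto simp: indicator_def)
  also have "\<dots> = (\<integral>\<^sup>+\<theta>\<in>{0..<2*pi}. F (w * cis \<theta>) \<partial>lborel)"
    by (rule nn_integral_circle_rotate[OF F w(1), symmetric])
  also have "\<dots> = (\<integral>\<^sup>+\<theta>\<in>{0..<2*pi}. ennreal (norm (f (z * cis \<theta>)) powr p) \<partial>lborel)"
    unfolding F_def mult.assoc[symmetric] w(2)[symmetric]
    by (intro nn_integral_cong) (use w in \<open>auto simp: indicator_def norm_mult\<close>)
  finally show ?thesis using 1 2 by simp
qed

text \<open>Hardy's convexity theorem by duality: testing \<open>z \<mapsto> f(z exp(i\<theta>))\<close> against the function of \<open>\<theta>\<close>
  that norms the circle of radius \<open>r\<close> gives a holomorphic function of \<open>z\<close>, to which the maximum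
  principle applies.\<close>

lemma circle_mean_mono:
  assumes f: "f holomorphic_on ball 0 R" and p: "1 < p" and r: "0 \<le> r" "r \<le> \<rho>" "\<rho> < R"
  shows "circle_mean p f r \<le> circle_mean p f \<rho>"
proof -
  define I where "I = (\<lambda>z. integral {0..2*pi} (\<lambda>\<theta>. norm (f (z * cis \<theta>)) powr p))"
  have cm: "circle_mean p f (norm z) = ennreal (I z)" if "norm z < R" for z
    using circle_mean_eq_integral[OF f that] p by (simp add: I_def)
  have I0: "0 \<le> I z" for z 
    unfolding I_def
    by (cases "(\<lambda>\<theta>. norm (f (z * cis \<theta>)) powr p) integrable_on {0..2*pi}")
      (auto intro: integral_nonneg simp: not_integrable_integral)
  define g where "g = (\<lambda>\<theta>. (\<lambda>w. cnj w * of_real (norm w powr (p - 2))) (f (of_real r * cis \<theta>)))"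
  have cf: "continuous_on A (\<lambda>\<theta>. f (z * cis \<theta>))" if "norm z < R" for A z
    by (rule continuous_on_compose2[OF holomorphic_on_imp_continuous_on[OF f]])
      (use that in \<open>auto intro!: continuous_intros simp: norm_mult\<close>)
  have cg: "continuous_on A g" for A
    unfolding g_def by (rule continuous_on_compose2[OF continuous_on_conj_powr[OF p] cf]) (use r in auto)
  have ng: "norm (g \<theta>) = norm (f (of_real r * cis \<theta>)) powr (p - 1)" for \<theta>
    unfolding g_def by (cases "f (of_real r * cis \<theta>) = 0") (auto simp: norm_mult powr_mult_base)
  have fg: "f (of_real r * cis \<theta>) * g \<theta> = of_real (norm (f (of_real r * cis \<theta>)) powr p)" for \<theta>
  proof -
    have "w * (cnj w * of_real (norm w powr (p - 2))) = of_real (norm w powr p)" for w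
    proof (cases "w = 0")
      case False
      have "w * (cnj w * of_real (norm w powr (p - 2))) = of_real ((norm w)\<^sup>2 * norm w powr (p - 2))"
        by (simp only: of_real_mult complex_norm_square mult.assoc)
      also have "(norm w)\<^sup>2 * norm w powr (p - 2) = norm w powr p"
        using False powr_add[of "norm w" 2 "p - 2"] by simp
      finally show ?thesis .
    qed simp
    then show ?thesis by (simp add: g_def)
  qed
  define G where "G = (\<lambda>z. integral (cbox 0 (2*pi)) (\<lambda>\<theta>. f (z * cis \<theta>) * g \<theta>))"
  have G: "G holomorphic_on ball 0 R"
    unfolding G_def
  proof (rule leibniz_rule_holomorphic)
    fix z :: complex and t :: real assume z: "z \<in> ball 0 R"
    have "(f has_field_derivative deriv f (z * cis t)) (at (z * cis t))"
      by (rule holomorphic_derivI[OF f]) (use z in \<open>auto simp: norm_mult\<close>)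
    then have "((\<lambda>z. f (z * cis t)) has_field_derivative deriv f (z * cis t) * (1 * cis t)) (at z)"
      by (rule DERIV_chain2) (auto intro!: derivative_eq_intros)
    then have "((\<lambda>z. f (z * cis t) * g t) has_field_derivative deriv f (z * cis t) * (1 * cis t) * g t) (at z)"
      by (rule DERIV_cmult_right)
    then show "((\<lambda>z. f (z * cis t) * g t) has_field_derivative deriv f (z * cis t) * cis t * g t) (at z within ball 0 R)"
      by (simp add: has_field_derivative_at_within)
  next
    fix z :: complex assume z: "z \<in> ball 0 R"
    show "(\<lambda>\<theta>. f (z * cis \<theta>) * g \<theta>) integrable_on cbox 0 (2*pi)"
      by (intro integrable_continuous continuous_on_mult cf cg) (use z in auto)
  next
    have d: "continuous_on (ball 0 R) (deriv f)"
      by (rule holomorphic_on_imp_continuous_on[OF holomorphic_deriv[OF f]]) simp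
    have "continuous_on (ball 0 R \<times> cbox 0 (2*pi)) (\<lambda>x. deriv f (fst x * cis (snd x)) * cis (snd x) * g (snd x))"
      by (intro continuous_on_mult continuous_on_compose2[OF d] continuous_on_compose2[OF cg[of UNIV]] continuous_intros)
        (auto simp: norm_mult)
    then show "continuous_on (ball 0 R \<times> cbox 0 (2*pi)) (\<lambda>(z, t). deriv f (z * cis t) * cis t * g t)"
      by (simp add: case_prod_beta)
  qed simp
  have bound: "norm (G z) \<le> I (of_real \<rho>) / p + (1 - 1/p) * I (of_real r)" if z: "norm z = \<rho>" for z
  proof -
    have zR: "norm z < R" using z r by simp
    have "norm (G z) \<le> integral (cbox 0 (2*pi)) (\<lambda>\<theta>. norm (f (z * cis \<theta>)) powr p / p + (1 - 1/p) * norm (f (of_real r * cis \<theta>)) powr p)"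
      unfolding G_def
    proof (rule integral_norm_bound_integral)
      show "(\<lambda>\<theta>. f (z * cis \<theta>) * g \<theta>) integrable_on cbox 0 (2*pi)"
        by (intro integrable_continuous continuous_on_mult cf cg zR)
      show "(\<lambda>\<theta>. norm (f (z * cis \<theta>)) powr p / p + (1 - 1/p) * norm (f (of_real r * cis \<theta>)) powr p) integrable_on cbox 0 (2*pi)"
        by (intro integrable_continuous continuous_intros continuous_on_circle_powr[OF f]) (use zR r p in auto)
      show "norm (f (z * cis \<theta>) * g \<theta>) \<le> norm (f (z * cis \<theta>)) powr p / p + (1 - 1/p) * norm (f (of_real r * cis \<theta>)) powr p" for \<theta>
        unfolding norm_mult ng by (rule Young_powr_minus_1) (use p in auto)
    qed
    also have "\<dots> = I z / p + (1 - 1/p) * I (of_real r)"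
    proof -
      have "(\<lambda>\<theta>. norm (f (v * cis \<theta>)) powr p) integrable_on {0..2*pi}" if "norm v < R" for v
        by (intro integrable_continuous_interval continuous_on_circle_powr[OF f]) (use that p in auto)
      from this[of z] this[of "of_real r"] show ?thesis
        unfolding I_def using zR r by (subst integral_add) (auto simp: divide_inverse intro: integrable_on_mult_left integrable_on_mult_right)
    qed
    also have "I z = I (of_real \<rho>)"
    proof -
      have "ennreal (I z) = ennreal (I (of_real \<rho>))"
        using cm[of z] cm[of "of_real \<rho>"] z r by simp
      then show ?thesis using I0 by simp
    qed
    finally show ?thesis .
  qed
  have "norm (G (of_real r)) \<le> I (of_real \<rho>) / p + (1 - 1/p) * I (of_real r)"
  proof (rule maximum_modulus_frontier[of G "cball 0 \<rho>"])
    show "G holomorphic_on interior (cball 0 \<rho>)"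
      by (rule holomorphic_on_subset[OF G]) (use r in auto)
    show "continuous_on (closure (cball 0 \<rho>)) G"
      by (rule continuous_on_subset[OF holomorphic_on_imp_continuous_on[OF G]]) (use r in auto)
    show "norm (G z) \<le> I (of_real \<rho>) / p + (1 - 1/p) * I (of_real r)" if "z \<in> frontier (cball 0 \<rho>)" for z
      using that by (intro bound) (simp add: frontier_cball)
  qed (use r in auto)
  moreover have "G (of_real r) = of_real (I (of_real r))"
  proof -
    have "G (of_real r) = integral {0..2*pi} (of_real \<circ> (\<lambda>\<theta>. norm (f (of_real r * cis \<theta>)) powr p))"
      unfolding G_def fg by (simp add: comp_def)
    also have "\<dots> = of_real (I (of_real r))"
      unfolding I_def by (intro integral_linear integrable_continuous_interval continuous_on_circle_powr[OF f] bounded_linear_of_real) (use r p in auto)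
    finally show ?thesis .
  qed
  \<comment> \<open>Young's inequality leaves I(r) on both sides; its coefficient 1 - 1/p on the
    right is below 1, and absorbing it leaves the factor 1/p on either side.\<close>
  ultimately have "I (of_real r) \<le> I (of_real \<rho>) / p + (1 - 1/p) * I (of_real r)"
    using I0 by simp
  then have "I (of_real r) / p \<le> I (of_real \<rho>) / p" by (simp add: algebra_simps)
  then have "I (of_real r) \<le> I (of_real \<rho>)" using p by (simp add: divide_le_cancel)
  then show ?thesis
    using cm[of "of_real r"] cm[of "of_real \<rho>"] r by (simp add: ennreal_leI)
qed

section \<open>Area means: subharmonicity of |f|^p and local bounds for derivatives\<close>

lemma borel_measurable_powr_indicator:
  fixes f :: "complex \<Rightarrow> complex"
  assumes "continuous_on A f" "A \<in> sets borel"
  shows "(\<lambda>z. ennreal (norm (f z) powr p) * indicator A z) \<in> borel_measurable borel"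
proof -
  have [measurable]: "(\<lambda>z. indicator A z *\<^sub>R f z) \<in> borel_measurable borel" "A \<in> sets borel"
    using borel_measurable_continuous_on_indicator assms by auto
  have "(\<lambda>z. ennreal (norm (indicator A z *\<^sub>R f z) powr p) * indicator A z) \<in> borel_measurable borel"
    by measurable
  then show ?thesis
    by (rule back_subst[of "\<lambda>h. h \<in> borel_measurable borel"]) (auto simp: indicator_def fun_eq_iff)
qed

lemma nn_integral_disc_powr_polar:
  fixes g :: "real \<Rightarrow> ennreal"
  assumes f: "continuous_on disc f" and [measurable]: "g \<in> borel_measurable borel"
  shows "(\<integral>\<^sup>+z\<in>disc. ennreal (norm (f z) powr p) * g (norm z) \<partial>lborel)
    = (\<integral>\<^sup>+r\<in>{0..<1}. ennreal r * g r * circle_mean p f r \<partial>lborel)"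
proof -
  have [measurable]: "cis \<in> borel_measurable borel"
    by (intro borel_measurable_continuous_onI continuous_intros)
  have [measurable]: "(\<lambda>z. ennreal (norm (f z) powr p) * indicator disc z) \<in> borel_measurable borel"
    by (rule borel_measurable_powr_indicator[OF f]) (simp add: disc_def)
  define F where "F = (\<lambda>z. ennreal (norm (f z) powr p) * indicator disc z * g (norm z))"
  have F: "F \<in> borel_measurable borel" unfolding F_def by measurable
  have "(\<integral>\<^sup>+z\<in>disc. ennreal (norm (f z) powr p) * g (norm z) \<partial>lborel) = (\<integral>\<^sup>+z\<in>disc. F z \<partial>lborel)"
    by (intro nn_integral_cong) (auto simp: F_def indicator_def)
  also have "\<dots> = (\<integral>\<^sup>+r\<in>{0..<1}. ennreal r * (\<integral>\<^sup>+\<theta>\<in>{0..<2*pi}. F (of_real r * cis \<theta>) \<partial>lborel) \<partial>lborel)"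
    by (rule nn_integral_disc_polar[OF F])
  also have "\<dots> = (\<integral>\<^sup>+r\<in>{0..<1}. ennreal r * g r * circle_mean p f r \<partial>lborel)"
  proof (rule nn_integral_cong)
    fix r :: real
    show "ennreal r * (\<integral>\<^sup>+\<theta>\<in>{0..<2*pi}. F (of_real r * cis \<theta>) \<partial>lborel) * indicator {0..<1} r
       = ennreal r * g r * circle_mean p f r * indicator {0..<1} r"
    proof (cases "0 \<le> r \<and> r < 1")
      case True
      have "(\<integral>\<^sup>+\<theta>\<in>{0..<2*pi}. F (of_real r * cis \<theta>) \<partial>lborel)
         = (\<integral>\<^sup>+\<theta>. g r * (ennreal (norm (f (of_real r * cis \<theta>)) powr p) * indicator disc (of_real r * cis \<theta>) * indicator {0..<2*pi} \<theta>) \<partial>lborel)"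
        using True by (intro nn_integral_cong) (auto simp: F_def indicator_def norm_mult ac_simps)
      also have "\<dots> = g r * (\<integral>\<^sup>+\<theta>. ennreal (norm (f (of_real r * cis \<theta>)) powr p) * indicator disc (of_real r * cis \<theta>) * indicator {0..<2*pi} \<theta> \<partial>lborel)"
        by (rule nn_integral_cmult) measurable
      also have "\<dots> = g r * circle_mean p f r"
        unfolding circle_mean_def using True
        by (intro arg_cong2[where f="(*)"] refl nn_integral_cong) (auto simp: indicator_def norm_mult disc_def)
      finally show ?thesis by (simp add: mult.assoc)
    qed auto
  qed
  finally show ?thesis .
qed

lemma nn_integral_ball_affine:
  fixes F :: "complex \<Rightarrow> ennreal"
  assumes [measurable]: "F \<in> borel_measurable borel" and d: "0 < d"
  shows "(\<integral>\<^sup>+z\<in>ball w d. F z \<partial>lborel) = ennreal (d\<^sup>2) * (\<integral>\<^sup>+z\<in>disc. F (w + d *\<^sub>R z) \<partial>lborel)"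
proof -
  have [measurable]: "ball w d \<in> sets borel" by simp
  have "(\<integral>\<^sup>+z\<in>ball w d. F z \<partial>lborel)
     = (\<integral>\<^sup>+z. ennreal (d\<^sup>2) * (F (w + d *\<^sub>R z) * indicator (ball w d) (w + d *\<^sub>R z)) \<partial>lborel)"
    by (subst lborel_affine[of d w])
      (use d in \<open>auto simp: nn_integral_density nn_integral_distr\<close>)
  also have "\<dots> = ennreal (d\<^sup>2) * (\<integral>\<^sup>+z. F (w + d *\<^sub>R z) * indicator (ball w d) (w + d *\<^sub>R z) \<partial>lborel)"
    by (rule nn_integral_cmult) measurable
  also have "(\<integral>\<^sup>+z. F (w + d *\<^sub>R z) * indicator (ball w d) (w + d *\<^sub>R z) \<partial>lborel) = (\<integral>\<^sup>+z\<in>disc. F (w + d *\<^sub>R z) \<partial>lborel)"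
    using d by (intro nn_integral_cong) (auto simp: indicator_def disc_def dist_norm)
  finally show ?thesis .
qed

text \<open>Subharmonicity of |f|^p: after rescaling to the unit disc, compare each circular mean
  with the degenerate one of radius 0, which is 2 pi |f(w)|^p, and integrate in r.\<close>

lemma powr_norm_submean:
  assumes f: "f holomorphic_on ball w d" and d: "0 < d" and p: "1 < p"
  shows "ennreal (pi * d\<^sup>2) * ennreal (norm (f w) powr p) \<le> (\<integral>\<^sup>+z\<in>ball w d. ennreal (norm (f z) powr p) \<partial>lborel)"
proof -
  define h where "h = (\<lambda>z. f (w + d *\<^sub>R z))"
  have "h holomorphic_on ball 0 1"
    unfolding h_def scaleR_conv_of_real
    by (rule holomorphic_on_compose_gen[of "\<lambda>z. w + of_real d * z" _ f, unfolded comp_def, OF _ f])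
      (use d in \<open>auto intro!: holomorphic_intros simp: dist_norm norm_mult\<close>)
  note h = this
  have hd: "continuous_on disc h" using holomorphic_on_imp_continuous_on[OF h] by (simp add: disc_def)
  have m: "(\<lambda>z. ennreal (norm (f z) powr p) * indicator (ball w d) z) \<in> borel_measurable borel"
    by (rule borel_measurable_powr_indicator[OF holomorphic_on_imp_continuous_on[OF f]]) simp
  have "(\<integral>\<^sup>+r\<in>{0..<1}. ennreal r * ennreal (2 * pi * norm (h 0) powr p) \<partial>lborel)
      \<le> (\<integral>\<^sup>+r\<in>{0..<1}. ennreal r * 1 * circle_mean p h r \<partial>lborel)"
  proof (rule nn_integral_mono)
    fix r :: real
    have "ennreal (2 * pi * norm (h 0) powr p) = circle_mean p h 0"
      unfolding circle_mean_def using nn_integral_cmult_indicator[of "{0..<2*pi}" lborel "ennreal (norm (h 0) powr p)"] 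
      by (simp add: ennreal_mult[symmetric] mult.commute)
    also have "circle_mean p h 0 \<le> circle_mean p h r" if "0 \<le> r" "r < 1"
      by (rule circle_mean_mono[OF h p]) (use that in auto)
    finally show "ennreal r * ennreal (2 * pi * norm (h 0) powr p) * indicator {0..<1} r
      \<le> ennreal r * 1 * circle_mean p h r * indicator {0..<1} r"
      by (auto simp: indicator_def intro!: mult_left_mono)
  qed
  also have "\<dots> = (\<integral>\<^sup>+z\<in>disc. ennreal (norm (h z) powr p) * 1 \<partial>lborel)"
    by (rule nn_integral_disc_powr_polar[OF hd, symmetric]) simp
  finally have 1: "(\<integral>\<^sup>+r\<in>{0..<1}. ennreal r * ennreal (2 * pi * norm (h 0) powr p) \<partial>lborel)
      \<le> (\<integral>\<^sup>+z\<in>disc. ennreal (norm (h z) powr p) \<partial>lborel)" by simp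
  have "(\<integral>\<^sup>+r\<in>{0..<1}. ennreal r * ennreal (2 * pi * norm (h 0) powr p) \<partial>lborel)
     = (\<integral>\<^sup>+r\<in>{0..<1}. ennreal (2 * pi * r) * ennreal (norm (h 0) powr p) \<partial>lborel)"
    by (intro nn_integral_cong) (auto simp: indicator_def ac_simps simp flip: ennreal_mult)
  also have "\<dots> = (\<integral>\<^sup>+z\<in>disc. ennreal (norm (h 0) powr p) \<partial>lborel)"
    by (rule nn_integral_disc_radial[symmetric]) simp
  also have "\<dots> = ennreal pi * ennreal (norm (h 0) powr p)"
    by (subst nn_integral_cmult_indicator) (auto simp: disc_def emeasure_ball unit_ball_vol_2 mult.commute)
  finally have 2: "ennreal pi * ennreal (norm (f w) powr p) \<le> (\<integral>\<^sup>+z\<in>disc. ennreal (norm (h z) powr p) \<partial>lborel)"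
    using 1 by (simp add: h_def)
  have "(\<integral>\<^sup>+z\<in>ball w d. ennreal (norm (f z) powr p) \<partial>lborel)
     = (\<integral>\<^sup>+z\<in>ball w d. (ennreal (norm (f z) powr p) * indicator (ball w d) z) \<partial>lborel)"
    by (intro nn_integral_cong) (auto simp: indicator_def)
  also have "\<dots> = ennreal (d\<^sup>2) * (\<integral>\<^sup>+z\<in>disc. (ennreal (norm (f (w + d *\<^sub>R z)) powr p) * indicator (ball w d) (w + d *\<^sub>R z)) \<partial>lborel)"
    by (rule nn_integral_ball_affine[OF m d])
  also have "\<dots> = ennreal (d\<^sup>2) * (\<integral>\<^sup>+z\<in>disc. ennreal (norm (h z) powr p) \<partial>lborel)"
    using d by (intro arg_cong[where f="\<lambda>x. ennreal (d\<^sup>2) * x"] nn_integral_cong)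
      (auto simp: h_def indicator_def dist_norm disc_def)
  finally have "(\<integral>\<^sup>+z\<in>ball w d. ennreal (norm (f z) powr p) \<partial>lborel) = \<dots>" .
  then show ?thesis
    using mult_left_mono[OF 2, of "ennreal (d\<^sup>2)"] by (simp add: ennreal_mult ac_simps)
qed

text \<open>Cauchy's inequality on the circle of radius d/2 about w. Each point y of it has
  \<open>ball y (d/2)\<close> inside \<open>ball w d\<close>, so the submean property bounds
  |f(y)|^p by 4 / (pi d^2) times the integral. The power of d combines -2 from the area with -kp
  from Cauchy.\<close>

lemma higher_deriv_powr_le_integral:
  assumes f: "f holomorphic_on ball w d" and d: "0 < d" and p: "1 < p"
  shows "ennreal (norm ((deriv ^^ k) f w) powr p)
     \<le> ennreal ((fact k * 2 ^ k) powr p * 4 / pi * d powr (- (2 + k * p))) * (\<integral>\<^sup>+z\<in>ball w d. ennreal (norm (f z) powr p) \<partial>lborel)"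
proof -
  define X where "X = (\<integral>\<^sup>+z\<in>ball w d. ennreal (norm (f z) powr p) \<partial>lborel)"
  have pos: "0 < (fact k * 2 ^ k) powr p * 4 / pi * d powr (- (2 + k * p))"
    using d by simp
  show ?thesis
  proof (cases "X = \<infinity>")
    case True
    then show ?thesis using pos d by (simp add: X_def[symmetric] ennreal_mult_top)
  next
    case False
    define x where "x = enn2real X"
    have x: "X = ennreal x" "0 \<le> x" using False by (auto simp: x_def less_top)
    define B where "B = (4 * x / (pi * d\<^sup>2)) powr (1 / p)"
    have bound: "norm (f y) \<le> B" if y: "norm (w - y) = d / 2" for y
    proof -
      have sub: "ball y (d/2) \<subseteq> ball w d"
      proof
        fix z assume "z \<in> ball y (d/2)"
        then have "dist w z < d" using y dist_triangle[of w z y] by (simp add: dist_norm)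
        then show "z \<in> ball w d" by simp
      qed
      have "ennreal (pi * (d/2)\<^sup>2) * ennreal (norm (f y) powr p) \<le> (\<integral>\<^sup>+z\<in>ball y (d/2). ennreal (norm (f z) powr p) \<partial>lborel)"
        by (rule powr_norm_submean[OF holomorphic_on_subset[OF f sub]]) (use d p in auto)
      also have "\<dots> \<le> X" unfolding X_def
        by (intro nn_integral_mono) (use sub in \<open>auto simp: indicator_def\<close>)
      finally have "pi * (d/2)\<^sup>2 * norm (f y) powr p \<le> x"
        using x by (simp flip: ennreal_mult)
      then have "norm (f y) powr p \<le> 4 * x / (pi * d\<^sup>2)"
        using d by (simp add: field_simps)
      then have "(norm (f y) powr p) powr (1/p) \<le> B"
        unfolding B_def by (intro powr_mono2) (use p in auto)
      then show ?thesis using p by (simp add: powr_powr)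
    qed
    have B: "0 \<le> B" by (simp add: B_def)
    have sub: "cball w (d/2) \<subseteq> ball w d" using d by (auto simp: subset_iff)
    have "norm ((deriv ^^ k) f w) \<le> fact k * B / (d/2) ^ k"
    proof (rule Cauchy_inequality)
      show "f holomorphic_on ball w (d/2)" by (rule holomorphic_on_subset[OF f]) (use d in auto)
      show "continuous_on (cball w (d/2)) f"
        by (rule continuous_on_subset[OF holomorphic_on_imp_continuous_on[OF f] sub])
    qed (use d bound in auto)
    then have "norm ((deriv ^^ k) f w) powr p \<le> (fact k * B / (d/2) ^ k) powr p"
      by (intro powr_mono2) (use p in auto)
    also have "fact k * B / (d/2) ^ k = fact k * 2 ^ k * (B * d powr (- real k))"
      using d by (simp add: powr_minus powr_realpow power_divide field_simps)
    also have "(fact k * 2 ^ k * (B * d powr (- real k))) powr p = (fact k * 2 ^ k) powr p * ((4 * x / (pi * d\<^sup>2)) * d powr (- (k * p)))"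
      using d x p by (simp add: powr_mult B_def powr_powr)
    also have "\<dots> = (fact k * 2 ^ k) powr p * 4 / pi * d powr (- (2 + k * p)) * x"
    proof -
      have "d powr (- (2 + k * p)) = d powr (- (k * p)) / d\<^sup>2"
        using d powr_add[of d "-2" "- (k*p)"] by (simp add: powr_minus field_simps)
      then show ?thesis by simp
    qed
    finally show ?thesis
      unfolding X_def[symmetric] x(1) using x(2) pos
      by (subst ennreal_mult[symmetric]) (auto intro: ennreal_leI)
  qed
qed

section \<open>Radial weights\<close>

lemma omega_measurable:
  assumes "radial_weight \<omega>"
  shows "(\<lambda>t. ennreal (\<omega> t) * indicator {0..1} t) \<in> borel_measurable borel"
proof -
  have "(\<lambda>t. indicator {0..1} t *\<^sub>R \<omega> t) \<in> borel_measurable borel"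
    using assms by (auto simp: radial_weight_def set_integrable_def dest: borel_measurable_integrable)
  then have "(\<lambda>t. ennreal (indicator {0..1} t *\<^sub>R \<omega> t)) \<in> borel_measurable borel" by measurable
  then show ?thesis
    by (rule back_subst[of "\<lambda>h. h \<in> borel_measurable borel"]) (auto simp: indicator_def fun_eq_iff)
qed

lemma nn_integral_omega:
  assumes w: "radial_weight \<omega>" and r: "0 \<le> r"
  shows "(\<integral>\<^sup>+t\<in>{r..1}. ennreal (\<omega> t) \<partial>lborel) = ennreal (omega_hat \<omega> r)"
    and "0 \<le> omega_hat \<omega> r"
proof -
  have i: "set_integrable lborel {r..1} \<omega>"
    using w r by (auto simp: radial_weight_def intro: set_integrable_subset)
  have nn: "0 \<le> indicator {r..1} t *\<^sub>R \<omega> t" for t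
    using w r by (auto simp: radial_weight_def indicator_def)
  have "(\<integral>\<^sup>+t\<in>{r..1}. ennreal (\<omega> t) \<partial>lborel) = (\<integral>\<^sup>+t. ennreal (indicator {r..1} t *\<^sub>R \<omega> t) \<partial>lborel)"
    by (intro nn_integral_cong) (auto simp: indicator_def)
  also have "\<dots> = ennreal (omega_hat \<omega> r)"
    unfolding omega_hat_def set_lebesgue_integral_def
    by (intro nn_integral_eq_integral) (use i nn in \<open>auto simp: set_integrable_def\<close>)
  finally show "(\<integral>\<^sup>+t\<in>{r..1}. ennreal (\<omega> t) \<partial>lborel) = ennreal (omega_hat \<omega> r)" .
  show "0 \<le> omega_hat \<omega> r"
    unfolding omega_hat_def set_lebesgue_integral_def using nn by (intro integral_nonneg_AE) auto
qed

lemma omega_hat_antimono: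
  assumes w: "radial_weight \<omega>" and r: "0 \<le> r" "r \<le> t"
  shows "omega_hat \<omega> t \<le> omega_hat \<omega> r"
proof -
  have "ennreal (omega_hat \<omega> t) \<le> ennreal (omega_hat \<omega> r)"
    using r nn_integral_omega(1)[OF w, symmetric]
    by (auto intro!: nn_integral_mono simp: indicator_def)
  then show ?thesis using nn_integral_omega(2)[OF w, of r] r by simp
qed

lemma nn_integral_omega_Ico:
  assumes w: "radial_weight \<omega>" and r: "0 \<le> r" "r \<le> t" "t \<le> 1"
  shows "(\<integral>\<^sup>+s\<in>{r..<t}. ennreal (\<omega> s) \<partial>lborel) = ennreal (omega_hat \<omega> r - omega_hat \<omega> t)"
proof -
  note [measurable] = omega_measurable[OF w]
  have m: "(\<lambda>s. ennreal (\<omega> s) * indicator {r..<t} s) \<in> borel_measurable borel"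
  proof -
    have "(\<lambda>s. ennreal (\<omega> s) * indicator {0..1} s * indicator {r..<t} s) \<in> borel_measurable borel" by measurable
    then show ?thesis
      by (rule back_subst[of "\<lambda>h. h \<in> borel_measurable borel"]) (use r in \<open>auto simp: indicator_def fun_eq_iff\<close>)
  qed
  have m': "(\<lambda>s. ennreal (\<omega> s) * indicator {t..1} s) \<in> borel_measurable borel"
  proof -
    have "(\<lambda>s. ennreal (\<omega> s) * indicator {0..1} s * indicator {t..1} s) \<in> borel_measurable borel" by measurable
    then show ?thesis
      by (rule back_subst[of "\<lambda>h. h \<in> borel_measurable borel"]) (use r in \<open>auto simp: indicator_def fun_eq_iff\<close>)
  qed
  have "ennreal (omega_hat \<omega> r) = (\<integral>\<^sup>+s. ennreal (\<omega> s) * indicator {r..<t} s + ennreal (\<omega> s) * indicator {t..1} s \<partial>lborel)"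
    unfolding nn_integral_omega(1)[OF w r(1), symmetric]
    by (intro nn_integral_cong) (use r in \<open>auto simp: indicator_def\<close>)
  also have "\<dots> = (\<integral>\<^sup>+s\<in>{r..<t}. ennreal (\<omega> s) \<partial>lborel) + ennreal (omega_hat \<omega> t)"
    using m m' r by (subst nn_integral_add) (auto simp: nn_integral_omega(1)[OF w])
  finally show ?thesis
    using nn_integral_omega(2)[OF w, of t] r by (simp add: ennreal_minus[symmetric])
qed

lemma omega_hat_pos: "radial_weight \<omega> \<Longrightarrow> 0 \<le> r \<Longrightarrow> r < 1 \<Longrightarrow> 0 < omega_hat \<omega> r"
  by (simp add: radial_weight_def)

text \<open>Measurability comes from monotonicity, which is at hand for nonnegative radii only;
  hence the \<open>max 0\<close>.\<close>

lemma omega_hat_measurable: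
  assumes w: "radial_weight \<omega>"
  shows "(\<lambda>r. omega_hat \<omega> (max 0 r)) \<in> borel_measurable borel"
proof -
  have "mono (\<lambda>r. - omega_hat \<omega> (max 0 r))"
    by (intro monoI) (auto intro!: omega_hat_antimono[OF w])
  then have "(\<lambda>r. - omega_hat \<omega> (max 0 r)) \<in> borel_measurable borel"
    by (rule borel_measurable_mono)
  then show ?thesis by simp
qed

lemma omega_hat_doubling_iter:
  assumes C: "0 \<le> C" "\<And>r. 0 \<le> r \<Longrightarrow> r < 1 \<Longrightarrow> omega_hat \<omega> r \<le> C * omega_hat \<omega> ((1 + r) / 2)" and r: "0 \<le> r" "r < 1"
  shows "omega_hat \<omega> r \<le> C ^ n * omega_hat \<omega> (1 - (1 - r) / 2 ^ n)"
proof (induction n)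
  case (Suc n)
  have "1 - (1 - r) / 2 ^ n \<ge> 0" "1 - (1 - r) / 2 ^ n < 1"
  proof -
    have "1 - r \<le> 2 ^ n" using r one_le_power[of "2::real" n] by linarith
    then show "1 - (1 - r) / 2 ^ n \<ge> 0" by simp
  qed (use r in simp)
  then have "omega_hat \<omega> (1 - (1 - r) / 2 ^ n) \<le> C * omega_hat \<omega> ((1 + (1 - (1 - r) / 2 ^ n)) / 2)"
    by (rule C(2))
  also have "(1 + (1 - (1 - r) / 2 ^ n)) / 2 = 1 - (1 - r) / 2 ^ Suc n" by (simp add: field_simps)
  finally have "C ^ n * omega_hat \<omega> (1 - (1 - r) / 2 ^ n) \<le> C ^ n * (C * omega_hat \<omega> (1 - (1 - r) / 2 ^ Suc n))"
    using C(1) by (intro mult_left_mono) auto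
  then show ?case using Suc by (simp add: mult.assoc mult.left_commute)
qed simp

section \<open>Bergman integrals through circular means, and the regularised weight\<close>

lemma Ap_int_polar:
  assumes w: "radial_weight \<omega>" and f: "f holomorphic_on disc"
  shows "Ap_int \<omega> p f = (\<integral>\<^sup>+r\<in>{0..<1}. ennreal r * ennreal (\<omega> r / pi) * circle_mean p f r \<partial>lborel)"
proof -
  note [measurable] = omega_measurable[OF w]
  have 0: "0 \<le> \<omega> r" if "0 \<le> r" "r < 1" for r using w that by (auto simp: radial_weight_def)
  have "Ap_int \<omega> p f = (\<integral>\<^sup>+z\<in>disc. ennreal (norm (f z) powr p) * (ennreal (1/pi) * (ennreal (\<omega> (norm z)) * indicator {0..1} (norm z))) \<partial>lborel)"
    unfolding Ap_int_def by (intro nn_integral_cong) (auto simp: indicator_def disc_def 0 simp flip: ennreal_mult)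
  also have "\<dots> = (\<integral>\<^sup>+r\<in>{0..<1}. ennreal r * (ennreal (1/pi) * (ennreal (\<omega> r) * indicator {0..1} r)) * circle_mean p f r \<partial>lborel)"
    by (rule nn_integral_disc_powr_polar[OF holomorphic_on_imp_continuous_on[OF f]]) measurable
  also have "\<dots> = (\<integral>\<^sup>+r\<in>{0..<1}. ennreal r * ennreal (\<omega> r / pi) * circle_mean p f r \<partial>lborel)"
    by (intro nn_integral_cong) (auto simp: indicator_def 0 simp flip: ennreal_mult)
  finally show ?thesis .
qed

lemma circle_mean_measurable:
  assumes "f holomorphic_on disc"
  shows "(\<lambda>r. circle_mean p f r * indicator {0..<1} r) \<in> borel_measurable borel"
proof -
  have [measurable]: "cis \<in> borel_measurable borel"
    by (intro borel_measurable_continuous_onI continuous_intros)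
  have [measurable]: "(\<lambda>z. ennreal (norm (f z) powr p) * indicator disc z) \<in> borel_measurable borel"
    by (rule borel_measurable_powr_indicator[OF holomorphic_on_imp_continuous_on[OF assms]]) (simp add: disc_def)
  have "(\<lambda>r. (\<integral>\<^sup>+\<theta>. ennreal (norm (f (of_real r * cis \<theta>)) powr p) * indicator disc (of_real r * cis \<theta>) * indicator {0..<2*pi} \<theta> \<partial>lborel) * indicator {0..<1} r) \<in> borel_measurable borel"
    by measurable
  then show ?thesis
    by (rule back_subst[of "\<lambda>h. h \<in> borel_measurable borel"])
      (auto simp: indicator_def fun_eq_iff circle_mean_def disc_def norm_mult intro!: nn_integral_cong)
qed

text \<open>Unlike \<open>\<omega>\<close>, which may vanish on large annuli, the weight \<open>\<omega>_hat(r) / (1 - r)\<close> is nearly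
  constant on discs of hyperbolic size. The two are compared on the annuli
  \<open>1 - 1/K\<^sup>n \<le> r < 1 - 1/K\<^sup>n\<^sup>+\<^sup>1\<close>, using that circular means increase.\<close>

lemma Ap_int_regularized_le:
  assumes w: "weight_D \<omega>" and p: "1 < p"
  shows "\<exists>C>0. \<forall>f. f holomorphic_on disc \<longrightarrow>
    (\<integral>\<^sup>+z\<in>disc. ennreal (norm (f z) powr p) * ennreal (omega_hat \<omega> (norm z) / (1 - norm z)) \<partial>lborel)
      \<le> ennreal C * Ap_int \<omega> p f"
proof -
  have rw: "radial_weight \<omega>" using w by (simp add: weight_D_def weight_Dhat_def)
  note [measurable] = omega_measurable[OF rw] omega_hat_measurable[OF rw]
  obtain C1 where C1: "C1 \<ge> 1" "\<And>r. 0 \<le> r \<Longrightarrow> r < 1 \<Longrightarrow> omega_hat \<omega> r \<le> C1 * omega_hat \<omega> ((1 + r) / 2)"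
    using w unfolding weight_D_def weight_Dhat_def by auto
  obtain K C2 where K: "K > 1" and C2: "C2 > 1"
    "\<And>r. 0 \<le> r \<Longrightarrow> r < 1 \<Longrightarrow> C2 * omega_hat \<omega> (1 - (1 - r) / K) \<le> omega_hat \<omega> r"
    using w unfolding weight_D_def by auto
  \<comment> \<open>L doublings reach at least as far towards the boundary as one annulus, so
    \<open>omega_hat\<close> drops by at most the factor \<open>C1 ^ L\<close> from one \<rho> to
    the next.\<close>
  obtain L where L: "K \<le> 2 ^ L" using real_arch_pow[of 2 K] by (auto intro: less_imp_le)
  define C where "C = C1 ^ L * (C2 / (C2 - 1)) * K * pi"
  have C: "0 < C" unfolding C_def using C1 C2 K by (intro mult_pos_pos divide_pos_pos) auto
  define \<rho> where "\<rho> = (\<lambda>n::nat. 1 - 1 / K ^ n)"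
  have \<rho>0: "0 \<le> \<rho> n" and \<rho>1: "\<rho> n < 1" for n using K by (auto simp: \<rho>_def)
  have \<rho>S: "\<rho> (Suc n) = 1 - (1 - \<rho> n) / K" for n using K by (simp add: \<rho>_def field_simps)
  have \<rho>mono: "\<rho> m \<le> \<rho> n" if "m \<le> n" for m n
    unfolding \<rho>_def using K that by (auto intro!: divide_left_mono power_increasing)
  define A where "A = (\<lambda>n. {\<rho> n..<\<rho> (Suc n)})"
  have disj: "disjoint_family A"
    unfolding disjoint_family_on_def
  proof (intro ballI impI)
    fix m n :: nat assume "m \<noteq> n"
    then consider "Suc m \<le> n" | "Suc n \<le> m" by linarith
    then show "A m \<inter> A n = {}"
      by cases (use \<rho>mono in \<open>fastforce simp: A_def\<close>)+
  qed
  have UN: "(\<Union>n. A n) = {0..<1}"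
  proof
    show "(\<Union>n. A n) \<subseteq> {0..<1}"
      unfolding A_def using \<rho>0 \<rho>1 by (fastforce intro: order.trans less_trans)
    show "{0..<1} \<subseteq> (\<Union>n. A n)"
    proof
      fix r :: real assume r: "r \<in> {0..<1}"
      obtain n where n: "1 / (1 - r) < K ^ n" using real_arch_pow[OF K] by blast
      then have "1 / K ^ n < 1 - r" using r K by (simp add: field_simps)
      then have ex: "r < \<rho> n" by (simp add: \<rho>_def)
      define N where "N = (LEAST n. r < \<rho> n)"
      have N: "r < \<rho> N" unfolding N_def by (rule LeastI[of _ n]) (rule ex)
      have "N \<noteq> 0" using N r by (auto simp: \<rho>_def intro: ccontr)
      then obtain k where k: "N = Suc k" by (cases N) auto
      then have "\<not> r < \<rho> k" using not_less_Least[of k "\<lambda>n. r < \<rho> n"] N_def by simp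
      then have "r \<in> A k" using N k by (auto simp: A_def)
      then show "r \<in> (\<Union>n. A n)" by blast
    qed
  qed
  have A01: "0 \<le> r" "r < 1" if "r \<in> A n" for r n
    using that UN by (metis UN_I UNIV_I atLeastLessThan_iff)+
  show ?thesis
  proof (intro exI[of _ C] conjI allI impI C)
    fix f assume f: "f holomorphic_on disc"
    define I where "I = circle_mean p f"
    have I[measurable]: "(\<lambda>r. I r * indicator {0..<1} r) \<in> borel_measurable borel"
      unfolding I_def by (rule circle_mean_measurable[OF f])
    have Imono: "I r \<le> I s" if "0 \<le> r" "r \<le> s" "s < 1" for r s
      unfolding I_def by (rule circle_mean_mono[OF _ p that]) (use f in \<open>simp add: disc_def\<close>)
    define g where "g = (\<lambda>r. ennreal (omega_hat \<omega> (max 0 r) / (1 - r)))"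
    have [measurable]: "g \<in> borel_measurable borel" unfolding g_def by measurable
    define h where "h = (\<lambda>r. ennreal r * g r * (I r * indicator {0..<1} r))"
    define k where "k = (\<lambda>r. ennreal r * (ennreal (1/pi) * (ennreal (\<omega> r) * indicator {0..1} r)) * (I r * indicator {0..<1} r))"
    have [measurable]: "h \<in> borel_measurable borel" "k \<in> borel_measurable borel"
      unfolding h_def k_def by measurable
    have [measurable]: "A n \<in> sets borel" for n by (simp add: A_def)
    \<comment> \<open>The regularised integral over one annulus is charged to the true weight on the
      next annulus outwards: there the circular means are at least as large, and the \<omega>-mass
      is a fixed fraction of \<open>omega_hat\<close> at the annulus's inner radius.\<close>
    have step: "(\<integral>\<^sup>+r. h r * indicator (A n) r \<partial>lborel) \<le> ennreal C * (\<integral>\<^sup>+r. k r * indicator (A (Suc n)) r \<partial>lborel)" for n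
    proof -
      have "(\<integral>\<^sup>+r. h r * indicator (A n) r \<partial>lborel)
         \<le> (\<integral>\<^sup>+r. ennreal (omega_hat \<omega> (\<rho> n) * K ^ Suc n) * I (\<rho> (Suc n)) * indicator (A n) r \<partial>lborel)"
      proof (rule nn_integral_mono)
        fix r :: real
        show "h r * indicator (A n) r \<le> ennreal (omega_hat \<omega> (\<rho> n) * K ^ Suc n) * I (\<rho> (Suc n)) * indicator (A n) r"
        proof (cases "r \<in> A n")
          case True
          then have r: "\<rho> n \<le> r" "r < \<rho> (Suc n)" by (auto simp: A_def)
          have r01: "0 \<le> r" "r < 1" using r \<rho>0[of n] \<rho>1[of "Suc n"] by auto
          have o: "omega_hat \<omega> r \<le> omega_hat \<omega> (\<rho> n)" by (rule omega_hat_antimono[OF rw \<rho>0 r(1)])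
          have d: "1 / (1 - r) \<le> K ^ Suc n"
          proof -
            have "1 / K ^ Suc n \<le> 1 - r" using r by (simp add: \<rho>_def)
            then show ?thesis using r01 K by (simp add: field_simps)
          qed
          have "r * (omega_hat \<omega> r / (1 - r)) \<le> 1 * (omega_hat \<omega> (\<rho> n) * K ^ Suc n)"
            unfolding divide_inverse[of "omega_hat \<omega> r"] using r01 o d nn_integral_omega(2)[OF rw, of r] K nn_integral_omega(2)[OF rw \<rho>0]
            by (intro mult_mono) (auto simp: inverse_eq_divide)
          then have "ennreal r * g r \<le> ennreal (omega_hat \<omega> (\<rho> n) * K ^ Suc n)"
            unfolding g_def using r01 nn_integral_omega(2)[OF rw, of r]
            by (subst ennreal_mult[symmetric]) (auto intro!: ennreal_leI simp: max_def)
          moreover have "I r \<le> I (\<rho> (Suc n))" by (rule Imono) (use r r01 \<rho>1 in auto)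
          ultimately show ?thesis
            unfolding h_def using True r01 by (auto intro!: mult_mono)
        qed simp
      qed
      also have "\<dots> = ennreal (omega_hat \<omega> (\<rho> n) * K ^ Suc n) * I (\<rho> (Suc n)) * ennreal (\<rho> (Suc n) - \<rho> n)"
        unfolding A_def using \<rho>mono[of n "Suc n"] by (subst nn_integral_cmult_indicator) auto
      also have "\<dots> = ennreal (omega_hat \<omega> (\<rho> n) * (K - 1)) * I (\<rho> (Suc n))"
      proof -
        have "K ^ Suc n * (\<rho> (Suc n) - \<rho> n) = K - 1" using K by (simp add: \<rho>_def field_simps)
        then have "omega_hat \<omega> (\<rho> n) * (K - 1) = (omega_hat \<omega> (\<rho> n) * K ^ Suc n) * (\<rho> (Suc n) - \<rho> n)"
          by (metis mult.assoc)
        then have "ennreal (omega_hat \<omega> (\<rho> n) * K ^ Suc n) * ennreal (\<rho> (Suc n) - \<rho> n) = ennreal (omega_hat \<omega> (\<rho> n) * (K - 1))"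
          using \<rho>mono[of n "Suc n"] K nn_integral_omega(2)[OF rw \<rho>0, of n] by (simp only:) (subst ennreal_mult, auto)
        then show ?thesis by (metis mult.assoc mult.commute)
      qed
      also have "\<dots> \<le> ennreal (C * ((1 - 1/K) / pi * (omega_hat \<omega> (\<rho> (Suc n)) - omega_hat \<omega> (\<rho> (Suc (Suc n)))))) * I (\<rho> (Suc n))"
      proof (intro mult_right_mono ennreal_leI)
        define x where "x = omega_hat \<omega> (\<rho> (Suc n))"
        define y where "y = omega_hat \<omega> (\<rho> (Suc (Suc n)))"
        have y: "0 \<le> x" unfolding x_def by (rule nn_integral_omega(2)[OF rw \<rho>0])
        have xy: "C2 * y \<le> x" unfolding x_def y_def \<rho>S[of "Suc n"] by (rule C2(2)[OF \<rho>0 \<rho>1])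
        \<comment> \<open>Here \<open>x - y\<close> is the \<omega>-mass of the next annulus. Since
          \<open>C2 * y \<le> x\<close> with \<open>C2 > 1\<close>, this mass is at least (1 - 1/C2)
          x: the reverse doubling condition in \<open>weight_D\<close> prevents \<omega> from
          vanishing on a whole annulus.\<close>
        have "x * (C2 - 1) \<le> C2 * (x - y)" using xy by (simp add: algebra_simps)
        then have x2: "x \<le> C2 / (C2 - 1) * (x - y)" using C2(1) by (simp add: field_simps)
        have "omega_hat \<omega> (\<rho> n) \<le> C1 ^ L * omega_hat \<omega> (1 - (1 - \<rho> n) / 2 ^ L)"
          by (rule omega_hat_doubling_iter[OF _ C1(2) \<rho>0 \<rho>1]) (use C1 in auto)
        also have "\<dots> \<le> C1 ^ L * x"
        proof -
          have "(1 - \<rho> n) / 2 ^ L \<le> (1 - \<rho> n) / K" using L K \<rho>1[of n] by (intro divide_left_mono) auto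
          then show ?thesis unfolding x_def \<rho>S[of n] using C1(1) \<rho>0[of "Suc n", unfolded \<rho>S[of n]]
            by (intro mult_left_mono omega_hat_antimono[OF rw]) auto
        qed
        also have "\<dots> \<le> C1 ^ L * (C2 / (C2 - 1) * (x - y))"
          using x2 C1(1) by (intro mult_left_mono) auto
        finally have "omega_hat \<omega> (\<rho> n) * (K - 1) \<le> C1 ^ L * (C2 / (C2 - 1) * (x - y)) * (K - 1)"
          using K by (intro mult_right_mono) auto
        also have "\<dots> = C * ((1 - 1/K) / pi * (x - y))"
        proof -
          define E where "E = C2 / (C2 - 1)"
          show ?thesis unfolding C_def E_def[symmetric] using K by (simp add: field_simps)
        qed
        finally show "omega_hat \<omega> (\<rho> n) * (K - 1) \<le> C * ((1 - 1/K) / pi * (omega_hat \<omega> (\<rho> (Suc n)) - omega_hat \<omega> (\<rho> (Suc (Suc n)))))"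
          by (simp add: x_def y_def)
      qed simp
      also have "\<dots> = ennreal C * (ennreal ((1 - 1/K) / pi) * I (\<rho> (Suc n)) * (\<integral>\<^sup>+r\<in>A (Suc n). ennreal (\<omega> r) \<partial>lborel))"
      proof -
        define E where "E = omega_hat \<omega> (\<rho> (Suc n)) - omega_hat \<omega> (\<rho> (Suc (Suc n)))"
        have i: "(\<integral>\<^sup>+r\<in>A (Suc n). ennreal (\<omega> r) \<partial>lborel) = ennreal E"
          unfolding A_def E_def using \<rho>mono[of "Suc n" "Suc (Suc n)"] \<rho>0[of "Suc n"] \<rho>1[of "Suc (Suc n)"]
          by (intro nn_integral_omega_Ico[OF rw]) auto
        have "0 \<le> E"
          using omega_hat_antimono[OF rw \<rho>0 \<rho>mono[of "Suc n" "Suc (Suc n)"]] by (simp add: E_def)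
        then have "ennreal (C * ((1 - 1/K) / pi * E)) = ennreal C * (ennreal ((1 - 1/K) / pi) * ennreal E)"
          using C K by (subst ennreal_mult, simp, simp, subst ennreal_mult) auto
        then show ?thesis unfolding i E_def[symmetric] by (simp only: ac_simps)
      qed
      also have "\<dots> \<le> ennreal C * (\<integral>\<^sup>+r. k r * indicator (A (Suc n)) r \<partial>lborel)"
      proof (rule mult_left_mono)
        have "ennreal ((1 - 1/K) / pi) * I (\<rho> (Suc n)) * (\<integral>\<^sup>+r\<in>A (Suc n). ennreal (\<omega> r) \<partial>lborel)
          = ennreal ((1 - 1/K) / pi) * I (\<rho> (Suc n)) * (\<integral>\<^sup>+r\<in>A (Suc n). (ennreal (\<omega> r) * indicator {0..1} r) \<partial>lborel)"
          using A01 by (intro arg_cong[where f="\<lambda>x. ennreal ((1 - 1/K) / pi) * I (\<rho> (Suc n)) * x"] nn_integral_cong)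
            (auto simp: indicator_def less_imp_le)
        also have "\<dots> = (\<integral>\<^sup>+r. ennreal ((1 - 1/K) / pi) * I (\<rho> (Suc n)) * (ennreal (\<omega> r) * indicator {0..1} r * indicator (A (Suc n)) r) \<partial>lborel)"
          by (rule nn_integral_cmult[symmetric]) measurable
        also have "\<dots> \<le> (\<integral>\<^sup>+r. k r * indicator (A (Suc n)) r \<partial>lborel)"
        proof (rule nn_integral_mono)
          fix r
          show "ennreal ((1 - 1/K) / pi) * I (\<rho> (Suc n)) * (ennreal (\<omega> r) * indicator {0..1} r * indicator (A (Suc n)) r)
             \<le> k r * indicator (A (Suc n)) r"
          proof (cases "r \<in> A (Suc n)")
            case True
            then have r: "\<rho> (Suc n) \<le> r" "r < 1" using A01[OF True] by (auto simp: A_def)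
            \<comment> \<open>The shift by one annulus also keeps r away from 0, so the Jacobian
              factor r in the polar form is bounded below.\<close>
            have r1: "1 - 1/K \<le> r" using r(1) \<rho>mono[of 1 "Suc n"] by (simp add: \<rho>_def)
            have r0: "0 \<le> r" using r \<rho>0[of "Suc n"] by simp
            have "ennreal ((1 - 1/K) / pi) \<le> ennreal r * ennreal (1/pi)"
              using r1 r0 by (subst ennreal_mult[symmetric]) (auto intro!: ennreal_leI divide_right_mono)
            moreover have "I (\<rho> (Suc n)) \<le> I r" by (rule Imono[OF \<rho>0 r])
            ultimately have "ennreal ((1 - 1/K) / pi) * I (\<rho> (Suc n)) * ennreal (\<omega> r) \<le> (ennreal r * ennreal (1/pi)) * I r * ennreal (\<omega> r)"
              by (intro mult_right_mono mult_mono) auto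
            then show ?thesis using True r r0 by (simp add: k_def ac_simps)
          qed simp
        qed
        finally show "ennreal ((1 - 1/K) / pi) * I (\<rho> (Suc n)) * (\<integral>\<^sup>+r\<in>A (Suc n). ennreal (\<omega> r) \<partial>lborel) \<le> (\<integral>\<^sup>+r. k r * indicator (A (Suc n)) r \<partial>lborel)" .
      qed simp
      finally show ?thesis .
    qed
    have "(\<integral>\<^sup>+z\<in>disc. ennreal (norm (f z) powr p) * ennreal (omega_hat \<omega> (norm z) / (1 - norm z)) \<partial>lborel)
       = (\<integral>\<^sup>+z\<in>disc. ennreal (norm (f z) powr p) * g (norm z) \<partial>lborel)"
      by (simp add: g_def)
    also have "\<dots> = (\<integral>\<^sup>+r\<in>{0..<1}. ennreal r * g r * circle_mean p f r \<partial>lborel)"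
      by (rule nn_integral_disc_powr_polar[OF holomorphic_on_imp_continuous_on[OF f]]) measurable
    also have "\<dots> = (\<integral>\<^sup>+r. (\<Sum>n. h r * indicator (A n) r) \<partial>lborel)"
      by (intro nn_integral_cong) (simp add: h_def I_def suminf_indicator[OF disj] UN, auto simp: indicator_def)
    also have "\<dots> = (\<Sum>n. \<integral>\<^sup>+r. h r * indicator (A n) r \<partial>lborel)"
      by (rule nn_integral_suminf) measurable
    also have "\<dots> \<le> (\<Sum>n. ennreal C * (\<integral>\<^sup>+r. k r * indicator (A (Suc n)) r \<partial>lborel))"
      by (intro suminf_le step) auto
    also have "\<dots> = ennreal C * (\<Sum>n. \<integral>\<^sup>+r. k r * indicator (A (Suc n)) r \<partial>lborel)"
      by simp
    also have "(\<Sum>n. \<integral>\<^sup>+r. k r * indicator (A (Suc n)) r \<partial>lborel) = (\<integral>\<^sup>+r. (\<Sum>n. k r * indicator (A (Suc n)) r) \<partial>lborel)"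
      by (rule nn_integral_suminf[symmetric]) measurable
    also have "\<dots> \<le> Ap_int \<omega> p f"
      unfolding Ap_int_polar[OF rw f]
    proof (rule nn_integral_mono)
      fix r
      have dj: "disjoint_family (\<lambda>n. A (Suc n))"
        using disj unfolding disjoint_family_on_def by simp
      have "(\<Sum>n. k r * indicator (A (Suc n)) r) = k r * indicator (\<Union>n. A (Suc n)) r"
        by (simp add: suminf_indicator[OF dj])
      also have "\<dots> \<le> k r * indicator {0..<1} r"
        using A01 by (intro mult_left_mono) (auto simp: indicator_def)
      also have "\<dots> = ennreal r * ennreal (\<omega> r / pi) * circle_mean p f r * indicator {0..<1} r"
        using rw by (auto simp: k_def I_def indicator_def radial_weight_def simp flip: ennreal_mult)
      finally show "(\<Sum>n. k r * indicator (A (Suc n)) r) \<le> ennreal r * ennreal (\<omega> r / pi) * circle_mean p f r * indicator {0..<1} r" .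
    qed
    finally show "(\<integral>\<^sup>+z\<in>disc. ennreal (norm (f z) powr p) * ennreal (omega_hat \<omega> (norm z) / (1 - norm z)) \<partial>lborel)
      \<le> ennreal C * Ap_int \<omega> p f"
      by (simp add: mult_left_mono)
  qed
qed

section \<open>Test functions\<close>

text \<open>For h < 1/2 the real part forces cos \<theta> > 1/2 and s > 1/2, the imaginary part then
  |sin \<theta>| < 2h, and the mean value theorem puts \<theta> within 4h of 0 or of 2 pi. For
  larger h the bound exceeds the full circle, as 16h >= 8 > 2 pi.\<close>

lemma emeasure_circle_near_1:
  fixes s h :: real
  assumes s: "0 \<le> s" "s < 1" and h: "0 < h"
  shows "(\<integral>\<^sup>+\<theta>\<in>{0..<2*pi}. indicator {z. norm (1 - of_real s * z) < h} (cis \<theta>) \<partial>lborel) \<le> ennreal (16 * h)"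
proof (cases "h \<ge> 1/2")
  case True
  have "(\<integral>\<^sup>+\<theta>\<in>{0..<2*pi}. indicator {z. norm (1 - of_real s * z) < h} (cis \<theta>) \<partial>lborel) \<le> (\<integral>\<^sup>+\<theta>. indicator {0..<2*pi} \<theta> \<partial>lborel)"
    by (intro nn_integral_mono) (auto simp: indicator_def)
  also have "\<dots> = ennreal (2 * pi)" by simp
  also have "\<dots> \<le> ennreal (16 * h)" using True pi_less_4 by (intro ennreal_leI) simp
  finally show ?thesis .
next
  case False
  have key: "\<theta> \<in> {0..4*h} \<union> {2*pi - 4*h..2*pi}" if t: "0 \<le> \<theta>" "\<theta> < 2*pi" and n: "norm (1 - of_real s * cis \<theta>) < h" for \<theta>
  proof -
    have "\<bar>Re (1 - of_real s * cis \<theta>)\<bar> < h" "\<bar>Im (1 - of_real s * cis \<theta>)\<bar> < h"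
      using n abs_Re_le_cmod[of "1 - of_real s * cis \<theta>"] abs_Im_le_cmod[of "1 - of_real s * cis \<theta>"] by linarith+
    then have re: "s * cos \<theta> > 1/2" and im: "\<bar>s * sin \<theta>\<bar> < h" using False by auto
    have c: "cos \<theta> > 1/2"
    proof -
      have "0 < cos \<theta>"
      proof (rule ccontr)
        assume "\<not> 0 < cos \<theta>"
        then have "s * cos \<theta> \<le> 0" using s by (intro mult_nonneg_nonpos) auto
        then show False using re by simp
      qed
      then have "s * cos \<theta> \<le> 1 * cos \<theta>" using s by (intro mult_right_mono) auto
      then show ?thesis using re by simp
    qed
    have s2: "s > 1/2"
    proof -
      have "s * cos \<theta> \<le> s * 1" using s by (intro mult_left_mono) auto
      then show ?thesis using re by simp
    qed
    have sn: "\<bar>sin \<theta>\<bar> < 2 * h"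
    proof -
      have "1/2 * \<bar>sin \<theta>\<bar> \<le> s * \<bar>sin \<theta>\<bar>" using s2 by (intro mult_right_mono) auto
      then show ?thesis using im s by (simp add: abs_mult)
    qed
    have small: "x < 4 * h" if x: "0 \<le> x" "x \<le> pi" and cx: "cos x > 1/2" and sx: "sin x < 2 * h" for x
    proof (cases "x = 0")
      case False
      then have "0 < x" using x by simp
      from MVT2[OF this, of sin cos] obtain \<xi> where xi: "0 < \<xi>" "\<xi> < x" "sin x - sin 0 = (x - 0) * cos \<xi>"
        by (auto intro: DERIV_sin)
      have "cos x \<le> cos \<xi>" using xi x by (intro cos_monotone_0_pi_le) auto
      then have "x * (1/2) \<le> sin x" using xi cx x by (simp add: mult_left_mono del: times_divide_eq_right)
      then show ?thesis using sx by simp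
    qed (use h in simp)
    show ?thesis
    proof (cases "\<theta> \<le> pi")
      case True
      then have "\<theta> < 4 * h" using small[of \<theta>] t c sn by auto
      then show ?thesis using t by auto
    next
      case False
      have "2*pi - \<theta> < 4 * h" using small[of "2*pi - \<theta>"] t c sn False
        by (auto simp: cos_diff sin_diff)
      then show ?thesis using t by auto
    qed
  qed
  have "(\<integral>\<^sup>+\<theta>\<in>{0..<2*pi}. indicator {z. norm (1 - of_real s * z) < h} (cis \<theta>) \<partial>lborel)
     \<le> (\<integral>\<^sup>+\<theta>. indicator ({0..4*h} \<union> {2*pi - 4*h..2*pi}) \<theta> \<partial>lborel)"
    using key by (intro nn_integral_mono) (auto simp: indicator_def)
  also have "\<dots> = emeasure lborel ({0..4*h} \<union> {2*pi - 4*h..2*pi})" by simp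
  also have "\<dots> \<le> emeasure lborel {0..4*h} + emeasure lborel {2*pi - 4*h..2*pi}"
    by (rule emeasure_subadditive) auto
  also have "\<dots> = ennreal (8 * h)" using h by (simp flip: ennreal_plus)
  also have "\<dots> \<le> ennreal (16 * h)" using h by (intro ennreal_leI) simp
  finally show ?thesis .
qed

section \<open>The kernel powers and their size in the Bergman space\<close>

lemma one_minus_cnj_mult_ge:
  assumes "norm a < 1" "norm z < 1"
  shows "1 - norm a \<le> norm (1 - cnj a * z)" "1 - norm z \<le> norm (1 - cnj a * z)"
proof -
  have "1 - norm a * norm z \<le> norm (1 - cnj a * z)"
    using norm_triangle_ineq2[of 1 "cnj a * z"] by (simp add: norm_mult)
  moreover have "norm a * norm z \<le> norm a" "norm a * norm z \<le> norm z"
    using assms by (auto intro!: mult_left_le mult_left_le_one_le)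
  ultimately show "1 - norm a \<le> norm (1 - cnj a * z)" "1 - norm z \<le> norm (1 - cnj a * z)" by linarith+
qed

text \<open>As |1 - cnj(a) z| >= 1 - |z|, the set lies in the annulus |z| > 1 - h, and by the
  preceding arc estimate it meets each circle in angular measure at most 16h. The
  \<open>max 0\<close> admits h > 1.\<close>

lemma nn_integral_omega_near_boundary_point:
  assumes w: "radial_weight \<omega>" and a: "norm a < 1" and h: "0 < h"
  shows "(\<integral>\<^sup>+z\<in>disc. ennreal (\<omega> (norm z)) * indicator {z. norm (1 - cnj a * z) < h} z \<partial>lborel)
     \<le> ennreal (16 * h * omega_hat \<omega> (max 0 (1 - h)))"
proof -
  note [measurable] = omega_measurable[OF w]
  have [measurable]: "{z::complex. norm (1 - b * z) < h} \<in> sets borel" for b by measurable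
  have [measurable]: "cis \<in> borel_measurable borel"
    by (intro borel_measurable_continuous_onI continuous_intros)
  define R where "R = max 0 (1 - h)"
  define E where "E = {z. norm (1 - cnj a * z) < h}"
  have [measurable]: "E \<in> sets borel" unfolding E_def by measurable
  define F :: "complex \<Rightarrow> ennreal" where "F = (\<lambda>z. ennreal (\<omega> (norm z)) * indicator {0..1} (norm z) * indicator E z)"
  have F: "F \<in> borel_measurable borel" unfolding F_def by measurable
  have ang: "(\<integral>\<^sup>+\<theta>\<in>{0..<2*pi}. indicator E (of_real r * cis \<theta>) \<partial>lborel) \<le> ennreal (16 * h)" if r: "0 \<le> r" "r < 1" for r
  proof -
    define b where "b = (if a = 0 then 1 else cnj a / of_real (norm a))"
    have b: "norm b = 1" "cnj a = of_real (norm a) * b" by (auto simp: b_def norm_divide)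
    define S :: "complex set" where "S = {z. norm (1 - of_real (norm a * r) * z) < h}"
    have [measurable]: "S \<in> sets borel" unfolding S_def by measurable
    have "(\<integral>\<^sup>+\<theta>\<in>{0..<2*pi}. indicator E (of_real r * cis \<theta>) \<partial>lborel)
       = (\<integral>\<^sup>+\<theta>\<in>{0..<2*pi}. indicator S (b * cis \<theta>) \<partial>lborel)"
      unfolding E_def S_def b(2) by (intro nn_integral_cong) (simp add: indicator_def ac_simps)
    also have "\<dots> = (\<integral>\<^sup>+\<theta>\<in>{0..<2*pi}. indicator S (cis \<theta>) \<partial>lborel)"
      by (rule nn_integral_circle_rotate) (use b in auto)
    also have "\<dots> \<le> ennreal (16 * h)"
      unfolding S_def by (rule emeasure_circle_near_1) (use a r h mult_left_le[of r "norm a"] in auto)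
    finally show ?thesis .
  qed
  have "(\<integral>\<^sup>+z\<in>disc. ennreal (\<omega> (norm z)) * indicator E z \<partial>lborel) = (\<integral>\<^sup>+z\<in>disc. F z \<partial>lborel)"
    by (intro nn_integral_cong) (auto simp: F_def indicator_def disc_def)
  also have "\<dots> = (\<integral>\<^sup>+r\<in>{0..<1}. ennreal r * (\<integral>\<^sup>+\<theta>\<in>{0..<2*pi}. F (of_real r * cis \<theta>) \<partial>lborel) \<partial>lborel)"
    by (rule nn_integral_disc_polar[OF F])
  also have "\<dots> \<le> (\<integral>\<^sup>+r. ennreal (16 * h) * (ennreal (\<omega> r) * indicator {0..1} r * indicator {R..1} r) \<partial>lborel)"
  proof (rule nn_integral_mono)
    fix r :: real
    show "ennreal r * (\<integral>\<^sup>+\<theta>\<in>{0..<2*pi}. F (of_real r * cis \<theta>) \<partial>lborel) * indicator {0..<1} r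
        \<le> ennreal (16 * h) * (ennreal (\<omega> r) * indicator {0..1} r * indicator {R..1} r)"
    proof (cases "0 \<le> r \<and> r < 1")
      case True
      show ?thesis
      proof (cases "R \<le> r")
        case R: True
        have "(\<integral>\<^sup>+\<theta>\<in>{0..<2*pi}. F (of_real r * cis \<theta>) \<partial>lborel)
          = (\<integral>\<^sup>+\<theta>. ennreal (\<omega> r) * (indicator E (of_real r * cis \<theta>) * indicator {0..<2*pi} \<theta>) \<partial>lborel)"
          using True by (intro nn_integral_cong) (auto simp: F_def norm_mult indicator_def)
        also have "\<dots> = ennreal (\<omega> r) * (\<integral>\<^sup>+\<theta>\<in>{0..<2*pi}. indicator E (of_real r * cis \<theta>) \<partial>lborel)"
          by (rule nn_integral_cmult) measurable
        also have "\<dots> \<le> ennreal (\<omega> r) * ennreal (16 * h)" by (intro mult_left_mono ang) (use True in auto)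
        finally have "ennreal r * (\<integral>\<^sup>+\<theta>\<in>{0..<2*pi}. F (of_real r * cis \<theta>) \<partial>lborel) \<le> ennreal 1 * (ennreal (\<omega> r) * ennreal (16 * h))"
          using True by (intro mult_mono ennreal_leI) auto
        then show ?thesis using True R by (simp add: mult.commute)
      next
        case R: False
        have "F (of_real r * cis \<theta>) = 0" for \<theta>
        proof -
          have "r < 1 - h" using R True by (auto simp: R_def max_def split: if_splits)
          then have "\<not> norm (1 - cnj a * (of_real r * cis \<theta>)) < h"
            using one_minus_cnj_mult_ge(2)[OF a, of "of_real r * cis \<theta>"] True by (simp add: norm_mult)
          then show ?thesis by (simp add: F_def E_def)
        qed
        then show ?thesis by simp
      qed
    qed auto
  qed
  also have "\<dots> = ennreal (16 * h) * (\<integral>\<^sup>+r. ennreal (\<omega> r) * indicator {0..1} r * indicator {R..1} r \<partial>lborel)"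
    by (rule nn_integral_cmult) measurable
  also have "(\<integral>\<^sup>+r. ennreal (\<omega> r) * indicator {0..1} r * indicator {R..1} r \<partial>lborel) = (\<integral>\<^sup>+r\<in>{R..1}. ennreal (\<omega> r) \<partial>lborel)"
    by (intro nn_integral_cong) (auto simp: indicator_def R_def)
  also have "\<dots> = ennreal (omega_hat \<omega> R)"
    by (rule nn_integral_omega(1)[OF w]) (simp add: R_def)
  finally show ?thesis
    unfolding E_def R_def using h nn_integral_omega(2)[OF w, of "max 0 (1 - h)"] by (simp add: ennreal_mult)
qed

text \<open>Doubling read inwards: enlarging the distance to the circle by a factor 2 costs a factor
  C. Truncation at 0 allows dyadic scales beyond the whole disc, as the shells around a boundary
  point require.\<close>

lemma omega_hat_doubling_scale:
  assumes w: "radial_weight \<omega>" and C: "1 \<le> C" "\<And>r. 0 \<le> r \<Longrightarrow> r < 1 \<Longrightarrow> omega_hat \<omega> r \<le> C * omega_hat \<omega> ((1 + r) / 2)"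
    and d: "0 < \<delta>" "\<delta> \<le> 1"
  shows "omega_hat \<omega> (max 0 (1 - 2 ^ n * \<delta>)) \<le> C ^ n * omega_hat \<omega> (1 - \<delta>)"
proof (induction n)
  case 0
  then show ?case using d by simp
next
  case (Suc n)
  define x where "x = 2 ^ n * \<delta>"
  have x: "0 < x" using d by (simp add: x_def)
  have "omega_hat \<omega> (max 0 (1 - 2 * x)) \<le> C * omega_hat \<omega> (max 0 (1 - x))"
  proof -
    define r where "r = max 0 (1 - 2 * x)"
    have "omega_hat \<omega> r \<le> C * omega_hat \<omega> ((1 + r) / 2)" by (rule C(2)) (use x in \<open>auto simp: r_def\<close>)
    also have "\<dots> \<le> C * omega_hat \<omega> (max 0 (1 - x))"
      using C(1) x by (intro mult_left_mono omega_hat_antimono[OF w]) (auto simp: r_def max_def)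
    finally show ?thesis by (simp add: r_def)
  qed
  also have "\<dots> \<le> C * (C ^ n * omega_hat \<omega> (1 - \<delta>))"
    using Suc C(1) by (intro mult_left_mono) (auto simp: x_def)
  finally show ?case by (simp add: x_def mult.assoc)
qed

text \<open>Scaled so that its modulus is at most 2 everywhere and bounded below near
  \<open>a\<close>. Differentiating a power gives the next power times a factor of size |a| / (1 -
  |a|^2), so test functions and their derivatives stay in one family.\<close>

definition bergman_sigma :: "complex \<Rightarrow> complex \<Rightarrow> complex" where
  "bergman_sigma a z = of_real (1 - (norm a)\<^sup>2) / (1 - cnj a * z)"

lemma norm_bergman_sigma_le:
  assumes "norm a < 1" "norm z < 1"
  shows "norm (bergman_sigma a z) \<le> 2 * (1 - norm a) / norm (1 - cnj a * z)"
    and "norm (bergman_sigma a z) \<le> 2"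
proof -
  have sq: "(norm a)\<^sup>2 \<le> 1" using assms(1) by (simp add: power_le_one)
  have "norm (bergman_sigma a z) = \<bar>1 - (norm a)\<^sup>2\<bar> / norm (1 - cnj a * z)"
    unfolding bergman_sigma_def norm_divide norm_of_real ..
  also have "\<bar>1 - (norm a)\<^sup>2\<bar> = (1 + norm a) * (1 - norm a)" using sq by (simp add: algebra_simps power2_eq_square)
  also have "\<dots> \<le> 2 * (1 - norm a)" using assms by (intro mult_right_mono) auto
  finally show 1: "norm (bergman_sigma a z) \<le> 2 * (1 - norm a) / norm (1 - cnj a * z)"
    by (simp add: divide_right_mono)
  also have "\<dots> \<le> 2 * (1 - norm a) / (1 - norm a)"
    using one_minus_cnj_mult_ge(1)[OF assms] assms by (intro divide_left_mono) (auto intro!: mult_pos_pos)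
  also have "\<dots> = 2" using assms by (simp add: field_simps)
  finally show "norm (bergman_sigma a z) \<le> 2" .
qed

text \<open>Split the disc into shells where |1 - cnj(a) z| is about 2^j \<delta>, with \<delta> = 1
  - |a|. On shell j the integrand is at most (4/2^j)^(mp), while the \<omega>-mass grows by at most
  (2C)^j; the condition \<open>4 * C \<le> 2 powr (m * p)\<close> leaves a geometric series of ratio
  1/2. Its sum 2 and the 16 of the mass estimate give the 32.\<close>

lemma Ap_int_bergman_sigma_le:
  assumes w: "radial_weight \<omega>" and C: "1 \<le> C" "\<And>r. 0 \<le> r \<Longrightarrow> r < 1 \<Longrightarrow> omega_hat \<omega> r \<le> C * omega_hat \<omega> ((1 + r) / 2)"
    and p: "0 < p" and m: "4 * C \<le> 2 powr (m * p)" and a: "norm a < 1"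
  shows "Ap_int \<omega> p (\<lambda>z. bergman_sigma a z ^ m)
    \<le> ennreal (4 powr (m * p) * 32 / pi * (omega_hat \<omega> (norm a) * (1 - norm a)))"
proof -
  note [measurable] = omega_measurable[OF w]
  define \<delta> where "\<delta> = 1 - norm a"
  have \<delta>: "0 < \<delta>" "\<delta> \<le> 1" using a by (auto simp: \<delta>_def)
  have om: "0 \<le> omega_hat \<omega> (norm a)" by (rule nn_integral_omega(2)[OF w]) simp
  define E where "E = (\<lambda>j::nat. {z. norm (1 - cnj a * z) < 2 ^ j * \<delta>})"
  have [measurable]: "E j \<in> sets borel" for j unfolding E_def by measurable
  have [measurable]: "disc \<in> sets borel" by (simp add: disc_def)
  have pw: "norm (bergman_sigma a z ^ m) powr p \<le> (4 / 2 ^ j) powr (m * p)"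
    if z: "norm z < 1" and j: "2 ^ j * \<delta> \<le> 2 * norm (1 - cnj a * z)" for z j
  proof -
    define N where "N = norm (1 - cnj a * z)"
    have N: "0 < N" using one_minus_cnj_mult_ge(1)[OF a z] a unfolding N_def by linarith
    have "norm (bergman_sigma a z) \<le> 2 * \<delta> / N"
      using norm_bergman_sigma_le(1)[OF a z] by (simp add: \<delta>_def N_def)
    also have "\<dots> \<le> 4 / 2 ^ j"
      using j[folded N_def] N by (simp add: field_simps)
    finally have "norm (bergman_sigma a z) powr (m * p) \<le> (4 / 2 ^ j) powr (m * p)"
      using p by (intro powr_mono2) auto
    moreover have "norm (bergman_sigma a z ^ m) powr p = norm (bergman_sigma a z) powr (m * p)"
    proof (cases "m = 0")
      case True
      then show ?thesis using m C by simp
    next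
      case False
      then show ?thesis by (cases "bergman_sigma a z = 0") (auto simp: norm_power powr_powr simp flip: powr_realpow)
    qed
    ultimately show ?thesis by simp
  qed
  have bound: "ennreal (norm (bergman_sigma a z ^ m) powr p) \<le> (\<Sum>j. ennreal ((4 / 2 ^ j) powr (m * p)) * indicator (E j) z)" if z: "norm z < 1" for z
  proof -
    define N where "N = norm (1 - cnj a * z)"
    obtain n where "N / \<delta> < 2 ^ n" using real_arch_pow[of 2] by auto
    then have ex: "N < 2 ^ n * \<delta>" using \<delta> by (simp add: field_simps)
    \<comment> \<open>The index is positive because N >= \<delta>, so minimality gives the lower
      bound N >= 2^(j-1) \<delta> on the shell.\<close>
    define j where "j = (LEAST n. N < 2 ^ n * \<delta>)"
    have j: "N < 2 ^ j * \<delta>" unfolding j_def by (rule LeastI[of _ n]) (rule ex)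
    have "\<delta> \<le> N" using one_minus_cnj_mult_ge(1)[OF a z] by (simp add: N_def \<delta>_def)
    then have "j \<noteq> 0" using j by (auto intro: ccontr)
    then obtain i where i: "j = Suc i" by (cases j) auto
    then have "\<not> N < 2 ^ i * \<delta>" using not_less_Least[of i "\<lambda>n. N < 2 ^ n * \<delta>"] j_def by simp
    then have "norm (bergman_sigma a z ^ m) powr p \<le> (4 / 2 ^ j) powr (m * p)"
      by (intro pw z) (simp add: i N_def)
    then have "ennreal (norm (bergman_sigma a z ^ m) powr p) \<le> ennreal ((4 / 2 ^ j) powr (m * p)) * indicator (E j) z"
      using j by (simp add: E_def N_def ennreal_leI)
    also have "\<dots> = (\<Sum>k\<in>{j}. ennreal ((4 / 2 ^ k) powr (m * p)) * indicator (E k) z)"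
      by (subst sum.insert) (auto simp del: sum_mult_indicator)
    also have "\<dots> \<le> (\<Sum>k. ennreal ((4 / 2 ^ k) powr (m * p)) * indicator (E k) z)"
      by (rule sum_le_suminf) auto
    finally show ?thesis .
  qed
  define W :: "complex \<Rightarrow> ennreal" where "W = (\<lambda>z. ennreal (1/pi) * (ennreal (\<omega> (norm z)) * indicator {0..1} (norm z)))"
  have [measurable]: "W \<in> borel_measurable borel" unfolding W_def by measurable
  have om0: "0 \<le> \<omega> (norm z)" if "norm z < 1" for z :: complex using w that by (auto simp: radial_weight_def)
  have "Ap_int \<omega> p (\<lambda>z. bergman_sigma a z ^ m)
     \<le> (\<integral>\<^sup>+z. (\<Sum>j. ennreal ((4 / 2 ^ j) powr (m * p)) * indicator (E j) z * W z * indicator disc z) \<partial>lborel)"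
    unfolding Ap_int_def
  proof (rule nn_integral_mono)
    fix z :: complex
    show "ennreal (norm (bergman_sigma a z ^ m) powr p * \<omega> (norm z) / pi) * indicator disc z
      \<le> (\<Sum>j. ennreal ((4 / 2 ^ j) powr (m * p)) * indicator (E j) z * W z * indicator disc z)"
    proof (cases "z \<in> disc")
      case True
      then have z: "norm z < 1" by (simp add: disc_def)
      have "ennreal (norm (bergman_sigma a z ^ m) powr p * \<omega> (norm z) / pi) = ennreal (norm (bergman_sigma a z ^ m) powr p) * W z"
        unfolding W_def using om0[OF z] z by (simp flip: ennreal_mult)
      also have "\<dots> \<le> (\<Sum>j. ennreal ((4 / 2 ^ j) powr (m * p)) * indicator (E j) z) * W z"
        by (intro mult_right_mono bound z) simp
      also have "\<dots> = (\<Sum>j. ennreal ((4 / 2 ^ j) powr (m * p)) * indicator (E j) z * W z)" by simp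
      finally show ?thesis using True by simp
    qed simp
  qed
  also have "\<dots> = (\<Sum>j. \<integral>\<^sup>+z. ennreal ((4 / 2 ^ j) powr (m * p)) * indicator (E j) z * W z * indicator disc z \<partial>lborel)"
    by (rule nn_integral_suminf) measurable
  also have "\<dots> \<le> (\<Sum>j. ennreal (4 powr (m * p) * 16 / pi * (omega_hat \<omega> (norm a) * \<delta>) * (1/2) ^ j))"
  proof (intro suminf_le allI)
    fix j
    have "(\<integral>\<^sup>+z. ennreal ((4 / 2 ^ j) powr (m * p)) * indicator (E j) z * W z * indicator disc z \<partial>lborel)
       = (\<integral>\<^sup>+z. ennreal ((4 / 2 ^ j) powr (m * p) / pi) * (ennreal (\<omega> (norm z)) * indicator {0..1} (norm z) * indicator (E j) z * indicator disc z) \<partial>lborel)"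
      by (intro nn_integral_cong) (simp add: W_def divide_inverse ennreal_mult ac_simps)
    also have "\<dots> = ennreal ((4 / 2 ^ j) powr (m * p) / pi) * (\<integral>\<^sup>+z. ennreal (\<omega> (norm z)) * indicator {0..1} (norm z) * indicator (E j) z * indicator disc z \<partial>lborel)"
      by (rule nn_integral_cmult) measurable
    also have "(\<integral>\<^sup>+z. ennreal (\<omega> (norm z)) * indicator {0..1} (norm z) * indicator (E j) z * indicator disc z \<partial>lborel)
        = (\<integral>\<^sup>+z\<in>disc. ennreal (\<omega> (norm z)) * indicator (E j) z \<partial>lborel)"
      by (intro nn_integral_cong) (auto simp: indicator_def disc_def)
    also have "\<dots> \<le> ennreal (16 * (2 ^ j * \<delta>) * omega_hat \<omega> (max 0 (1 - 2 ^ j * \<delta>)))"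
      unfolding E_def by (rule nn_integral_omega_near_boundary_point[OF w a]) (use \<delta> in simp)
    also have "\<dots> \<le> ennreal (16 * (2 ^ j * \<delta>) * (C ^ j * omega_hat \<omega> (norm a)))"
      using omega_hat_doubling_scale[OF w C \<delta>, of j] \<delta> by (intro ennreal_leI mult_left_mono) (auto simp: \<delta>_def)
    finally have "(\<integral>\<^sup>+z. ennreal ((4 / 2 ^ j) powr (m * p)) * indicator (E j) z * W z * indicator disc z \<partial>lborel)
       \<le> ennreal ((4 / 2 ^ j) powr (m * p) / pi) * ennreal (16 * (2 ^ j * \<delta>) * (C ^ j * omega_hat \<omega> (norm a)))"
      by (simp add: mult_left_mono)
    also have "\<dots> = ennreal ((4 / 2 ^ j) powr (m * p) / pi * (16 * (2 ^ j * \<delta>) * (C ^ j * omega_hat \<omega> (norm a))))"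
      using \<delta> C om by (subst ennreal_mult) auto
    also have "\<dots> \<le> ennreal (4 powr (m * p) * 16 / pi * (omega_hat \<omega> (norm a) * \<delta>) * (1/2) ^ j)"
    proof (rule ennreal_leI)
      have "(4 / 2 ^ j) powr (m * p) * (2 ^ j * C ^ j) \<le> 4 powr (m * p) * (1/2) ^ j"
      proof -
        have e: "(2 ^ j) powr (m * p) = (2 powr (m * p)) ^ j"
          by (simp add: powr_powr mult.commute flip: powr_realpow)
        have "(4 * C) ^ j \<le> (2 powr (m * p)) ^ j" using m C by (intro power_mono) auto
        moreover have "(4 * C) ^ j = (2 * C * 2) ^ j" by simp
        ultimately have "2 ^ j * C ^ j * 2 ^ j \<le> (2 powr (m * p)) ^ j"
          by (simp only: power_mult_distrib)
        then have "4 powr (m * p) * (2 ^ j * C ^ j * 2 ^ j) \<le> 4 powr (m * p) * (2 powr (m * p)) ^ j" by (intro mult_left_mono) auto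
        note le = this
        have eq: "(4 / 2 ^ j) powr (m * p) = 4 powr (m * p) / (2 powr (m * p)) ^ j"
          by (simp add: powr_divide e)
        show ?thesis unfolding eq using le by (simp add: field_simps)
      qed
      then have "(4 / 2 ^ j) powr (m * p) * (2 ^ j * C ^ j) * (16 / pi * (omega_hat \<omega> (norm a) * \<delta>)) \<le> 4 powr (m * p) * (1/2) ^ j * (16 / pi * (omega_hat \<omega> (norm a) * \<delta>))"
        using om \<delta> by (intro mult_right_mono) auto
      then show "(4 / 2 ^ j) powr (m * p) / pi * (16 * (2 ^ j * \<delta>) * (C ^ j * omega_hat \<omega> (norm a)))
         \<le> 4 powr (m * p) * 16 / pi * (omega_hat \<omega> (norm a) * \<delta>) * (1/2) ^ j"
        by (simp add: ac_simps)
    qed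
    finally show "(\<integral>\<^sup>+z. ennreal ((4 / 2 ^ j) powr (m * p)) * indicator (E j) z * W z * indicator disc z \<partial>lborel) \<le> \<dots>" .
  qed auto
  also have "\<dots> = ennreal (\<Sum>j. 4 powr (m * p) * 16 / pi * (omega_hat \<omega> (norm a) * \<delta>) * (1/2) ^ j)"
    using om \<delta> by (intro suminf_ennreal2 summable_mult summable_geometric) auto
  also have "(\<Sum>j. 4 powr (m * p) * 16 / pi * (omega_hat \<omega> (norm a) * \<delta>) * (1/2) ^ j) = 4 powr (m * p) * 16 / pi * (omega_hat \<omega> (norm a) * \<delta>) * 2"
    by (subst suminf_mult) (auto simp: suminf_geometric)
  finally show ?thesis by (simp add: \<delta>_def ac_simps)
qed

text \<open>Going from r back to 0 takes i doublings with 2^i (1 - r) between 1 and 2, hence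
  \<open>omega_hat \<omega> r\<close> is at least C^(-i) \<open>omega_hat \<omega> 0\<close>: a
  lower bound by a power of 1 - r. The choice of m beats it with a factor 1 - r to spare, and this
  spare factor makes the normalised test functions tend to 0.\<close>

lemma one_minus_norm_powr_le:
  fixes m :: nat and p :: real
  assumes w: "radial_weight \<omega>" and C: "1 \<le> C" "\<And>r. 0 \<le> r \<Longrightarrow> r < 1 \<Longrightarrow> omega_hat \<omega> r \<le> C * omega_hat \<omega> ((1 + r) / 2)"
    and p: "0 < p" and m: "4 * C \<le> 2 powr (m * p)" and r: "0 \<le> r" "r < 1"
  shows "(1 - r) powr (m * p) \<le> 2 powr (m * p) / omega_hat \<omega> 0 * (1 - r) * (omega_hat \<omega> r * (1 - r))"
proof -
  define \<delta> where "\<delta> = 1 - r"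
  have \<delta>: "0 < \<delta>" "\<delta> \<le> 1" using r by (auto simp: \<delta>_def)
  have o0: "0 < omega_hat \<omega> 0" by (rule omega_hat_pos[OF w]) auto
  have ord: "0 \<le> omega_hat \<omega> r" by (rule nn_integral_omega(2)[OF w r(1)])
  obtain n where "1 / \<delta> < 2 ^ n" using real_arch_pow[of 2] by auto
  then have ex: "1 \<le> 2 ^ n * \<delta>" using \<delta> by (simp add: field_simps)
  define i where "i = (LEAST n. 1 \<le> 2 ^ n * \<delta>)"
  have i: "1 \<le> 2 ^ i * \<delta>" unfolding i_def by (rule LeastI[of _ n]) (rule ex)
  have i2: "2 ^ i * \<delta> \<le> 2"
  proof (cases i)
    case 0
    then show ?thesis using \<delta> by simp
  next
    case (Suc k)
    then have "\<not> 1 \<le> 2 ^ k * \<delta>" using not_less_Least[of k "\<lambda>n. 1 \<le> 2 ^ n * \<delta>"] i_def by simp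
    then show ?thesis using Suc by simp
  qed
  have "omega_hat \<omega> 0 \<le> C ^ i * omega_hat \<omega> r"
    using omega_hat_doubling_scale[OF w C \<delta>, of i] i by (simp add: \<delta>_def max_def split: if_splits)
  then have "omega_hat \<omega> 0 * 4 ^ i \<le> (4 * C) ^ i * omega_hat \<omega> r"
    by (simp add: power_mult_distrib)
  also have "\<dots> \<le> (2 powr (m * p)) ^ i * omega_hat \<omega> r"
    using m C ord by (intro mult_right_mono power_mono) auto
  finally have 1: "omega_hat \<omega> 0 * 4 ^ i \<le> (2 powr (m * p)) ^ i * omega_hat \<omega> r" .
  have e: "(2 ^ i) powr (m * p) = (2 powr (m * p)) ^ i"
    by (simp add: powr_powr mult.commute flip: powr_realpow)
  have "(2 ^ i * \<delta>) powr (m * p) \<le> 2 powr (m * p)" using i2 \<delta> p by (intro powr_mono2) auto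
  then have 2: "(2 powr (m * p)) ^ i * \<delta> powr (m * p) \<le> 2 powr (m * p)" using \<delta> by (simp add: powr_mult e)
  have "1 \<le> (2 ^ i * \<delta>)\<^sup>2" using i by (simp add: one_le_power)
  moreover have "(2 ^ i * \<delta>)\<^sup>2 = (2\<^sup>2) ^ i * \<delta>\<^sup>2"
    by (simp only: power_mult_distrib power_mult[symmetric] mult.commute)
  ultimately have 3: "1 \<le> 4 ^ i * \<delta>\<^sup>2" by simp
  have "\<delta> powr (m * p) * omega_hat \<omega> 0 \<le> \<delta> powr (m * p) * (omega_hat \<omega> 0 * (4 ^ i * \<delta>\<^sup>2))"
    using 3 o0 by (intro mult_left_mono) auto
  also have "\<dots> = (omega_hat \<omega> 0 * 4 ^ i) * (\<delta> powr (m * p) * \<delta>\<^sup>2)" by simp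
  also have "\<dots> \<le> ((2 powr (m * p)) ^ i * omega_hat \<omega> r) * (\<delta> powr (m * p) * \<delta>\<^sup>2)"
    using 1 by (intro mult_right_mono) auto
  also have "\<dots> = ((2 powr (m * p)) ^ i * \<delta> powr (m * p)) * (omega_hat \<omega> r * \<delta>\<^sup>2)" by simp
  also have "\<dots> \<le> 2 powr (m * p) * (omega_hat \<omega> r * \<delta>\<^sup>2)"
    using 2 ord by (intro mult_right_mono) auto
  finally show ?thesis using o0 by (simp add: \<delta>_def field_simps power2_eq_square)
qed

section \<open>Carleson embedding\<close>

text \<open>The product \<open>omega_hat \<omega> r * (1 - r)\<close> is the usual size of the
  \<omega>-area of a Carleson square at distance 1 - r from the circle; the exponent q/p is that of
  a (p, q) Carleson measure, and the first factor is the price of k derivatives.\<close>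

definition carleson_gauge :: "(real \<Rightarrow> real) \<Rightarrow> real \<Rightarrow> real \<Rightarrow> nat \<Rightarrow> real \<Rightarrow> real" where
  "carleson_gauge \<omega> p q k r = (1 - r) powr (k * q) * (omega_hat \<omega> r * (1 - r)) powr (q / p)"

text \<open>The integrand of \<open>Ap_int_regularized_le\<close>, cut off to the disc so that it
  can be integrated over the plane and over arbitrary balls.\<close>

definition reg_density :: "(real \<Rightarrow> real) \<Rightarrow> real \<Rightarrow> (complex \<Rightarrow> complex) \<Rightarrow> complex \<Rightarrow> ennreal" where
  "reg_density \<omega> p f z = ennreal (norm (f z) powr p) * ennreal (omega_hat \<omega> (norm z) / (1 - norm z)) * indicator disc z"

lemma carleson_gauge_pos:
  assumes "radial_weight \<omega>" "0 \<le> r" "r < 1"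
  shows "0 < carleson_gauge \<omega> p q k r"
  unfolding carleson_gauge_def using omega_hat_pos[OF assms] assms by simp

lemma omega_hat_near:
  assumes w: "radial_weight \<omega>" and C: "1 \<le> C" "\<And>r. 0 \<le> r \<Longrightarrow> r < 1 \<Longrightarrow> omega_hat \<omega> r \<le> C * omega_hat \<omega> ((1 + r) / 2)"
    and r: "0 \<le> r" "r < 1" "0 \<le> s" "1 - r \<le> 2 * (1 - s)"
  shows "omega_hat \<omega> r \<le> C * omega_hat \<omega> s"
proof -
  have "omega_hat \<omega> r \<le> C * omega_hat \<omega> ((1 + r) / 2)" by (rule C(2)) (use r in auto)
  also have "\<dots> \<le> C * omega_hat \<omega> s"
    using C(1) r by (intro mult_left_mono omega_hat_antimono[OF w]) auto
  finally show ?thesis .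
qed

text \<open>The unequal radii 1/4 and 1/2 allow the two centres to be interchanged, which the
  exchange of integrals in \<open>carleson_embedding\<close> calls for.\<close>

lemma norm_near_disc:
  fixes w z :: complex
  assumes "dist w z < (1 - norm w) / 4"
  shows "3/4 * (1 - norm w) < 1 - norm z" "1 - norm z < 5/4 * (1 - norm w)"
    and "dist z w < (1 - norm z) / 2"
proof -
  have "\<bar>norm w - norm z\<bar> \<le> dist w z" unfolding dist_norm by (rule norm_triangle_ineq3)
  then show *: "3/4 * (1 - norm w) < 1 - norm z" "1 - norm z < 5/4 * (1 - norm w)" using assms by auto
  have "0 < (1 - norm w) / 4" by (rule le_less_trans[OF zero_le_dist assms])
  then show "dist z w < (1 - norm z) / 2" using * assms by (simp add: dist_commute)
qed

lemma carleson_gauge_near: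
  assumes w: "radial_weight \<omega>" and C: "1 \<le> C" "\<And>r. 0 \<le> r \<Longrightarrow> r < 1 \<Longrightarrow> omega_hat \<omega> r \<le> C * omega_hat \<omega> ((1 + r) / 2)"
    and p: "0 < p" "0 < q" and r: "0 \<le> r" "r < 1" "0 \<le> s" "s < 1" "1 - r \<le> 5/4 * (1 - s)"
  shows "carleson_gauge \<omega> p q k r \<le> (5/4) powr (k * q) * (5/4 * C) powr (q / p) * carleson_gauge \<omega> p q k s"
proof -
  have 1: "(1 - r) powr (k * q) \<le> (5/4 * (1 - s)) powr (k * q)"
    using r p by (intro powr_mono2) auto
  have "omega_hat \<omega> r * (1 - r) \<le> (C * omega_hat \<omega> s) * (5/4 * (1 - s))"
    using omega_hat_near[OF w C, of r s] r nn_integral_omega(2)[OF w, of s] C(1) by (intro mult_mono) auto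
  then have 2: "(omega_hat \<omega> r * (1 - r)) powr (q / p) \<le> ((5/4 * C) * (omega_hat \<omega> s * (1 - s))) powr (q / p)"
    using r p nn_integral_omega(2)[OF w, of r] by (intro powr_mono2) (auto simp: ac_simps)
  have "carleson_gauge \<omega> p q k r \<le> (5/4 * (1 - s)) powr (k * q) * ((5/4 * C) * (omega_hat \<omega> s * (1 - s))) powr (q / p)"
    unfolding carleson_gauge_def using 1 2 by (intro mult_mono) auto
  also have "\<dots> = (5/4) powr (k * q) * (5/4 * C) powr (q / p) * carleson_gauge \<omega> p q k s"
  proof -
    have "(5/4 * (1 - s)) powr (k * q) = (5/4) powr (k * q) * (1 - s) powr (k * q)"
      by (rule powr_mult)
    moreover have "((5/4 * C) * (omega_hat \<omega> s * (1 - s))) powr (q / p) = (5/4 * C) powr (q / p) * (omega_hat \<omega> s * (1 - s)) powr (q / p)"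
      by (rule powr_mult)
    ultimately show ?thesis unfolding carleson_gauge_def by (simp only: ac_simps)
  qed
  finally show ?thesis .
qed

lemma reg_density_measurable:
  assumes w: "radial_weight \<omega>" and f: "f holomorphic_on disc"
  shows "reg_density \<omega> p f \<in> borel_measurable borel"
proof -
  note [measurable] = omega_hat_measurable[OF w] borel_measurable_powr_indicator[OF holomorphic_on_imp_continuous_on[OF f]]
  have [measurable]: "disc \<in> sets borel" by (simp add: disc_def)
  have "(\<lambda>z. ennreal (norm (f z) powr p) * indicator disc z * ennreal (omega_hat \<omega> (max 0 (norm z)) / (1 - norm z))) \<in> borel_measurable borel"
    by measurable
  then show ?thesis
    by (rule back_subst[of "\<lambda>h. h \<in> borel_measurable borel"]) (auto simp: reg_density_def fun_eq_iff ac_simps)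
qed

text \<open>On the ball of radius (1 - |w|)/4 the regularised weight is bounded below by a multiple
  of its value at |w|. The local derivative bound therefore controls |f^(k)(w)|^p by the local
  integral X of \<open>reg_density\<close>, divided by (1 - |w|)^(kp) times
  \<open>omega_hat \<omega> (norm w) * (1 - norm w)\<close>; raising this to the power q/p produces
  the gauge.\<close>

lemma higher_deriv_le_reg_density:
  assumes w: "weight_D \<omega>" and p: "1 < p" "p \<le> q"
  shows "\<exists>c>0. \<forall>f w. f holomorphic_on disc \<longrightarrow> Ap_int \<omega> p f \<le> 1 \<longrightarrow> norm w < 1 \<longrightarrow>
    ennreal (norm ((deriv ^^ k) f w) powr q)
      \<le> ennreal (c / carleson_gauge \<omega> p q k (norm w)) * (\<integral>\<^sup>+z\<in>ball w ((1 - norm w) / 4). reg_density \<omega> p f z \<partial>lborel)"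
proof -
  have rw: "radial_weight \<omega>" using w by (simp add: weight_D_def weight_Dhat_def)
  obtain C1 where C1: "C1 \<ge> 1" "\<And>r. 0 \<le> r \<Longrightarrow> r < 1 \<Longrightarrow> omega_hat \<omega> r \<le> C1 * omega_hat \<omega> ((1 + r) / 2)"
    using w unfolding weight_D_def weight_Dhat_def by auto
  obtain C0 where C0: "C0 > 0" "\<And>f. f holomorphic_on disc \<Longrightarrow> (\<integral>\<^sup>+z. reg_density \<omega> p f z \<partial>lborel) \<le> ennreal C0 * Ap_int \<omega> p f"
    using Ap_int_regularized_le[OF w p(1)] unfolding reg_density_def by auto
  define c1 where "c1 = (fact k * 2 ^ k) powr p * 4 / pi"
  define c2 where "c2 = c1 * 4 powr (2 + k * p) * (5/4 * C1)"
  define c3 where "c3 = c2 powr (q / p) * C0 powr (q / p - 1)"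
  have c1: "0 < c1" by (simp add: c1_def)
  have c2: "0 < c2" using c1 C1 by (simp add: c2_def)
  have c3: "0 < c3" using c2 C0 by (simp add: c3_def)
  show ?thesis
  proof (intro exI[of _ c3] conjI allI impI c3)
    fix f w assume f: "f holomorphic_on disc" and f1: "Ap_int \<omega> p f \<le> 1" and wn: "norm (w::complex) < 1"
    define \<delta> where "\<delta> = 1 - norm w"
    have \<delta>: "0 < \<delta>" using wn by (simp add: \<delta>_def)
    have om: "0 < omega_hat \<omega> (norm w)" using omega_hat_pos[OF rw] wn by simp
    define B where "B = ball w (\<delta> / 4)"
    have Bd: "B \<subseteq> disc"
    proof
      fix z assume "z \<in> B"
      then have "3/4 * (1 - norm w) < 1 - norm z" by (intro norm_near_disc) (simp add: B_def \<delta>_def)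
      then have "norm z < 1" using wn by simp
      then show "z \<in> disc" by (simp add: disc_def)
    qed
    define X where "X = (\<integral>\<^sup>+z\<in>B. reg_density \<omega> p f z \<partial>lborel)"
    have "X \<le> (\<integral>\<^sup>+z. reg_density \<omega> p f z \<partial>lborel)"
      unfolding X_def by (intro nn_integral_mono) (auto simp: indicator_def)
    also have "\<dots> \<le> ennreal C0 * Ap_int \<omega> p f" by (rule C0(2)[OF f])
    also have "\<dots> \<le> ennreal C0 * 1" by (intro mult_left_mono f1) simp
    finally have XC: "X \<le> ennreal C0" by simp
    define x where "x = enn2real X"
    have x: "X = ennreal x" "0 \<le> x" using le_less_trans[OF XC ennreal_less_top] by (auto simp: x_def)
    have xC: "x \<le> C0" using XC x C0 by simp
    have m: "(\<lambda>z. reg_density \<omega> p f z * indicator B z) \<in> borel_measurable borel"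
      unfolding B_def by (intro borel_measurable_times_ennreal borel_measurable_indicator reg_density_measurable[OF rw f]) simp
    have "(\<integral>\<^sup>+z\<in>B. ennreal (norm (f z) powr p) \<partial>lborel)
       \<le> (\<integral>\<^sup>+z. ennreal (5/4 * C1 * \<delta> / omega_hat \<omega> (norm w)) * (reg_density \<omega> p f z * indicator B z) \<partial>lborel)"
    proof (rule nn_integral_mono)
      fix z
      show "ennreal (norm (f z) powr p) * indicator B z \<le> ennreal (5/4 * C1 * \<delta> / omega_hat \<omega> (norm w)) * (reg_density \<omega> p f z * indicator B z)"
      proof (cases "z \<in> B")
        case True
        then have z: "3/4 * \<delta> < 1 - norm z" "1 - norm z < 5/4 * \<delta>"
          using norm_near_disc[of w z] by (auto simp: B_def \<delta>_def)
        have zd: "z \<in> disc" using True Bd by blast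
        have "omega_hat \<omega> (norm w) \<le> C1 * omega_hat \<omega> (norm z)"
          by (rule omega_hat_near[OF rw C1]) (use wn z \<delta> in \<open>auto simp: \<delta>_def\<close>)
        then have "omega_hat \<omega> (norm w) * (1 - norm z) \<le> (C1 * omega_hat \<omega> (norm z)) * (5/4 * \<delta>)"
          using z \<delta> om by (intro mult_mono) auto
        then have 1: "1 \<le> 5/4 * C1 * \<delta> / omega_hat \<omega> (norm w) * (omega_hat \<omega> (norm z) / (1 - norm z))"
          using om z \<delta> by (simp add: field_simps)
        have 0: "0 \<le> 5/4 * C1 * \<delta> / omega_hat \<omega> (norm w)" using C1 \<delta> om by simp
        have "ennreal (norm (f z) powr p) * 1 \<le> ennreal (norm (f z) powr p) * ennreal (5/4 * C1 * \<delta> / omega_hat \<omega> (norm w) * (omega_hat \<omega> (norm z) / (1 - norm z)))"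
          using ennreal_leI[OF 1] by (intro mult_left_mono) auto
        also have "\<dots> = ennreal (5/4 * C1 * \<delta> / omega_hat \<omega> (norm w)) * (ennreal (norm (f z) powr p) * ennreal (omega_hat \<omega> (norm z) / (1 - norm z)))"
          using z \<delta> nn_integral_omega(2)[OF rw, of "norm z"] by (subst ennreal_mult[OF 0]) (auto simp: ac_simps)
        finally show ?thesis using True zd by (simp add: reg_density_def)
      qed simp
    qed
    also have "\<dots> = ennreal (5/4 * C1 * \<delta> / omega_hat \<omega> (norm w)) * X"
      unfolding X_def by (rule nn_integral_cmult) (use m in simp)
    finally have fX: "(\<integral>\<^sup>+z\<in>B. ennreal (norm (f z) powr p) \<partial>lborel) \<le> ennreal (5/4 * C1 * \<delta> / omega_hat \<omega> (norm w)) * X" .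
    have "ennreal (norm ((deriv ^^ k) f w) powr p) \<le> ennreal (c1 * (\<delta> / 4) powr (- (2 + k * p))) * (\<integral>\<^sup>+z\<in>B. ennreal (norm (f z) powr p) \<partial>lborel)"
      unfolding c1_def B_def
      by (rule higher_deriv_powr_le_integral[OF holomorphic_on_subset[OF f]]) (use Bd \<delta> p in \<open>auto simp: B_def\<close>)
    also have "\<dots> \<le> ennreal (c1 * (\<delta> / 4) powr (- (2 + k * p))) * (ennreal (5/4 * C1 * \<delta> / omega_hat \<omega> (norm w)) * ennreal x)"
      using fX unfolding x(1)[symmetric] by (rule mult_left_mono) simp
    also have "\<dots> = ennreal (c1 * (\<delta> / 4) powr (- (2 + k * p)) * (5/4 * C1 * \<delta> / omega_hat \<omega> (norm w) * x))"
      using C1 \<delta> om x c1 by (subst ennreal_mult[symmetric], simp, simp, subst ennreal_mult[symmetric]) auto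
    finally have "norm ((deriv ^^ k) f w) powr p \<le> c1 * (\<delta> / 4) powr (- (2 + k * p)) * (5/4 * C1 * \<delta> / omega_hat \<omega> (norm w) * x)"
      using C1 \<delta> om x c1 by (subst (asm) ennreal_le_iff) auto
    also have "(\<delta> / 4) powr (- (2 + k * p)) = 4 powr (2 + k * p) * (\<delta> powr (- (k * p)) / \<delta>\<^sup>2)"
    proof -
      have "\<delta> powr (- (2 + k * p)) = \<delta> powr (- (k * p)) / \<delta>\<^sup>2"
        using \<delta> powr_add[of \<delta> "-2" "- (k*p)"] by (simp add: powr_minus field_simps)
      moreover have "(\<delta> / 4) powr (- (2 + k * p)) = \<delta> powr (- (2 + k * p)) * 4 powr (2 + k * p)"
        unfolding powr_divide powr_minus[of 4] by (simp only: divide_inverse inverse_inverse_eq)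
      ultimately show ?thesis by simp
    qed
    also have "c1 * (4 powr (2 + k * p) * (\<delta> powr (- (k * p)) / \<delta>\<^sup>2)) * (5/4 * C1 * \<delta> / omega_hat \<omega> (norm w) * x)
        = c2 * (\<delta> powr (- (k * p)) / (omega_hat \<omega> (norm w) * \<delta>)) * x"
      unfolding c2_def using \<delta> om by (simp add: field_simps power2_eq_square)
    finally have le: "norm ((deriv ^^ k) f w) powr p \<le> c2 * (\<delta> powr (- (k * p)) / (omega_hat \<omega> (norm w) * \<delta>)) * x" .
    have qp: "1 \<le> q / p" using p by simp
    have "norm ((deriv ^^ k) f w) powr q = (norm ((deriv ^^ k) f w) powr p) powr (q / p)"
      using p by (simp add: powr_powr)
    also have "\<dots> \<le> (c2 * (\<delta> powr (- (k * p)) / (omega_hat \<omega> (norm w) * \<delta>)) * x) powr (q / p)"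
      using le qp by (intro powr_mono2) auto
    also have "\<dots> = c2 powr (q / p) * (1 / carleson_gauge \<omega> p q k (norm w)) * x powr (q / p)"
    proof -
      have "(\<delta> powr (- (k * p)) / (omega_hat \<omega> (norm w) * \<delta>)) powr (q / p) = 1 / carleson_gauge \<omega> p q k (norm w)"
      proof -
        have "- (k * p) * (q / p) = - (k * q)" using p by simp
        then show ?thesis
          unfolding carleson_gauge_def \<delta>_def[symmetric] powr_divide powr_powr by (simp add: powr_minus_divide)
      qed
      then show ?thesis by (simp only: powr_mult)
    qed
    \<comment> \<open>Here p <= q enters: X is at most C0 on the unit ball, so the surplus power q/p
      - 1 is bounded and the estimate becomes linear in X, ready for Fubini.\<close>
    also have "x powr (q / p) \<le> C0 powr (q / p - 1) * x"
    proof (cases "x = 0")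
      case False
      then have "x powr (q / p) = x powr (q / p - 1) * x"
        using x powr_add[of x "q / p - 1" 1] by simp
      also have "\<dots> \<le> C0 powr (q / p - 1) * x"
        using x xC qp by (intro mult_right_mono powr_mono2) auto
      finally show ?thesis .
    qed (use qp in simp)
    finally have "norm ((deriv ^^ k) f w) powr q \<le> c3 / carleson_gauge \<omega> p q k (norm w) * x"
      using c2 carleson_gauge_pos[OF rw, of "norm w" p q k] wn by (simp add: c3_def ac_simps mult_left_mono divide_right_mono)
    then have "ennreal (norm ((deriv ^^ k) f w) powr q) \<le> ennreal (c3 / carleson_gauge \<omega> p q k (norm w)) * ennreal x"
      using x c3 carleson_gauge_pos[OF rw, of "norm w" p q k] wn
      by (subst ennreal_mult[symmetric]) (auto intro: ennreal_leI)
    then show "ennreal (norm ((deriv ^^ k) f w) powr q)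
      \<le> ennreal (c3 / carleson_gauge \<omega> p q k (norm w)) * (\<integral>\<^sup>+z\<in>ball w ((1 - norm w) / 4). reg_density \<omega> p f z \<partial>lborel)"
      unfolding x(1)[symmetric] X_def B_def \<delta>_def .
  qed
qed

lemma carleson_gauge_measurable:
  assumes "radial_weight \<omega>"
  shows "(\<lambda>r. carleson_gauge \<omega> p q k (max 0 r)) \<in> borel_measurable borel"
proof -
  note [measurable] = omega_hat_measurable[OF assms]
  show ?thesis unfolding carleson_gauge_def by measurable
qed

text \<open>Insert the local bound at \<tau>(z) and exchange the integrals. For fixed \<zeta>, the z
  whose \<tau>(z) has \<zeta> in its ball belong to the set that the hypothesis measures at a =
  \<zeta>, and its mass cancels the gauge in the denominator; the total integral of
  \<open>reg_density\<close> remains. The measure is kept on the domain of \<tau>, with preimages in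
  the hypothesis, instead of being pushed forward.\<close>

lemma carleson_embedding:
  assumes w: "weight_D \<omega>" and p: "1 < p" "p \<le> q"
  shows "\<exists>C>0. \<forall>(\<nu>::complex measure) \<tau> M R f.
    sets \<nu> = sets borel \<longrightarrow> finite_measure \<nu> \<longrightarrow> \<tau> \<in> borel_measurable borel \<longrightarrow> range \<tau> \<subseteq> disc \<longrightarrow> 0 \<le> M \<longrightarrow>
    (\<forall>a. R \<le> norm a \<longrightarrow> norm a < 1 \<longrightarrow>
       emeasure \<nu> {z. dist a (\<tau> z) < (1 - norm a) / 2} \<le> ennreal (M * carleson_gauge \<omega> p q k (norm a))) \<longrightarrow>
    f holomorphic_on disc \<longrightarrow> Ap_int \<omega> p f \<le> 1 \<longrightarrow>
    (\<integral>\<^sup>+z. ennreal (norm ((deriv ^^ k) f (\<tau> z)) powr q) * indicator {z. 1 - 4/5 * (1 - R) < norm (\<tau> z)} z \<partial>\<nu>) \<le> ennreal (C * M)"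
proof -
  have rw: "radial_weight \<omega>" using w by (simp add: weight_D_def weight_Dhat_def)
  obtain C1 where C1: "C1 \<ge> 1" "\<And>r. 0 \<le> r \<Longrightarrow> r < 1 \<Longrightarrow> omega_hat \<omega> r \<le> C1 * omega_hat \<omega> ((1 + r) / 2)"
    using w unfolding weight_D_def weight_Dhat_def by auto
  obtain C0 where C0: "C0 > 0" "\<And>f. f holomorphic_on disc \<Longrightarrow> (\<integral>\<^sup>+z. reg_density \<omega> p f z \<partial>lborel) \<le> ennreal C0 * Ap_int \<omega> p f"
    using Ap_int_regularized_le[OF w p(1)] unfolding reg_density_def by auto
  obtain c3 where c3: "c3 > 0" "\<And>f w. f holomorphic_on disc \<Longrightarrow> Ap_int \<omega> p f \<le> 1 \<Longrightarrow> norm w < 1 \<Longrightarrow>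
    ennreal (norm ((deriv ^^ k) f w) powr q)
      \<le> ennreal (c3 / carleson_gauge \<omega> p q k (norm w)) * (\<integral>\<^sup>+z\<in>ball w ((1 - norm w) / 4). reg_density \<omega> p f z \<partial>lborel)"
    using higher_deriv_le_reg_density[OF w p, of k] by blast
  define c4 where "c4 = (5/4) powr (k * q) * (5/4 * C1) powr (q / p)"
  have c4: "0 < c4" using C1 by (simp add: c4_def)
  show ?thesis
  proof (intro exI[of _ "c3 * c4 * C0"] conjI allI impI)
    show "0 < c3 * c4 * C0" using c3 c4 C0 by simp
    fix \<nu> :: "complex measure" and \<tau> M R f
    assume s: "sets \<nu> = sets borel" and fin: "finite_measure \<nu>" and \<tau>: "\<tau> \<in> borel_measurable borel" and rng: "range \<tau> \<subseteq> disc"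
      and M: "0 \<le> M" and f: "f holomorphic_on disc" and f1: "Ap_int \<omega> p f \<le> 1"
      and car: "\<forall>a. R \<le> norm a \<longrightarrow> norm a < 1 \<longrightarrow>
       emeasure \<nu> {z. dist a (\<tau> z) < (1 - norm a) / 2} \<le> ennreal (M * carleson_gauge \<omega> p q k (norm a))"
    interpret \<nu>: finite_measure \<nu> by (rule fin)
    interpret P: pair_sigma_finite \<nu> lborel ..
    have \<tau>1: "norm (\<tau> z) < 1" for z using rng[THEN subsetD, of "\<tau> z"] by (simp add: disc_def)
    have \<tau>m[measurable]: "\<tau> \<in> borel_measurable \<nu>" using \<tau> measurable_cong_sets[OF s refl] by blast
    note [measurable] = reg_density_measurable[OF rw f] carleson_gauge_measurable[OF rw]
    define G where "G = reg_density \<omega> p f"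
    have G[measurable]: "G \<in> borel_measurable borel" unfolding G_def by measurable
    define \<Phi> where "\<Phi> = (\<lambda>r. carleson_gauge \<omega> p q k (max 0 r))"
    have [measurable]: "\<Phi> \<in> borel_measurable borel" unfolding \<Phi>_def by measurable
    \<comment> \<open>A point \<zeta> in the ball about \<tau>(z) satisfies 1 - |\<zeta>| < 5/4 (1 -
      |\<tau>(z)|). So |\<tau>(z)| > R' ensures |\<zeta>| > R, where the hypothesis is
      available.\<close>
    define R' where "R' = 1 - 4/5 * (1 - R)"
    define H where "H = (\<lambda>z \<zeta>. ennreal (c3 / \<Phi> (norm (\<tau> z))) * indicator {z. R' < norm (\<tau> z)} z * (G \<zeta> * indicator {x. dist (\<tau> (fst x)) (snd x) < (1 - norm (\<tau> (fst x))) / 4} (z, \<zeta>)))"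
    have sp: "space \<nu> = UNIV" using sets_eq_imp_space_eq[OF s] by simp
    have [measurable]: "{z. R' < norm (\<tau> z)} \<in> sets \<nu>"
    proof -
      have "{z\<in>space \<nu>. R' < norm (\<tau> z)} \<in> sets \<nu>" by measurable
      then show ?thesis by (simp add: sp)
    qed
    have [measurable]: "{x. dist (\<tau> (fst x)) (snd x) < (1 - norm (\<tau> (fst x))) / 4} \<in> sets (\<nu> \<Otimes>\<^sub>M lborel)"
    proof -
      have "{x\<in>space (\<nu> \<Otimes>\<^sub>M lborel). dist (\<tau> (fst x)) (snd x) < (1 - norm (\<tau> (fst x))) / 4} \<in> sets (\<nu> \<Otimes>\<^sub>M lborel)" by measurable
      then show ?thesis by (simp add: sp space_pair_measure)
    qed
    have H[measurable]: "(\<lambda>(z, \<zeta>). H z \<zeta>) \<in> borel_measurable (\<nu> \<Otimes>\<^sub>M lborel)"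
      unfolding H_def by measurable
    have "(\<integral>\<^sup>+z. ennreal (norm ((deriv ^^ k) f (\<tau> z)) powr q) * indicator {z. R' < norm (\<tau> z)} z \<partial>\<nu>)
       \<le> (\<integral>\<^sup>+z. (\<integral>\<^sup>+\<zeta>. H z \<zeta> \<partial>lborel) \<partial>\<nu>)"
    proof (rule nn_integral_mono)
      fix z
      have ind: "indicator {x. dist (\<tau> (fst x)) (snd x) < (1 - norm (\<tau> (fst x))) / 4} (z, \<zeta>) = (indicator (ball (\<tau> z) ((1 - norm (\<tau> z)) / 4)) \<zeta> :: ennreal)" for \<zeta>
        by (simp add: indicator_def)
      have "ennreal (norm ((deriv ^^ k) f (\<tau> z)) powr q) * indicator {z. R' < norm (\<tau> z)} z
        \<le> ennreal (c3 / carleson_gauge \<omega> p q k (norm (\<tau> z))) * (\<integral>\<^sup>+\<zeta>\<in>ball (\<tau> z) ((1 - norm (\<tau> z)) / 4). G \<zeta> \<partial>lborel) * indicator {z. R' < norm (\<tau> z)} z"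
        unfolding G_def by (intro mult_right_mono c3(2) f f1 \<tau>1) simp
      also have "\<dots> = (ennreal (c3 / \<Phi> (norm (\<tau> z))) * indicator {z. R' < norm (\<tau> z)} z) * (\<integral>\<^sup>+\<zeta>\<in>ball (\<tau> z) ((1 - norm (\<tau> z)) / 4). G \<zeta> \<partial>lborel)"
        by (simp add: \<Phi>_def ac_simps)
      also have "\<dots> = (\<integral>\<^sup>+\<zeta>. H z \<zeta> \<partial>lborel)"
        unfolding H_def ind
        by (rule nn_integral_cmult[symmetric]) (intro borel_measurable_times_ennreal borel_measurable_indicator, simp_all)
      finally show "ennreal (norm ((deriv ^^ k) f (\<tau> z)) powr q) * indicator {z. R' < norm (\<tau> z)} z \<le> (\<integral>\<^sup>+\<zeta>. H z \<zeta> \<partial>lborel)" .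
    qed
    also have "\<dots> = (\<integral>\<^sup>+\<zeta>. (\<integral>\<^sup>+z. H z \<zeta> \<partial>\<nu>) \<partial>lborel)"
      by (rule P.Fubini'[symmetric]) measurable
    also have "\<dots> \<le> (\<integral>\<^sup>+\<zeta>. ennreal (c3 * c4 * M) * G \<zeta> \<partial>lborel)"
    proof (rule nn_integral_mono)
      fix \<zeta> :: complex
      show "(\<integral>\<^sup>+z. H z \<zeta> \<partial>\<nu>) \<le> ennreal (c3 * c4 * M) * G \<zeta>"
      proof (cases "\<exists>z. H z \<zeta> \<noteq> 0")
        case False
        then have "(\<integral>\<^sup>+z. H z \<zeta> \<partial>\<nu>) = 0" by simp
        then show ?thesis by simp
      next
        case True
        have sub: "dist \<zeta> (\<tau> z) < (1 - norm \<zeta>) / 2" "R < norm \<zeta>" "1 - norm \<zeta> \<le> 5/4 * (1 - norm (\<tau> z))" "norm \<zeta> < 1"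
          if "R' < norm (\<tau> z)" "dist (\<tau> z) \<zeta> < (1 - norm (\<tau> z)) / 4" for z
        proof -
          note nd = norm_near_disc[OF that(2)]
          show "dist \<zeta> (\<tau> z) < (1 - norm \<zeta>) / 2" by (rule nd(3))
          show "1 - norm \<zeta> \<le> 5/4 * (1 - norm (\<tau> z))" using nd(2) by simp
          show "norm \<zeta> < 1" using nd(1) \<tau>1[of z] by argo
          show "R < norm \<zeta>" using nd(2) that(1) unfolding R'_def by argo
        qed
        have hz: "R' < norm (\<tau> z) \<and> dist (\<tau> z) \<zeta> < (1 - norm (\<tau> z)) / 4" if "H z \<zeta> \<noteq> 0" for z
          using that unfolding H_def by (auto simp: indicator_def split: if_splits)
        from True obtain z0 where "H z0 \<zeta> \<noteq> 0" by blast
        then have \<zeta>: "R < norm \<zeta>" "norm \<zeta> < 1" using sub hz by blast+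
        define S where "S = {z. dist \<zeta> (\<tau> z) < (1 - norm \<zeta>) / 2}"
        have Sm: "S \<in> sets \<nu>"
        proof -
          have "{z\<in>space \<nu>. dist \<zeta> (\<tau> z) < (1 - norm \<zeta>) / 2} \<in> sets \<nu>" by measurable
          then show ?thesis by (simp add: sp S_def)
        qed
        have \<Phi>\<zeta>: "0 < \<Phi> (norm \<zeta>)" unfolding \<Phi>_def using carleson_gauge_pos[OF rw, of "norm \<zeta>"] \<zeta> by simp
        have "(\<integral>\<^sup>+z. H z \<zeta> \<partial>\<nu>) \<le> (\<integral>\<^sup>+z. ennreal (c3 * c4 / \<Phi> (norm \<zeta>)) * G \<zeta> * indicator S z \<partial>\<nu>)"
        proof (rule nn_integral_mono)
          fix z
          show "H z \<zeta> \<le> ennreal (c3 * c4 / \<Phi> (norm \<zeta>)) * G \<zeta> * indicator S z"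
          proof (cases "H z \<zeta> = 0")
            case False
            note h = hz[OF False]
            have "\<Phi> (norm \<zeta>) \<le> c4 * \<Phi> (norm (\<tau> z))"
              unfolding \<Phi>_def c4_def using carleson_gauge_near[OF rw C1, of p q "norm \<zeta>" "norm (\<tau> z)" k] p \<zeta> \<tau>1[of z] sub[of z] h
              by simp
            moreover have "0 < \<Phi> (norm (\<tau> z))" unfolding \<Phi>_def using carleson_gauge_pos[OF rw, of "norm (\<tau> z)"] \<tau>1 by simp
            ultimately have "c3 / \<Phi> (norm (\<tau> z)) \<le> c3 * c4 / \<Phi> (norm \<zeta>)"
              using \<Phi>\<zeta> c3 by (simp add: field_simps)
            then have "ennreal (c3 / \<Phi> (norm (\<tau> z))) * G \<zeta> \<le> ennreal (c3 * c4 / \<Phi> (norm \<zeta>)) * G \<zeta>"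
              by (intro mult_right_mono ennreal_leI) auto
            then show ?thesis using h sub[of z] by (simp add: H_def S_def)
          qed simp
        qed
        also have "\<dots> = ennreal (c3 * c4 / \<Phi> (norm \<zeta>)) * G \<zeta> * emeasure \<nu> S"
          using Sm by (rule nn_integral_cmult_indicator)
        also have "\<dots> \<le> ennreal (c3 * c4 / \<Phi> (norm \<zeta>)) * G \<zeta> * ennreal (M * \<Phi> (norm \<zeta>))"
          using car \<zeta> unfolding S_def \<Phi>_def by (intro mult_left_mono) auto
        also have "\<dots> = ennreal (c3 * c4 / \<Phi> (norm \<zeta>)) * ennreal (M * \<Phi> (norm \<zeta>)) * G \<zeta>"
          by (simp add: ac_simps)
        also have "ennreal (c3 * c4 / \<Phi> (norm \<zeta>)) * ennreal (M * \<Phi> (norm \<zeta>)) = ennreal (c3 * c4 * M)"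
          using \<Phi>\<zeta> M c3 c4 by (subst ennreal_mult[symmetric]) auto
        finally show ?thesis .
      qed
    qed
    also have "\<dots> = ennreal (c3 * c4 * M) * (\<integral>\<^sup>+\<zeta>. G \<zeta> \<partial>lborel)"
      by (rule nn_integral_cmult) measurable
    also have "\<dots> \<le> ennreal (c3 * c4 * M) * ennreal C0"
    proof (rule mult_left_mono)
      have "(\<integral>\<^sup>+\<zeta>. G \<zeta> \<partial>lborel) \<le> ennreal C0 * Ap_int \<omega> p f" unfolding G_def by (rule C0(2)[OF f])
      also have "\<dots> \<le> ennreal C0 * 1" by (intro mult_left_mono f1) simp
      finally show "(\<integral>\<^sup>+\<zeta>. G \<zeta> \<partial>lborel) \<le> ennreal C0" by simp
    qed simp
    also have "\<dots> = ennreal (c3 * c4 * C0 * M)"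
      using c3 c4 M C0 by (subst ennreal_mult[symmetric]) (auto simp: ac_simps)
    finally show "(\<integral>\<^sup>+z. ennreal (norm ((deriv ^^ k) f (\<tau> z)) powr q) * indicator {z. 1 - 4/5 * (1 - R) < norm (\<tau> z)} z \<partial>\<nu>) \<le> ennreal (c3 * c4 * C0 * M)"
      unfolding R'_def .
  qed
qed

section \<open>Lebesgue and Bergman integrals\<close>

lemma root_enn_le_iff:
  assumes "0 < p" "0 \<le> c"
  shows "root_enn I p \<le> ennreal c \<longleftrightarrow> I \<le> ennreal (c powr p)"
proof (cases "I = \<infinity>")
  case True
  then show ?thesis by (simp add: root_enn_def top_unique)
next
  case False
  then obtain x where x: "I = ennreal x" "0 \<le> x" by (cases I) auto
  have "x powr (1 / p) \<le> c \<longleftrightarrow> x \<le> c powr p"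
  proof
    assume "x powr (1 / p) \<le> c"
    then have "(x powr (1 / p)) powr p \<le> c powr p" using assms by (intro powr_mono2) auto
    then show "x \<le> c powr p" using assms x by (simp add: powr_powr)
  next
    assume "x \<le> c powr p"
    then have "x powr (1 / p) \<le> (c powr p) powr (1 / p)" using assms x by (intro powr_mono2) auto
    then show "x powr (1 / p) \<le> c" using assms by (simp add: powr_powr)
  qed
  then show ?thesis using x assms by (simp add: root_enn_def)
qed

lemma Ap_norm_le_1_iff: "0 < p \<Longrightarrow> Ap_norm \<omega> p f \<le> 1 \<longleftrightarrow> Ap_int \<omega> p f \<le> 1"
  using root_enn_le_iff[of p 1 "Ap_int \<omega> p f"] by (simp add: Ap_norm_def)

section \<open>Measurability and quasi-norm estimates in L^q\<close>

lemma norm_add_powr_le: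
  fixes x y :: "'a::real_normed_vector"
  assumes q: "0 \<le> q"
  shows "norm (x + y) powr q \<le> 2 powr q * (norm x powr q + norm y powr q)"
proof -
  define M where "M = max (norm x) (norm y)"
  have "norm (x + y) \<le> 2 * M" using norm_triangle_ineq[of x y] by (simp add: M_def max_def)
  then have "norm (x + y) powr q \<le> (2 * M) powr q" using q by (intro powr_mono2) auto
  also have "\<dots> = 2 powr q * M powr q" by (rule powr_mult)
  also have "\<dots> \<le> 2 powr q * (norm x powr q + norm y powr q)"
    by (intro mult_left_mono) (auto simp: M_def max_def)
  finally show ?thesis .
qed

text \<open>Weights, symbols and derivatives are controlled on the disc only and arbitrary
  elsewhere, so measurability is asked of the extension by 0.\<close>

definition disc_measurable :: "(complex \<Rightarrow> complex) \<Rightarrow> bool" where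
  "disc_measurable g \<longleftrightarrow> (\<lambda>z. indicator disc z *\<^sub>R g z) \<in> borel_measurable borel"

lemma disc_sets [measurable]: "disc \<in> sets borel"
  by (simp add: disc_def)

lemma disc_measurable_powr:
  assumes "disc_measurable g"
  shows "(\<lambda>z. ennreal (norm (g z) powr q) * indicator disc z) \<in> borel_measurable borel"
proof -
  have [measurable]: "(\<lambda>z. indicator disc z *\<^sub>R g z) \<in> borel_measurable borel"
    using assms by (simp add: disc_measurable_def)
  have "(\<lambda>z. ennreal (norm (indicator disc z *\<^sub>R g z) powr q) * indicator disc z) \<in> borel_measurable borel"
    by measurable
  then show ?thesis
    by (rule back_subst[of "\<lambda>h. h \<in> borel_measurable borel"]) (auto simp: indicator_def fun_eq_iff)
qed

lemma disc_measurable_continuous: "continuous_on disc g \<Longrightarrow> disc_measurable g"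
  unfolding disc_measurable_def by (intro borel_measurable_continuous_on_indicator) (auto simp: disc_def)

lemma disc_measurable_add:
  assumes "disc_measurable g" "disc_measurable h"
  shows "disc_measurable (\<lambda>z. g z + h z)"
proof -
  have "(\<lambda>z. indicator disc z *\<^sub>R g z + indicator disc z *\<^sub>R h z) \<in> borel_measurable borel"
    using assms unfolding disc_measurable_def by measurable
  then show ?thesis by (simp add: disc_measurable_def scaleR_add_right)
qed

lemma disc_measurable_cmult:
  assumes "disc_measurable g"
  shows "disc_measurable (\<lambda>z. c * g z)"
proof -
  have "(\<lambda>z. c * (indicator disc z *\<^sub>R g z)) \<in> borel_measurable borel"
    using assms unfolding disc_measurable_def by measurable
  then show ?thesis by (simp add: disc_measurable_def)
qed

lemma disc_measurable_diff:
  assumes "disc_measurable g" "disc_measurable h"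
  shows "disc_measurable (\<lambda>z. g z - h z)"
  using disc_measurable_add[OF assms(1) disc_measurable_cmult[OF assms(2), of "-1"]] by simp

lemma disc_measurable_Lq:
  assumes s: "sets \<upsilon> = sets borel" and g: "g \<in> Lq_space \<upsilon> q"
  shows "disc_measurable g"
proof -
  have [measurable]: "g \<in> borel_measurable borel"
    using g measurable_cong_sets[OF s refl] by (auto simp: Lq_space_def)
  show ?thesis unfolding disc_measurable_def by measurable
qed

lemma Lq_int_add_le:
  assumes s: "sets \<upsilon> = sets borel" and q: "0 \<le> q" and g: "disc_measurable g" and h: "disc_measurable h"
  shows "Lq_int \<upsilon> q (\<lambda>z. g z + h z) \<le> ennreal (2 powr q) * (Lq_int \<upsilon> q g + Lq_int \<upsilon> q h)"
proof -
  note m = disc_measurable_powr[OF g, of q] disc_measurable_powr[OF h, of q]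
  have m': "(\<lambda>z. ennreal (norm (g z) powr q) * indicator disc z) \<in> borel_measurable \<upsilon>"
    "(\<lambda>z. ennreal (norm (h z) powr q) * indicator disc z) \<in> borel_measurable \<upsilon>"
    using m measurable_cong_sets[OF s refl] by auto
  have "Lq_int \<upsilon> q (\<lambda>z. g z + h z)
    \<le> (\<integral>\<^sup>+z. ennreal (2 powr q) * (ennreal (norm (g z) powr q) * indicator disc z + ennreal (norm (h z) powr q) * indicator disc z) \<partial>\<upsilon>)"
    unfolding Lq_int_def
  proof (rule nn_integral_mono)
    fix z
    have "ennreal (norm (g z + h z) powr q) \<le> ennreal (2 powr q) * (ennreal (norm (g z) powr q) + ennreal (norm (h z) powr q))"
      using norm_add_powr_le[OF q, of "g z" "h z"] by (simp flip: ennreal_mult ennreal_plus)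
    then show "ennreal (norm (g z + h z) powr q) * indicator disc z
      \<le> ennreal (2 powr q) * (ennreal (norm (g z) powr q) * indicator disc z + ennreal (norm (h z) powr q) * indicator disc z)"
      by (auto simp: indicator_def)
  qed
  also have "\<dots> = ennreal (2 powr q) * (Lq_int \<upsilon> q g + Lq_int \<upsilon> q h)"
    unfolding Lq_int_def using m' by (simp add: nn_integral_cmult nn_integral_add)
  finally show ?thesis .
qed

lemma Lq_int_cmult:
  assumes s: "sets \<upsilon> = sets borel" and g: "disc_measurable g"
  shows "Lq_int \<upsilon> q (\<lambda>z. c * g z) = ennreal (norm c powr q) * Lq_int \<upsilon> q g"
proof -
  have m: "(\<lambda>z. ennreal (norm (g z) powr q) * indicator disc z) \<in> borel_measurable \<upsilon>"
    using disc_measurable_powr[OF g, of q] measurable_cong_sets[OF s refl] by auto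
  have "Lq_int \<upsilon> q (\<lambda>z. c * g z) = (\<integral>\<^sup>+z. ennreal (norm c powr q) * (ennreal (norm (g z) powr q) * indicator disc z) \<partial>\<upsilon>)"
    unfolding Lq_int_def by (intro nn_integral_cong) (simp add: norm_mult powr_mult ennreal_mult ac_simps)
  also have "\<dots> = ennreal (norm c powr q) * Lq_int \<upsilon> q g"
    unfolding Lq_int_def by (rule nn_integral_cmult[OF m])
  finally show ?thesis .
qed

text \<open>The 4 is a product: 2 from \<open>norm_add_powr_le\<close>, and 2 from a^q + b^q <= 2 (a
  + b)^q <= 2^q (a + b)^q, where q >= 1 is used. It becomes the constant of the upper
  estimate.\<close>

lemma Lq_norm_add_le:
  assumes s: "sets \<upsilon> = sets borel" and q: "1 \<le> q" and g: "disc_measurable g" and h: "disc_measurable h"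
    and "Lq_norm \<upsilon> q g \<le> ennreal a" "Lq_norm \<upsilon> q h \<le> ennreal b" "0 \<le> a" "0 \<le> b"
  shows "Lq_norm \<upsilon> q (\<lambda>z. g z + h z) \<le> ennreal (4 * (a + b))"
proof -
  have "Lq_int \<upsilon> q g \<le> ennreal (a powr q)" "Lq_int \<upsilon> q h \<le> ennreal (b powr q)"
    using assms by (auto simp: Lq_norm_def root_enn_le_iff)
  then have "Lq_int \<upsilon> q (\<lambda>z. g z + h z) \<le> ennreal (2 powr q) * (ennreal (a powr q) + ennreal (b powr q))"
    using Lq_int_add_le[OF s _ g h, of q] q by (meson add_mono mult_left_mono order_trans zero_le_one zero_le)
  also have "\<dots> = ennreal (2 powr q * (a powr q + b powr q))" by (simp flip: ennreal_plus ennreal_mult)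
  also have "\<dots> \<le> ennreal ((4 * (a + b)) powr q)"
  proof (rule ennreal_leI)
    have "a powr q + b powr q \<le> (a + b) powr q + (a + b) powr q"
      using assms by (intro add_mono powr_mono2) auto
    also have "\<dots> \<le> 2 powr q * (a + b) powr q"
      using powr_mono[of 1 q 2] q mult_right_mono[of 2 "2 powr q" "(a + b) powr q"] by simp
    finally have "2 powr q * (a powr q + b powr q) \<le> 2 powr q * (2 powr q * (a + b) powr q)"
      by (intro mult_left_mono) auto
    also have "\<dots> = (2 * (2 * (a + b))) powr q" by (simp only: powr_mult)
    finally show "2 powr q * (a powr q + b powr q) \<le> (4 * (a + b)) powr q" by simp
  qed
  finally show ?thesis
    unfolding Lq_norm_def using assms by (subst root_enn_le_iff) auto
qed

lemma Lq_norm_tendsto_0D: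
  assumes q: "0 < q" and lim: "((\<lambda>n. Lq_norm \<upsilon> q (g n)) \<longlongrightarrow> 0) sequentially" and e: "0 < e"
  shows "eventually (\<lambda>n. Lq_int \<upsilon> q (g n) \<le> ennreal e) sequentially"
proof -
  have "eventually (\<lambda>n. Lq_norm \<upsilon> q (g n) < ennreal (e powr (1 / q))) sequentially"
    by (rule order_tendstoD(2)[OF lim]) (use e in simp)
  then show ?thesis
  proof eventually_elim
    case (elim n)
    then have "Lq_int \<upsilon> q (g n) \<le> ennreal ((e powr (1 / q)) powr q)"
      using root_enn_le_iff[of q "e powr (1 / q)" "Lq_int \<upsilon> q (g n)"] q less_imp_le[OF elim]
      by (simp add: Lq_norm_def)
    then show ?case using q e by (simp add: powr_powr)
  qed
qed

lemma Lq_norm_tendsto_0I: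
  assumes q: "0 < q" and ev: "\<And>e. 0 < e \<Longrightarrow> eventually (\<lambda>n. Lq_int \<upsilon> q (g n) \<le> ennreal e) sequentially"
  shows "((\<lambda>n. Lq_norm \<upsilon> q (g n)) \<longlongrightarrow> 0) sequentially"
proof (rule order_tendstoI)
  fix a :: ennreal assume "0 < a"
  then obtain e where e: "0 < e" "ennreal e < a"
    by (metis ennreal_less_zero_iff dense ennreal_cases less_top_ennreal neq_top_trans top.not_eq_extremum order_less_imp_le less_le_trans)
  have "eventually (\<lambda>n. Lq_int \<upsilon> q (g n) \<le> ennreal (e powr q)) sequentially"
    by (rule ev) (use e in simp)
  then show "eventually (\<lambda>n. Lq_norm \<upsilon> q (g n) < a) sequentially"
  proof eventually_elim
    case (elim n)
    then have "Lq_norm \<upsilon> q (g n) \<le> ennreal e"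
      using root_enn_le_iff[of q e "Lq_int \<upsilon> q (g n)"] q e by (simp add: Lq_norm_def)
    then show ?case using e by simp
  qed
qed simp

section \<open>Almost additivity of the Bergman integral along null sequences\<close>

lemma Ap_int_weight:
  assumes w: "radial_weight \<omega>"
  defines "V \<equiv> \<lambda>z::complex. ennreal (\<omega> (norm z) / pi) * indicator disc z"
  shows "V \<in> borel_measurable borel" "Ap_int \<omega> p f = (\<integral>\<^sup>+z. ennreal (norm (f z) powr p) * V z \<partial>lborel)"
    and "(\<integral>\<^sup>+z. V z \<partial>lborel) < \<infinity>"
proof -
  note [measurable] = omega_measurable[OF w]
  have om0: "0 \<le> \<omega> (norm z)" if "norm z < 1" for z :: complex using w that by (auto simp: radial_weight_def)
  have Veq: "V = (\<lambda>z. ennreal (1/pi) * (ennreal (\<omega> (norm z)) * indicator {0..1} (norm z)) * indicator disc z)"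
    unfolding V_def by (auto simp: fun_eq_iff indicator_def disc_def om0 simp flip: ennreal_mult)
  show "V \<in> borel_measurable borel" unfolding Veq by measurable
  show "Ap_int \<omega> p f = (\<integral>\<^sup>+z. ennreal (norm (f z) powr p) * V z \<partial>lborel)"
    unfolding Ap_int_def V_def
    by (intro nn_integral_cong) (auto simp: indicator_def disc_def om0 simp flip: ennreal_mult)
  have "(\<integral>\<^sup>+z. V z \<partial>lborel) = (\<integral>\<^sup>+r\<in>{0..<1}. ennreal (2 * pi * r) * (ennreal (1/pi) * (ennreal (\<omega> r) * indicator {0..1} r)) \<partial>lborel)"
    unfolding Veq by (rule nn_integral_disc_radial) measurable
  also have "\<dots> \<le> (\<integral>\<^sup>+r. ennreal 2 * (ennreal (\<omega> r) * indicator {0..1} r) \<partial>lborel)"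
  proof (rule nn_integral_mono)
    fix r :: real
    show "ennreal (2 * pi * r) * (ennreal (1/pi) * (ennreal (\<omega> r) * indicator {0..1} r)) * indicator {0..<1} r \<le> ennreal 2 * (ennreal (\<omega> r) * indicator {0..1} r)"
    proof (cases "0 \<le> r \<and> r < 1")
      case True
      have "0 \<le> \<omega> r" using True w by (auto simp: radial_weight_def)
      note h = this
      have "ennreal (2 * pi * r) * (ennreal (1/pi) * (ennreal (\<omega> r) * indicator {0..1} r)) * indicator {0..<1} r
         = ennreal (2 * pi * r * (1 / pi * \<omega> r))"
        using True h by (simp flip: ennreal_mult)
      also have "\<dots> \<le> ennreal (2 * \<omega> r)"
        using True h by (intro ennreal_leI) (simp add: mult_left_le_one_le)
      also have "\<dots> = ennreal 2 * (ennreal (\<omega> r) * indicator {0..1} r)"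
        using True h by (simp add: ennreal_mult)
      finally show ?thesis .
    qed auto
  qed
  also have "\<dots> = ennreal 2 * (\<integral>\<^sup>+r\<in>{0..1}. ennreal (\<omega> r) \<partial>lborel)"
    by (rule nn_integral_cmult) measurable
  also have "\<dots> = ennreal 2 * ennreal (omega_hat \<omega> 0)" using nn_integral_omega(1)[OF w, of 0] by simp
  also have "\<dots> < \<infinity>" by (simp add: ennreal_mult_less_top)
  finally show "(\<integral>\<^sup>+z. V z \<partial>lborel) < \<infinity>" .
qed

lemma Ap_int_cmult:
  assumes f: "f holomorphic_on disc" and w: "radial_weight \<omega>"
  shows "Ap_int \<omega> p (\<lambda>z. c * f z) = ennreal (norm c powr p) * Ap_int \<omega> p f"
proof -
  note V = Ap_int_weight[OF w]
  note [measurable] = V(1) borel_measurable_powr_indicator[OF holomorphic_on_imp_continuous_on[OF f]]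
  have "(\<lambda>z. (ennreal (norm (f z) powr p) * indicator disc z) * (ennreal (\<omega> (norm z) / pi) * indicator disc z)) \<in> borel_measurable borel"
    by measurable
  then have m: "(\<lambda>z. ennreal (norm (f z) powr p) * (ennreal (\<omega> (norm z) / pi) * indicator disc z)) \<in> borel_measurable borel"
    by (rule back_subst[of "\<lambda>h. h \<in> borel_measurable borel"]) (auto simp: indicator_def fun_eq_iff)
  have "Ap_int \<omega> p (\<lambda>z. c * f z) = (\<integral>\<^sup>+z. ennreal (norm c powr p) * (ennreal (norm (f z) powr p) * (ennreal (\<omega> (norm z) / pi) * indicator disc z)) \<partial>lborel)"
    unfolding V(2) by (intro nn_integral_cong) (simp add: norm_mult powr_mult ennreal_mult ac_simps)
  also have "\<dots> = ennreal (norm c powr p) * Ap_int \<omega> p f"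
    unfolding V(2) using m by (intro nn_integral_cmult) simp
  finally show ?thesis .
qed

text \<open>Either y <= l x or x < y/l. The point is a coefficient near 1 on the dominant term: a
  fixed factor such as 2^p would compound in the gliding hump.\<close>

lemma add_powr_le_eps:
  fixes x y l p :: real
  assumes "0 < l" "0 \<le> p" "0 \<le> x" "0 \<le> y"
  shows "(x + y) powr p \<le> (1 + l) powr p * x powr p + (1 + 1/l) powr p * y powr p"
proof (cases "y \<le> l * x")
  case True
  then have "(x + y) powr p \<le> ((1 + l) * x) powr p" using assms by (intro powr_mono2) (auto simp: algebra_simps)
  also have "\<dots> = (1 + l) powr p * x powr p" by (rule powr_mult)
  finally show ?thesis by (simp add: add_increasing2)
next
  case False
  then have "x \<le> y / l" using assms by (simp add: field_simps)
  then have "(x + y) powr p \<le> ((1 + 1/l) * y) powr p" using assms by (intro powr_mono2) (auto simp: algebra_simps)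
  also have "\<dots> = (1 + 1/l) powr p * y powr p" by (rule powr_mult)
  finally show ?thesis by (simp add: add_increasing)
qed

text \<open>\<open>S\<close> has little mass near the circle and \<open>G n\<close> is uniformly
  small away from it, so the two are almost disjoint and their p-th power integrals nearly add. The
  increment 2 does not depend on \<open>S\<close>, which keeps the growth over repeated additions
  linear.\<close>

lemma Ap_int_add_null_le:
  assumes w: "radial_weight \<omega>" and p: "0 < p" and S: "S \<in> Ap_space \<omega> p"
    and G: "\<And>n. G n \<in> Ap_space \<omega> p" "\<And>n. Ap_int \<omega> p (G n) \<le> 1"
    and null: "\<And>R. R < 1 \<Longrightarrow> uniform_limit (cball 0 R) G (\<lambda>_. 0) sequentially"
  shows "eventually (\<lambda>n. Ap_int \<omega> p (\<lambda>z. S z + G n z) \<le> Ap_int \<omega> p S + 2) sequentially"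
proof -
  define V where "V = (\<lambda>z::complex. ennreal (\<omega> (norm z) / pi) * indicator disc z)"
  have V: "V \<in> borel_measurable borel" "\<And>f. Ap_int \<omega> p f = (\<integral>\<^sup>+z. ennreal (norm (f z) powr p) * V z \<partial>lborel)"
    "(\<integral>\<^sup>+z. V z \<partial>lborel) < \<infinity>"
    unfolding V_def by (rule Ap_int_weight[OF w])+
  note [measurable] = V(1)
  have holS: "S holomorphic_on disc" and holG: "G n holomorphic_on disc" for n
    using S G by (auto simp: Ap_space_def)
  have pm: "(\<lambda>z. ennreal (norm (f z) powr p) * V z) \<in> borel_measurable borel" if "f holomorphic_on disc" for f
  proof -
    note [measurable] = borel_measurable_powr_indicator[OF holomorphic_on_imp_continuous_on[OF that]]
    have "(\<lambda>z. (ennreal (norm (f z) powr p) * indicator disc z) * V z) \<in> borel_measurable borel" by measurable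
    then show ?thesis
      by (rule back_subst[of "\<lambda>h. h \<in> borel_measurable borel"]) (auto simp: indicator_def fun_eq_iff V_def)
  qed
  note [measurable] = pm[OF holS] pm[OF holG]
  define s where "s = enn2real (Ap_int \<omega> p S)"
  have s: "Ap_int \<omega> p S = ennreal s" "0 \<le> s" using S by (auto simp: s_def Ap_space_def)
  define v where "v = enn2real (\<integral>\<^sup>+z. V z \<partial>lborel)"
  have v: "(\<integral>\<^sup>+z. V z \<partial>lborel) = ennreal v" "0 \<le> v" using V(3) by (auto simp: v_def)
  \<comment> \<open>Of the allowance s + 2 the main terms use less than s + 3/2; a quarter each is
    left for the tail of \<open>S\<close> near the circle and for \<open>G n\<close> on the compact
    disc.\<close>
  obtain l where l: "0 < l" "(1 + l) powr p * (s + 1) < s + 3/2"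
  proof -
    have "((\<lambda>l. (1 + l) powr p * (s + 1)) \<longlongrightarrow> (1 + 0) powr p * (s + 1)) (at_right 0)"
      by (intro tendsto_intros) auto
    then have "eventually (\<lambda>l. (1 + l) powr p * (s + 1) < s + 3/2) (at_right (0::real))"
      by (rule order_tendstoD) simp
    moreover have "eventually (\<lambda>l. 0 < l) (at_right (0::real))" by (rule eventually_at_right_less)
    ultimately have "eventually (\<lambda>l. 0 < l \<and> (1 + l) powr p * (s + 1) < s + 3/2) (at_right (0::real))"
      by eventually_elim simp
    then show ?thesis using that eventually_happens'[OF trivial_limit_at_right_real] by blast
  qed
  define c where "c = (1 + 1/l) powr p"
  have "0 < 1 + 1/l" using l by (simp add: add_pos_pos)
  then have c: "0 < c" by (simp add: c_def)
  define tail where "tail = (\<lambda>n::nat. \<integral>\<^sup>+z. ennreal (norm (S z) powr p) * V z * indicator {z. 1 - 1 / real (Suc n) < norm z} z \<partial>lborel)"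
  have "tail \<longlonglongrightarrow> (\<integral>\<^sup>+z. 0 \<partial>(lborel :: complex measure))"
    unfolding tail_def
  proof (rule nn_integral_dominated_convergence[where w="\<lambda>z. ennreal (norm (S z) powr p) * V z"])
    have [measurable]: "{z::complex. 1 - 1 / real (Suc n) < norm z} \<in> sets borel" for n by measurable
    show "(\<lambda>z. ennreal (norm (S z) powr p) * V z * indicator {z. 1 - 1 / real (Suc n) < norm z} z) \<in> borel_measurable lborel" for n
      by measurable
    show "(\<integral>\<^sup>+z. ennreal (norm (S z) powr p) * V z \<partial>lborel) < \<infinity>" using s V(2)[of S] by simp
    show "AE z in lborel. (\<lambda>n. ennreal (norm (S z) powr p) * V z * indicator {z. 1 - 1 / real (Suc n) < norm z} z) \<longlonglongrightarrow> 0"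
    proof (intro AE_I2)
      fix z :: complex
      show "(\<lambda>n. ennreal (norm (S z) powr p) * V z * indicator {z. 1 - 1 / real (Suc n) < norm z} z) \<longlonglongrightarrow> 0"
      proof (cases "z \<in> disc")
        case True
        then have "0 < 1 - norm z" by (simp add: disc_def)
        then have "eventually (\<lambda>n. 1 / real (Suc n) < 1 - norm z) sequentially"
          by (intro order_tendstoD(2)[OF LIMSEQ_Suc[OF lim_inverse_n']])
        then have "eventually (\<lambda>n. ennreal (norm (S z) powr p) * V z * indicator {z. 1 - 1 / real (Suc n) < norm z} z = 0) sequentially"
          by eventually_elim auto
        then show ?thesis by (rule tendsto_eventually)
      qed (simp add: V_def)
    qed
  qed (auto simp: indicator_def)
  then have "tail \<longlonglongrightarrow> 0" by simp
  then have "eventually (\<lambda>n. tail n < ennreal (1 / (4 * c))) sequentially"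
    by (rule order_tendstoD) (use c in simp)
  then obtain n0 where n0: "tail n0 < ennreal (1 / (4 * c))"
    using eventually_happens'[OF sequentially_bot] by blast
  define R where "R = 1 - 1 / real (Suc n0)"
  have R: "R < 1" by (simp add: R_def)
  define T where "T = {z::complex. R < norm z}"
  have [measurable]: "T \<in> sets borel" unfolding T_def by measurable
  have tailT: "(\<integral>\<^sup>+z. ennreal (norm (S z) powr p) * V z * indicator T z \<partial>lborel) \<le> ennreal (1 / (4 * c))"
    using n0 by (simp add: tail_def T_def R_def)
  define t where "t = (1 / (4 * c * (v + 1))) powr (1 / p)"
  have t: "0 < t" "c * t powr p * v \<le> 1/4"
  proof -
    have "t powr p = 1 / (4 * c * (v + 1))" using p c v by (simp add: t_def powr_powr)
    then have "c * t powr p * v = v / (v + 1) / 4" using c v by simp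
    moreover have "v / (v + 1) \<le> 1" using v by simp
    ultimately show "c * t powr p * v \<le> 1/4" by (metis divide_right_mono zero_le_numeral)
    show "0 < t" using c v by (simp add: t_def)
  qed
  have "eventually (\<lambda>n. \<forall>z\<in>cball 0 R. dist (G n z) 0 < t) sequentially"
    using uniform_limitD[OF null[OF R] t(1)] .
  then show ?thesis
  proof eventually_elim
    case (elim n)
    define L where "L = (1 + l) powr p"
    have L: "1 \<le> L" "0 \<le> L" unfolding L_def using l p ge_one_powr_ge_zero[of "1 + l" p] by auto
    \<comment> \<open>On \<open>T\<close> the summand \<open>G n\<close> is dominant and
      \<open>S\<close> is the error with coefficient c, off \<open>T\<close> conversely; adding all
      four terms gives one bound for both regions.\<close>
    have pt: "norm (S z + G n z) powr p \<le> L * norm (S z) powr p + L * norm (G n z) powr p + c * t powr p + c * (norm (S z) powr p * indicator T z)" for z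
    proof -
      have tri: "norm (S z + G n z) powr p \<le> (norm (S z) + norm (G n z)) powr p"
        using p by (intro powr_mono2 norm_triangle_ineq) auto
      show ?thesis
      proof (cases "z \<in> T")
        case True
        have "(norm (S z) + norm (G n z)) powr p \<le> L * norm (G n z) powr p + c * norm (S z) powr p"
          unfolding L_def c_def add.commute[of "norm (S z)"] by (rule add_powr_le_eps) (use l p in auto)
        moreover have "0 \<le> L * norm (S z) powr p" "0 \<le> c * t powr p" using L c by auto
        moreover have "norm (S z) powr p * indicator T z = norm (S z) powr p" using True by simp
        ultimately show ?thesis using tri by (simp only:)
      next
        case False
        then have "norm (G n z) \<le> t" using elim by (auto simp: T_def dist_norm intro: less_imp_le)
        then have "c * norm (G n z) powr p \<le> c * t powr p" using c p by (intro mult_left_mono powr_mono2) auto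
        moreover have "(norm (S z) + norm (G n z)) powr p \<le> L * norm (S z) powr p + c * norm (G n z) powr p"
          unfolding L_def c_def by (rule add_powr_le_eps) (use l p in auto)
        moreover have "0 \<le> L * norm (G n z) powr p" using L by auto
        ultimately show ?thesis using tri False by simp
      qed
    qed
    have "Ap_int \<omega> p (\<lambda>z. S z + G n z)
      \<le> (\<integral>\<^sup>+z. ennreal L * (ennreal (norm (S z) powr p) * V z) + ennreal L * (ennreal (norm (G n z) powr p) * V z)
            + ennreal (c * t powr p) * V z + ennreal c * (ennreal (norm (S z) powr p) * V z * indicator T z) \<partial>lborel)"
      unfolding V(2)
    proof (rule nn_integral_mono)
      fix z
      have "ennreal (norm (S z + G n z) powr p) \<le> ennreal (L * norm (S z) powr p + L * norm (G n z) powr p + c * t powr p + c * (norm (S z) powr p * indicator T z))"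
        by (rule ennreal_leI[OF pt])
      also have "\<dots> = ennreal L * ennreal (norm (S z) powr p) + ennreal L * ennreal (norm (G n z) powr p) + ennreal (c * t powr p) + ennreal c * (ennreal (norm (S z) powr p) * indicator T z)"
        using L c by (simp add: ennreal_mult ennreal_plus ennreal_indicator)
      finally have "ennreal (norm (S z + G n z) powr p) * V z \<le> (ennreal L * ennreal (norm (S z) powr p) + ennreal L * ennreal (norm (G n z) powr p) + ennreal (c * t powr p) + ennreal c * (ennreal (norm (S z) powr p) * indicator T z)) * V z"
        by (rule mult_right_mono) simp
      then show "ennreal (norm (S z + G n z) powr p) * V z \<le> ennreal L * (ennreal (norm (S z) powr p) * V z) + ennreal L * (ennreal (norm (G n z) powr p) * V z)
            + ennreal (c * t powr p) * V z + ennreal c * (ennreal (norm (S z) powr p) * V z * indicator T z)"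
        by (simp only: distrib_right mult.assoc mult.commute[of "V z" "indicator T z"])
    qed
    also have "\<dots> = ennreal L * Ap_int \<omega> p S + ennreal L * Ap_int \<omega> p (G n) + ennreal (c * t powr p) * ennreal v
        + ennreal c * (\<integral>\<^sup>+z. ennreal (norm (S z) powr p) * V z * indicator T z \<partial>lborel)"
      unfolding V(2) v(1)[symmetric]
      by (subst nn_integral_add, measurable)+ (simp add: nn_integral_cmult)
    also have "\<dots> \<le> ennreal L * ennreal s + ennreal L * ennreal 1 + ennreal (c * t powr p) * ennreal v + ennreal c * ennreal (1 / (4 * c))"
      using G(2)[of n] tailT s by (intro add_mono mult_left_mono) auto
    also have "\<dots> = ennreal (L * s + L + c * t powr p * v + 1/4)"
      using L c s v by (simp flip: ennreal_mult ennreal_plus)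
    also have "\<dots> \<le> ennreal (s + 2)"
      using l(2) t(2) by (intro ennreal_leI) (simp add: L_def algebra_simps)
    also have "\<dots> = Ap_int \<omega> p S + 2" using s by simp
    finally show ?case .
  qed
qed

section \<open>Compact operators\<close>

lemma compact_opD:
  assumes "compact_op \<omega> p \<upsilon> q K"
  shows "\<And>f. f \<in> Ap_space \<omega> p \<Longrightarrow> K f \<in> Lq_space \<upsilon> q"
    and "\<And>f g. f \<in> Ap_space \<omega> p \<Longrightarrow> g \<in> Ap_space \<omega> p \<Longrightarrow> K (\<lambda>z. f z + g z) = (\<lambda>z. K f z + K g z)"
    and "\<And>f c. f \<in> Ap_space \<omega> p \<Longrightarrow> K (\<lambda>z. c * f z) = (\<lambda>z. c * K f z)"
proof -
  have lin: "K (\<lambda>z. a * f z + b * g z) = (\<lambda>z. a * K f z + b * K g z)"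
    if "f \<in> Ap_space \<omega> p" "g \<in> Ap_space \<omega> p" for f g a b
    using assms that unfolding compact_op_def by blast
  show "\<And>f. f \<in> Ap_space \<omega> p \<Longrightarrow> K f \<in> Lq_space \<upsilon> q"
    using assms unfolding compact_op_def by blast
  show "\<And>f g. f \<in> Ap_space \<omega> p \<Longrightarrow> g \<in> Ap_space \<omega> p \<Longrightarrow> K (\<lambda>z. f z + g z) = (\<lambda>z. K f z + K g z)"
    using lin[of _ _ 1 1] by simp
  show "\<And>f c. f \<in> Ap_space \<omega> p \<Longrightarrow> K (\<lambda>z. c * f z) = (\<lambda>z. c * K f z)"
    using lin[of f f c 0 for f c] by simp
qed

lemma compact_op_subseq:
  assumes "compact_op \<omega> p \<upsilon> q K" "0 < p" "0 < q"
    and "\<And>n. F n \<in> Ap_space \<omega> p" "\<And>n. Ap_int \<omega> p (F n) \<le> 1"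
  obtains r h where "strict_mono (r::nat \<Rightarrow> nat)" "h \<in> Lq_space \<upsilon> q"
    "((\<lambda>n. Lq_norm \<upsilon> q (\<lambda>z. K (F (r n)) z - h z)) \<longlongrightarrow> 0) sequentially"
proof -
  have "\<forall>n. F n \<in> Ap_space \<omega> p \<and> Ap_norm \<omega> p (F n) \<le> 1"
    using assms Ap_norm_le_1_iff[OF assms(2)] by simp
  then show ?thesis using assms(1) that unfolding compact_op_def by blast
qed

lemma Ap_space_cmult:
  assumes "radial_weight \<omega>" "f \<in> Ap_space \<omega> p"
  shows "(\<lambda>z. c * f z) \<in> Ap_space \<omega> p"
  using assms Ap_int_cmult[of f \<omega> p c]
  by (auto simp: Ap_space_def ennreal_mult_less_top intro!: holomorphic_intros)

lemma Lq_int_le_diff: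
  assumes s: "sets \<upsilon> = sets borel" and q: "0 \<le> q" and g: "disc_measurable g" and h: "disc_measurable h"
  shows "Lq_int \<upsilon> q g \<le> ennreal (2 powr q) * (Lq_int \<upsilon> q (\<lambda>z. g z - h z) + Lq_int \<upsilon> q h)"
  using Lq_int_add_le[OF s q disc_measurable_diff[OF g h] h] by simp

text \<open>Compactness is formulated through subsequences alone, so boundedness is extracted:
  images with integral above n cannot have a subsequence converging in L^q.\<close>

lemma compact_op_bounded:
  assumes s: "sets \<upsilon> = sets borel" and K: "compact_op \<omega> p \<upsilon> q K" and p: "0 < p" "0 < q"
  shows "\<exists>B\<ge>0. \<forall>f\<in>Ap_space \<omega> p. Ap_int \<omega> p f \<le> 1 \<longrightarrow> Lq_int \<upsilon> q (K f) \<le> ennreal B"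
proof (rule ccontr)
  assume neg: "\<not> ?thesis"
  have "\<exists>f. f \<in> Ap_space \<omega> p \<and> Ap_int \<omega> p f \<le> 1 \<and> ennreal (real n) < Lq_int \<upsilon> q (K f)" for n
  proof (rule ccontr)
    assume "\<not> ?thesis"
    then have "\<forall>f\<in>Ap_space \<omega> p. Ap_int \<omega> p f \<le> 1 \<longrightarrow> Lq_int \<upsilon> q (K f) \<le> ennreal (real n)"
      by (simp add: not_less)
    with neg show False by (meson of_nat_0_le_iff)
  qed
  then have "\<exists>F. \<forall>n. F n \<in> Ap_space \<omega> p \<and> Ap_int \<omega> p (F n) \<le> 1 \<and> ennreal (real n) < Lq_int \<upsilon> q (K (F n))"
    by (intro choice allI)
  then obtain F where F: "\<And>n. F n \<in> Ap_space \<omega> p" "\<And>n. Ap_int \<omega> p (F n) \<le> 1" "\<And>n::nat. ennreal (real n) < Lq_int \<upsilon> q (K (F n))"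
    by blast
  obtain r h where r: "strict_mono (r::nat \<Rightarrow> nat)" and h: "h \<in> Lq_space \<upsilon> q"
    and lim: "((\<lambda>n. Lq_norm \<upsilon> q (\<lambda>z. K (F (r n)) z - h z)) \<longlongrightarrow> 0) sequentially"
    by (rule compact_op_subseq[OF K p F(1,2)])
  have hm: "disc_measurable h" by (rule disc_measurable_Lq[OF s h])
  define e where "e = enn2real (Lq_int \<upsilon> q h)"
  have e: "Lq_int \<upsilon> q h = ennreal e" "0 \<le> e" using h by (auto simp: e_def Lq_space_def)
  have "eventually (\<lambda>n. Lq_int \<upsilon> q (\<lambda>z. K (F (r n)) z - h z) \<le> ennreal 1) sequentially"
    by (rule Lq_norm_tendsto_0D[OF p(2) lim]) simp
  then obtain n0 where n0: "\<And>n. n \<ge> n0 \<Longrightarrow> Lq_int \<upsilon> q (\<lambda>z. K (F (r n)) z - h z) \<le> ennreal 1"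
    by (auto simp: eventually_sequentially)
  obtain m :: nat where m: "2 powr q * (1 + e) < real m" using reals_Archimedean2 by blast
  define n where "n = max n0 m"
  have "ennreal (real (r n)) < Lq_int \<upsilon> q (K (F (r n)))" by (rule F(3))
  also have "\<dots> \<le> ennreal (2 powr q) * (Lq_int \<upsilon> q (\<lambda>z. K (F (r n)) z - h z) + Lq_int \<upsilon> q h)"
    by (rule Lq_int_le_diff[OF s _ disc_measurable_Lq[OF s compact_opD(1)[OF K F(1)]] hm]) (use p in simp)
  also have "\<dots> \<le> ennreal (2 powr q) * (ennreal 1 + ennreal e)"
    unfolding e(1) by (intro mult_left_mono add_mono n0) (auto simp: n_def)
  also have "\<dots> = ennreal (2 powr q * (1 + e))" using e by (simp add: ennreal_mult)
  finally have "real (r n) < 2 powr q * (1 + e)" using e by (simp add: ennreal_less_iff)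
  moreover have "real m \<le> real (r n)" using seq_suble[OF r, of n] by (simp add: n_def)
  ultimately show False using m by simp
qed

text \<open>Gliding hump: suppose the images of a locally uniformly null sequence converge to \<open>h\<close>. Sums of \<open>N\<close>
  sparse terms have \<open>p\<close>-th power norm at most \<open>2 N\<close>, while their images are close to \<open>N h\<close>; as
  \<open>p > 1\<close>, boundedness of the operator forces \<open>h = 0\<close>.\<close>

lemma compact_op_null:
  assumes s: "sets \<upsilon> = sets borel" and w: "radial_weight \<omega>" and K: "compact_op \<omega> p \<upsilon> q K" and p: "1 < p" and q: "0 < q"
    and F: "\<And>n. F n \<in> Ap_space \<omega> p" "\<And>n. Ap_int \<omega> p (F n) \<le> 1"
    and null: "\<And>R. R < 1 \<Longrightarrow> uniform_limit (cball 0 R) F (\<lambda>_. 0) sequentially"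
    and \<epsilon>: "0 < \<epsilon>"
  shows "\<exists>n. Lq_int \<upsilon> q (K (F n)) \<le> ennreal \<epsilon>"
proof (rule ccontr)
  assume "\<not> ?thesis"
  then have big: "ennreal \<epsilon> < Lq_int \<upsilon> q (K (F n))" for n by (simp add: not_le)
  have p0: "0 < p" using p by simp
  obtain r h where r: "strict_mono (r::nat \<Rightarrow> nat)" and h: "h \<in> Lq_space \<upsilon> q"
    and lim: "((\<lambda>n. Lq_norm \<upsilon> q (\<lambda>z. K (F (r n)) z - h z)) \<longlongrightarrow> 0) sequentially"
    by (rule compact_op_subseq[OF K p0 q F])
  define G where "G = (\<lambda>n. F (r n))"
  have G: "\<And>n. G n \<in> Ap_space \<omega> p" "\<And>n. Ap_int \<omega> p (G n) \<le> 1" using F by (auto simp: G_def)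
  have Gnull: "uniform_limit (cball 0 R) G (\<lambda>_. 0) sequentially" if "R < 1" for R
    unfolding G_def by (rule filterlim_compose[OF null[OF that] filterlim_subseq[OF r]])
  have ev: "eventually (\<lambda>n. Lq_int \<upsilon> q (\<lambda>z. K (G n) z - h z) \<le> ennreal e) sequentially" if "0 < e" for e
    unfolding G_def by (rule Lq_norm_tendsto_0D[OF q lim that])
  have hm: "disc_measurable h" by (rule disc_measurable_Lq[OF s h])
  have Km: "disc_measurable (K f)" if "f \<in> Ap_space \<omega> p" for f
    by (rule disc_measurable_Lq[OF s compact_opD(1)[OF K that]])
  define \<eta> where "\<eta> = enn2real (Lq_int \<upsilon> q h)"
  have \<eta>: "Lq_int \<upsilon> q h = ennreal \<eta>" "0 \<le> \<eta>" using h by (auto simp: \<eta>_def Lq_space_def)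
  define c where "c = 2 powr q"
  have c: "0 < c" by (simp add: c_def)
  \<comment> \<open>The images keep integral above \<epsilon> while a subsequence approaches h, so h
    is not null.\<close>
  have "0 < \<eta>"
  proof -
    define e where "e = \<epsilon> / (2 * c)"
    have e: "0 < e" using \<epsilon> c by (simp add: e_def)
    obtain n where n: "Lq_int \<upsilon> q (\<lambda>z. K (G n) z - h z) \<le> ennreal e"
      using eventually_happens'[OF sequentially_bot ev[OF e]] by blast
    have "ennreal \<epsilon> < Lq_int \<upsilon> q (K (G n))" unfolding G_def by (rule big)
    also have "\<dots> \<le> ennreal c * (Lq_int \<upsilon> q (\<lambda>z. K (G n) z - h z) + Lq_int \<upsilon> q h)"
      unfolding c_def by (rule Lq_int_le_diff[OF s _ Km[OF G(1)] hm]) (use q in simp)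
    also have "\<dots> \<le> ennreal c * (ennreal e + ennreal \<eta>)"
      unfolding \<eta>(1) by (intro mult_left_mono add_mono n) auto
    also have "\<dots> = ennreal (c * (e + \<eta>))" using \<eta> e c by (simp flip: ennreal_plus ennreal_mult)
    finally have "\<epsilon> < c * (e + \<eta>)" using \<epsilon> by (simp add: ennreal_less_iff)
    also have "c * (e + \<eta>) = \<epsilon> / 2 + c * \<eta>" using c by (simp add: e_def distrib_left)
    finally have "0 < c * \<eta>" using \<epsilon> by simp
    then show ?thesis using c by (simp add: zero_less_mult_iff)
  qed
  \<comment> \<open>The tolerance e is generalised in the induction: each addition costs a factor c
    = 2^q in the quasi-triangle inequality, which is paid by asking e / (2c) of both the previous
    sum and the new term.\<close>
  have hump: "\<exists>S\<in>Ap_space \<omega> p. Ap_int \<omega> p S \<le> ennreal (2 * real N) \<and> Lq_int \<upsilon> q (\<lambda>z. K S z - of_nat N * h z) \<le> ennreal e"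
    if "0 < e" for N e
    using that
  proof (induction N arbitrary: e)
    case 0
    have z: "(\<lambda>_. 0) \<in> Ap_space \<omega> p" by (simp add: Ap_space_def Ap_int_def)
    have "K (\<lambda>_. 0) = (\<lambda>_. 0)" using compact_opD(3)[OF K z, of 0] by simp
    then show ?case by (intro bexI[OF _ z]) (simp add: Ap_int_def Lq_int_def)
  next
    case (Suc N)
    define e' where "e' = e / (2 * c)"
    have e': "0 < e'" using Suc c by (simp add: e'_def)
    from Suc.IH[OF e'] obtain S where S: "S \<in> Ap_space \<omega> p" "Ap_int \<omega> p S \<le> ennreal (2 * real N)"
      "Lq_int \<upsilon> q (\<lambda>z. K S z - of_nat N * h z) \<le> ennreal e'" by blast
    have "eventually (\<lambda>n. Ap_int \<omega> p (\<lambda>z. S z + G n z) \<le> Ap_int \<omega> p S + 2 \<and> Lq_int \<upsilon> q (\<lambda>z. K (G n) z - h z) \<le> ennreal e') sequentially"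
      by (intro eventually_conj Ap_int_add_null_le[OF w p0 S(1) G] Gnull ev e')
    then obtain n where n: "Ap_int \<omega> p (\<lambda>z. S z + G n z) \<le> Ap_int \<omega> p S + 2" "Lq_int \<upsilon> q (\<lambda>z. K (G n) z - h z) \<le> ennreal e'"
      using eventually_happens'[OF sequentially_bot] by blast
    have "Ap_int \<omega> p (\<lambda>z. S z + G n z) \<le> ennreal (2 * real N) + ennreal 2"
      by (rule order_trans[OF n(1)]) (use add_mono[OF S(2) order_refl[of 2]] in simp)
    also have "\<dots> = ennreal (2 * real N + 2)" by (rule ennreal_plus[symmetric]) auto
    also have "\<dots> = ennreal (2 * real (Suc N))" by (simp add: distrib_left)
    finally have A: "Ap_int \<omega> p (\<lambda>z. S z + G n z) \<le> ennreal (2 * real (Suc N))" .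
    have mem: "(\<lambda>z. S z + G n z) \<in> Ap_space \<omega> p"
      using S(1) G(1)[of n] le_less_trans[OF A ennreal_less_top] by (auto simp: Ap_space_def intro!: holomorphic_intros)
    have "(\<lambda>z. K (\<lambda>z. S z + G n z) z - of_nat (Suc N) * h z) = (\<lambda>z. (K S z - of_nat N * h z) + (K (G n) z - h z))"
      unfolding compact_opD(2)[OF K S(1) G(1)] by (simp add: fun_eq_iff algebra_simps)
    then have "Lq_int \<upsilon> q (\<lambda>z. K (\<lambda>z. S z + G n z) z - of_nat (Suc N) * h z)
       \<le> ennreal c * (Lq_int \<upsilon> q (\<lambda>z. K S z - of_nat N * h z) + Lq_int \<upsilon> q (\<lambda>z. K (G n) z - h z))"
      unfolding c_def
      using Lq_int_add_le[OF s _ disc_measurable_diff[OF Km[OF S(1)] disc_measurable_cmult[OF hm]] disc_measurable_diff[OF Km[OF G(1)] hm], of q "of_nat N" n] q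
      by simp
    also have "\<dots> \<le> ennreal c * (ennreal e' + ennreal e')" by (intro mult_left_mono add_mono S n) auto
    also have "\<dots> = ennreal e" using c e' by (simp flip: ennreal_plus ennreal_mult) (simp add: e'_def)
    finally show ?case using A mem by blast
  qed
  obtain B where B: "0 \<le> B" "\<And>f. f \<in> Ap_space \<omega> p \<Longrightarrow> Ap_int \<omega> p f \<le> 1 \<Longrightarrow> Lq_int \<upsilon> q (K f) \<le> ennreal B"
    using compact_op_bounded[OF s K p0 q] by blast
  \<comment> \<open>Rescaling \<open>S\<close> by t = (2N)^(-1/p) puts it into the unit ball, so the
    integral of \<open>K S\<close> is at most B (2N)^(q/p), while that of N h is N^q \<eta>.\<close>
  have growth: "real N powr q * \<eta> \<le> c * (1 + B * (2 * real N) powr (q / p))" if N: "0 < N" for N :: nat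
  proof -
    obtain S where S: "S \<in> Ap_space \<omega> p" "Ap_int \<omega> p S \<le> ennreal (2 * real N)"
      "Lq_int \<upsilon> q (\<lambda>z. K S z - of_nat N * h z) \<le> ennreal 1" using hump[of 1 N] by auto
    define t where "t = (2 * real N) powr (- 1 / p)"
    have t: "0 < t" using N by (simp add: t_def)
    have tp: "t powr p * (2 * real N) = 1"
    proof -
      have "- 1 / p * p = - 1" using p by simp
      then show ?thesis unfolding t_def powr_powr using N by (simp add: powr_minus)
    qed
    have tq: "t powr q * (2 * real N) powr (q / p) = 1"
      unfolding t_def powr_powr powr_add[symmetric] using N by simp
    have "Ap_int \<omega> p (\<lambda>z. of_real t * S z) = ennreal (t powr p) * Ap_int \<omega> p S"
      using Ap_int_cmult[of S \<omega> p "of_real t"] S(1) w t by (simp add: Ap_space_def)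
    also have "\<dots> \<le> ennreal (t powr p) * ennreal (2 * real N)" by (intro mult_left_mono S) simp
    also have "\<dots> = 1" using tp by (simp flip: ennreal_mult)
    finally have "Lq_int \<upsilon> q (K (\<lambda>z. of_real t * S z)) \<le> ennreal B"
      by (intro B(2) Ap_space_cmult[OF w S(1)])
    then have "ennreal (t powr q) * Lq_int \<upsilon> q (K S) \<le> ennreal B"
      unfolding compact_opD(3)[OF K S(1)] using Lq_int_cmult[OF s Km[OF S(1)], of q "of_real t"] t by simp
    then have "ennreal ((2 * real N) powr (q / p)) * (ennreal (t powr q) * Lq_int \<upsilon> q (K S)) \<le> ennreal ((2 * real N) powr (q / p)) * ennreal B"
      by (rule mult_left_mono) simp
    moreover have "ennreal ((2 * real N) powr (q / p)) * (ennreal (t powr q) * Lq_int \<upsilon> q (K S)) = Lq_int \<upsilon> q (K S)"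
    proof -
      have "ennreal ((2 * real N) powr (q / p)) * ennreal (t powr q) = 1"
        using tq by (subst ennreal_mult[symmetric]) (auto simp: mult.commute)
      then show ?thesis by (metis mult.assoc mult_1)
    qed
    ultimately have KS: "Lq_int \<upsilon> q (K S) \<le> ennreal (B * (2 * real N) powr (q / p))"
      using B by (simp only: ennreal_mult powr_ge_zero mult.commute)
    have "ennreal (real N powr q * \<eta>) = Lq_int \<upsilon> q (\<lambda>z. of_nat N * h z)"
      using Lq_int_cmult[OF s hm, of q "of_nat N"] \<eta> by (simp add: ennreal_mult)
    also have "\<dots> = Lq_int \<upsilon> q (\<lambda>z. (-1) * (K S z - of_nat N * h z) + K S z)" by simp
    also have "\<dots> \<le> ennreal c * (Lq_int \<upsilon> q (\<lambda>z. (-1) * (K S z - of_nat N * h z)) + Lq_int \<upsilon> q (K S))"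
      unfolding c_def using q
      by (intro Lq_int_add_le[OF s] disc_measurable_cmult disc_measurable_diff Km S hm) auto
    also have "Lq_int \<upsilon> q (\<lambda>z. (-1) * (K S z - of_nat N * h z)) = Lq_int \<upsilon> q (\<lambda>z. K S z - of_nat N * h z)"
      using Lq_int_cmult[OF s disc_measurable_diff[OF Km[OF S(1)] disc_measurable_cmult[OF hm, of "of_nat N"]], of q "-1"] by simp
    also have "ennreal c * (Lq_int \<upsilon> q (\<lambda>z. K S z - of_nat N * h z) + Lq_int \<upsilon> q (K S)) \<le> ennreal c * (ennreal 1 + ennreal (B * (2 * real N) powr (q / p)))"
      by (intro mult_left_mono add_mono S KS) simp
    also have "\<dots> = ennreal (c * (1 + B * (2 * real N) powr (q / p)))"
      using c B(1) by (simp add: ennreal_mult)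
    finally show ?thesis using c B by (subst (asm) ennreal_le_iff) auto
  qed
  \<comment> \<open>The surplus of N^q over N^(q/p); it is positive because p > 1, and this makes
    the growth bound fail for large N unless \<eta> = 0.\<close>
  define a where "a = q - q / p"
  have a: "0 < a" using p q by (simp add: a_def field_simps)
  define D where "D = c * (1 + B * 2 powr (q / p)) / \<eta>"
  have D: "0 \<le> D" using c B \<open>0 < \<eta>\<close> by (simp add: D_def)
  obtain N :: nat where N: "max 1 ((D + 1) powr (1 / a)) < real N" using reals_Archimedean2 by blast
  have N1: "1 < real N" using N by simp
  have "D + 1 = ((D + 1) powr (1 / a)) powr a" using a D by (simp add: powr_powr)
  also have "\<dots> \<le> real N powr a" using N a by (intro powr_mono2) auto
  finally have Na: "D + 1 \<le> real N powr a" .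
  have "real N powr (q / p) * (real N powr a * \<eta>) = real N powr q * \<eta>"
    using N1 by (simp add: a_def powr_add[symmetric] mult.assoc[symmetric])
  also have "\<dots> \<le> c * (1 + B * (2 * real N) powr (q / p))" by (rule growth) (use N1 in simp)
  also have "\<dots> \<le> c * (real N powr (q / p) + B * (2 * real N) powr (q / p))"
  proof -
    have "1 \<le> real N powr (q / p)" using N1 p q by (intro ge_one_powr_ge_zero) auto
    then show ?thesis using c by simp
  qed
  also have "\<dots> = real N powr (q / p) * (D * \<eta>)"
  proof -
    have "D * \<eta> = c * (1 + B * 2 powr (q / p))" using \<open>0 < \<eta>\<close> by (simp add: D_def)
    then show ?thesis by (simp only: powr_mult) (simp add: algebra_simps)
  qed
  finally have "real N powr a * \<eta> \<le> D * \<eta>" using N1 by simp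
  then have "real N powr a \<le> D" using \<open>0 < \<eta>\<close> by simp
  then show False using Na by simp
qed

lemma compact_op_add:
  assumes s: "sets \<upsilon> = sets borel" and p: "0 < p" "0 < q" and K: "compact_op \<omega> p \<upsilon> q K" and L: "compact_op \<omega> p \<upsilon> q L"
  shows "compact_op \<omega> p \<upsilon> q (\<lambda>f z. K f z + L f z)"
proof -
  have Lq_add: "(\<lambda>z. g z + h z) \<in> Lq_space \<upsilon> q" if "g \<in> Lq_space \<upsilon> q" "h \<in> Lq_space \<upsilon> q" for g h
  proof -
    have "Lq_int \<upsilon> q (\<lambda>z. g z + h z) \<le> ennreal (2 powr q) * (Lq_int \<upsilon> q g + Lq_int \<upsilon> q h)"
      by (rule Lq_int_add_le[OF s]) (use p that disc_measurable_Lq[OF s] in auto)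
    also have "\<dots> < \<infinity>" using that by (auto simp: Lq_space_def ennreal_mult_less_top)
    finally show ?thesis using that by (auto simp: Lq_space_def)
  qed
  show ?thesis
    unfolding compact_op_def
  proof (intro conjI ballI allI impI)
    fix f assume "f \<in> Ap_space \<omega> p"
    then show "(\<lambda>z. K f z + L f z) \<in> Lq_space \<upsilon> q" by (intro Lq_add compact_opD(1)[OF K] compact_opD(1)[OF L])
  next
    fix f g a b assume fg: "f \<in> Ap_space \<omega> p" "g \<in> Ap_space \<omega> p"
    have "K (\<lambda>z. a * f z + b * g z) = (\<lambda>z. a * K f z + b * K g z)" "L (\<lambda>z. a * f z + b * g z) = (\<lambda>z. a * L f z + b * L g z)"
      using K L fg unfolding compact_op_def by blast+
    then show "(\<lambda>z. K (\<lambda>z. a * f z + b * g z) z + L (\<lambda>z. a * f z + b * g z) z) = (\<lambda>z. a * (K f z + L f z) + b * (K g z + L g z))"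
      by (simp add: fun_eq_iff algebra_simps)
  next
    fix F :: "nat \<Rightarrow> complex \<Rightarrow> complex" assume "\<forall>n. F n \<in> Ap_space \<omega> p \<and> Ap_norm \<omega> p (F n) \<le> 1"
    then have F: "\<And>n. F n \<in> Ap_space \<omega> p" "\<And>n. Ap_int \<omega> p (F n) \<le> 1"
      using Ap_norm_le_1_iff[OF p(1)] by auto
    obtain r g where r: "strict_mono (r::nat \<Rightarrow> nat)" and g: "g \<in> Lq_space \<upsilon> q"
      and lim1: "((\<lambda>n. Lq_norm \<upsilon> q (\<lambda>z. K (F (r n)) z - g z)) \<longlongrightarrow> 0) sequentially"
      by (rule compact_op_subseq[OF K p F])
    obtain t h where t: "strict_mono (t::nat \<Rightarrow> nat)" and h: "h \<in> Lq_space \<upsilon> q"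
      and lim2: "((\<lambda>n. Lq_norm \<upsilon> q (\<lambda>z. L (F (r (t n))) z - h z)) \<longlongrightarrow> 0) sequentially"
      using compact_op_subseq[OF L p, of "\<lambda>n. F (r n)"] F by auto
    have lim1': "((\<lambda>n. Lq_norm \<upsilon> q (\<lambda>z. K (F (r (t n))) z - g z)) \<longlongrightarrow> 0) sequentially"
      using filterlim_compose[OF lim1 filterlim_subseq[OF t]] .
    have "((\<lambda>n. Lq_norm \<upsilon> q (\<lambda>z. K (F (r (t n))) z + L (F (r (t n))) z - (g z + h z))) \<longlongrightarrow> 0) sequentially"
    proof (rule Lq_norm_tendsto_0I[OF p(2)])
      fix e :: real assume e: "0 < e"
      define d where "d = e / (2 * 2 powr q)"
      have d: "0 < d" using e by (simp add: d_def)
      show "eventually (\<lambda>n. Lq_int \<upsilon> q (\<lambda>z. K (F (r (t n))) z + L (F (r (t n))) z - (g z + h z)) \<le> ennreal e) sequentially"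
        using Lq_norm_tendsto_0D[OF p(2) lim1' d] Lq_norm_tendsto_0D[OF p(2) lim2 d]
      proof eventually_elim
        case (elim n)
        have "Lq_int \<upsilon> q (\<lambda>z. K (F (r (t n))) z + L (F (r (t n))) z - (g z + h z))
          = Lq_int \<upsilon> q (\<lambda>z. (K (F (r (t n))) z - g z) + (L (F (r (t n))) z - h z))"
          by (simp add: algebra_simps)
        also have "\<dots> \<le> ennreal (2 powr q) * (Lq_int \<upsilon> q (\<lambda>z. K (F (r (t n))) z - g z) + Lq_int \<upsilon> q (\<lambda>z. L (F (r (t n))) z - h z))"
          using p F(1) g h compact_opD(1)[OF K] compact_opD(1)[OF L]
          by (intro Lq_int_add_le[OF s] disc_measurable_diff disc_measurable_Lq[OF s]) auto
        also have "\<dots> \<le> ennreal (2 powr q) * (ennreal d + ennreal d)"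
          using elim by (intro mult_left_mono add_mono) auto
        also have "\<dots> = ennreal e" using d by (simp flip: ennreal_plus ennreal_mult) (simp add: d_def)
        finally show ?case .
      qed
    qed
    then show "\<exists>r h. strict_mono r \<and> h \<in> Lq_space \<upsilon> q \<and>
        ((\<lambda>n. Lq_norm \<upsilon> q (\<lambda>z. K (F (r n)) z + L (F (r n)) z - h z)) \<longlongrightarrow> 0) sequentially"
      by (intro exI[of _ "r \<circ> t"] exI[of _ "\<lambda>z. g z + h z"] conjI)
        (use strict_mono_o[OF r t] Lq_add[OF g h] in \<open>auto simp: comp_def\<close>)
  qed
qed

section \<open>Truncated operators and their compactness\<close>

lemma Ap_ball_locally_bounded:
  assumes w: "weight_D \<omega>" and p: "1 < p" and R: "R < 1"
  shows "\<exists>B. \<forall>f z. f holomorphic_on disc \<longrightarrow> Ap_int \<omega> p f \<le> 1 \<longrightarrow> norm z \<le> R \<longrightarrow> norm ((deriv ^^ k) f z) \<le> B"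
proof -
  have rw: "radial_weight \<omega>" using w by (simp add: weight_D_def weight_Dhat_def)
  obtain C0 where C0: "C0 > 0" "\<And>f. f holomorphic_on disc \<Longrightarrow> (\<integral>\<^sup>+z. reg_density \<omega> p f z \<partial>lborel) \<le> ennreal C0 * Ap_int \<omega> p f"
    using Ap_int_regularized_le[OF w p(1)] unfolding reg_density_def by auto
  \<comment> \<open>Taking q = p in the local estimate; the gauge decreases in the radius, so its
    value at R serves on the whole disc of radius R.\<close>
  obtain c where c: "c > 0" "\<And>f w. f holomorphic_on disc \<Longrightarrow> Ap_int \<omega> p f \<le> 1 \<Longrightarrow> norm w < 1 \<Longrightarrow>
    ennreal (norm ((deriv ^^ k) f w) powr p)
      \<le> ennreal (c / carleson_gauge \<omega> p p k (norm w)) * (\<integral>\<^sup>+z\<in>ball w ((1 - norm w) / 4). reg_density \<omega> p f z \<partial>lborel)"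
    using higher_deriv_le_reg_density[OF w p order_refl, of k] by blast
  define R0 where "R0 = max 0 R"
  have R0: "0 \<le> R0" "R0 < 1" using R by (auto simp: R0_def)
  have g0: "0 < carleson_gauge \<omega> p p k R0" by (rule carleson_gauge_pos[OF rw R0])
  show ?thesis
  proof (intro exI allI impI)
    fix f z assume f: "f holomorphic_on disc" "Ap_int \<omega> p f \<le> 1" and z: "norm (z::complex) \<le> R"
    have z0: "norm z \<le> R0" "norm z < 1" using z R by (auto simp: R0_def)
    have gz: "carleson_gauge \<omega> p p k R0 \<le> carleson_gauge \<omega> p p k (norm z)"
      unfolding carleson_gauge_def using z0 R0 p nn_integral_omega(2)[OF rw, of R0] nn_integral_omega(2)[OF rw, of "norm z"]
      by (intro mult_mono powr_mono2 omega_hat_antimono[OF rw] mult_nonneg_nonneg) auto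
    have "(\<integral>\<^sup>+y\<in>ball z ((1 - norm z) / 4). reg_density \<omega> p f y \<partial>lborel) \<le> (\<integral>\<^sup>+z. reg_density \<omega> p f z \<partial>lborel)"
      by (intro nn_integral_mono) (auto simp: indicator_def)
    also have "\<dots> \<le> ennreal C0 * Ap_int \<omega> p f" by (rule C0(2)[OF f(1)])
    also have "\<dots> \<le> ennreal C0 * 1" by (intro mult_left_mono f) simp
    finally have "ennreal (norm ((deriv ^^ k) f z) powr p) \<le> ennreal (c / carleson_gauge \<omega> p p k (norm z)) * ennreal C0"
      by (intro order_trans[OF c(2)[OF f z0(2)]] mult_left_mono) simp_all
    also have "\<dots> \<le> ennreal (c / carleson_gauge \<omega> p p k R0) * ennreal C0"
      using gz g0 c(1) by (intro mult_right_mono ennreal_leI divide_left_mono mult_pos_pos) auto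
    also have "\<dots> = ennreal (c / carleson_gauge \<omega> p p k R0 * C0)"
      using c(1) g0 C0 by (subst ennreal_mult) auto
    finally have "norm ((deriv ^^ k) f z) powr p \<le> c / carleson_gauge \<omega> p p k R0 * C0"
      using c(1) g0 C0 by (subst (asm) ennreal_le_iff) auto
    then have "(norm ((deriv ^^ k) f z) powr p) powr (1 / p) \<le> (c / carleson_gauge \<omega> p p k R0 * C0) powr (1 / p)"
      using p by (intro powr_mono2) auto
    then show "norm ((deriv ^^ k) f z) \<le> (c / carleson_gauge \<omega> p p k R0 * C0) powr (1 / p)"
      using p by (simp add: powr_powr)
  qed
qed

text \<open>The value 0 off the disc is deliberate: \<open>compact_op\<close> asks for linearity as
  an identity of functions on the whole plane and for measurability there, while \<open>u\<close>
  and \<tau> are arbitrary outside the disc.\<close>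

definition trunc_op :: "(complex \<Rightarrow> complex) \<Rightarrow> (complex \<Rightarrow> complex) \<Rightarrow> nat \<Rightarrow> real \<Rightarrow> opr" where
  "trunc_op u \<tau> k R f z = (if z \<in> disc \<and> norm (\<tau> z) \<le> R then u z * (deriv ^^ k) f (\<tau> z) else 0)"

text \<open>Montel's theorem is applied to the family of k-th derivatives, locally bounded by
  \<open>Ap_ball_locally_bounded\<close>. The truncation only evaluates them on
  \<open>cball 0 R\<close>, where the convergence is uniform, and the integrability of |u|^q turns
  it into convergence in L^q.\<close>

lemma compact_trunc_op:
  assumes w: "weight_D \<omega>" and p: "1 < p" and q: "0 < q" and s: "sets \<upsilon> = sets borel" and \<tau>: "self_map \<tau>"
    and u: "u holomorphic_on disc" "Lq_int \<upsilon> q u < \<infinity>" and R: "R < 1"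
  shows "compact_op \<omega> p \<upsilon> q (trunc_op u \<tau> k R)"
proof -
  have \<tau>h: "\<tau> holomorphic_on disc" and \<tau>d: "\<And>z. z \<in> disc \<Longrightarrow> \<tau> z \<in> disc"
    using \<tau> by (auto simp: self_map_def)
  have od: "open disc" by (simp add: disc_def)
  define E where "E = {z\<in>disc. norm (\<tau> z) \<le> R}"
  have E: "E \<in> sets borel"
  proof -
    have [measurable]: "(\<lambda>z. indicator disc z *\<^sub>R \<tau> z) \<in> borel_measurable borel"
      by (intro borel_measurable_continuous_on_indicator holomorphic_on_imp_continuous_on \<tau>h disc_sets)
    have "disc \<inter> {z\<in>space borel. norm (indicator disc z *\<^sub>R \<tau> z) \<le> R} \<in> sets borel"
      by (intro sets.Int disc_sets) measurable
    then show ?thesis by (rule back_subst[of "\<lambda>x. x \<in> sets borel"]) (auto simp: E_def)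
  qed
  have cb: "cball 0 R \<subseteq> disc" using R by (auto simp: disc_def)
  \<comment> \<open>\<open>A\<close> takes the k-th derivative as its argument, so that it also
    applies to the Montel limit g, which is not presented as a derivative.\<close>
  define A where "A = (\<lambda>(g::complex \<Rightarrow> complex) z. if z \<in> E then u z * g (\<tau> z) else 0)"
  have A: "A g \<in> Lq_space \<upsilon> q" if g: "g holomorphic_on disc" for g
  proof -
    have "continuous_on disc (\<lambda>z. u z * g (\<tau> z))"
      by (intro continuous_on_mult holomorphic_on_imp_continuous_on u
          continuous_on_compose2[OF holomorphic_on_imp_continuous_on[OF g] holomorphic_on_imp_continuous_on[OF \<tau>h]])
        (use \<tau>d in auto)
    then have "(\<lambda>z. indicator E z *\<^sub>R (u z * g (\<tau> z))) \<in> borel_measurable borel"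
      using E by (intro borel_measurable_continuous_on_indicator) (auto intro: continuous_on_subset simp: E_def)
    then have "A g \<in> borel_measurable borel"
      by (rule back_subst[of "\<lambda>h. h \<in> borel_measurable borel"]) (auto simp: A_def fun_eq_iff)
    then have m: "A g \<in> borel_measurable \<upsilon>" using measurable_cong_sets[OF s refl] by blast
    have "bounded (g ` cball 0 R)"
      by (intro compact_imp_bounded compact_continuous_image continuous_on_subset[OF holomorphic_on_imp_continuous_on[OF g] cb]) auto
    then obtain B where B: "\<And>z. norm z \<le> R \<Longrightarrow> norm (g z) \<le> B" by (fastforce simp: bounded_iff)
    have "Lq_int \<upsilon> q (A g) \<le> (\<integral>\<^sup>+z\<in>disc. ennreal (norm (of_real B * u z) powr q) \<partial>\<upsilon>)"
      unfolding Lq_int_def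
    proof (intro nn_integral_mono mult_right_mono ennreal_leI powr_mono2)
      fix z
      show "norm (A g z) \<le> norm (of_real B * u z)"
      proof (cases "z \<in> E")
        case True
        then have "norm (g (\<tau> z)) \<le> B" using B by (simp add: E_def)
        then show ?thesis using True mult_right_mono[of "norm (g (\<tau> z))" "\<bar>B\<bar>" "norm (u z)"] by (simp add: A_def norm_mult mult.commute)
      qed (simp add: A_def)
    qed (use q in auto)
    also have "\<dots> = ennreal (norm (of_real B :: complex) powr q) * Lq_int \<upsilon> q u"
      using Lq_int_cmult[OF s disc_measurable_continuous[OF holomorphic_on_imp_continuous_on[OF u(1)]], of q "of_real B"] by (simp add: Lq_int_def)
    also have "\<dots> < \<infinity>" using u(2) by (simp add: ennreal_mult_less_top)
    finally show ?thesis using m by (simp add: Lq_space_def)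
  qed
  have KA: "trunc_op u \<tau> k R f = A ((deriv ^^ k) f)" for f
    by (auto simp: fun_eq_iff A_def trunc_op_def E_def)
  have hd: "(deriv ^^ k) f holomorphic_on disc" if "f holomorphic_on disc" for f
    by (rule holomorphic_higher_deriv[OF that od])
  show ?thesis
    unfolding compact_op_def
  proof (intro conjI ballI allI impI)
    fix f assume "f \<in> Ap_space \<omega> p"
    then show "trunc_op u \<tau> k R f \<in> Lq_space \<upsilon> q" unfolding KA by (intro A hd) (simp add: Ap_space_def)
  next
    fix f g a b assume "f \<in> Ap_space \<omega> p" "g \<in> Ap_space \<omega> p"
    then have f: "f holomorphic_on disc" and g: "g holomorphic_on disc" by (auto simp: Ap_space_def)
    have "(deriv ^^ k) (\<lambda>z. a * f z + b * g z) z = a * (deriv ^^ k) f z + b * (deriv ^^ k) g z" if "z \<in> disc" for z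
    proof -
      have "(\<lambda>z. a * f z) holomorphic_on disc" "(\<lambda>z. b * g z) holomorphic_on disc"
        using f g by (auto intro!: holomorphic_intros)
      from higher_deriv_add[OF this od that, of k] show ?thesis
        using higher_deriv_cmult[OF f that od] higher_deriv_cmult[OF g that od] by simp
    qed
    then show "trunc_op u \<tau> k R (\<lambda>z. a * f z + b * g z) = (\<lambda>z. a * trunc_op u \<tau> k R f z + b * trunc_op u \<tau> k R g z)"
      using \<tau>d by (auto simp: trunc_op_def fun_eq_iff algebra_simps)
  next
    fix F :: "nat \<Rightarrow> complex \<Rightarrow> complex" assume "\<forall>n. F n \<in> Ap_space \<omega> p \<and> Ap_norm \<omega> p (F n) \<le> 1"
    then have F: "\<And>n. F n holomorphic_on disc" "\<And>n. Ap_int \<omega> p (F n) \<le> 1"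
      using Ap_norm_le_1_iff[of p] p by (auto simp: Ap_space_def)
    define H where "H = {(deriv ^^ k) f |f. f holomorphic_on disc \<and> Ap_int \<omega> p f \<le> 1}"
    obtain g r where g: "g holomorphic_on disc" and r: "strict_mono (r::nat \<Rightarrow> nat)"
      and ul: "\<And>K. \<lbrakk>compact K; K \<subseteq> disc\<rbrakk> \<Longrightarrow> uniform_limit K ((\<lambda>n. (deriv ^^ k) (F n)) \<circ> r) g sequentially"
    proof (rule Montel[OF od, of H "\<lambda>n. (deriv ^^ k) (F n)"])
      show "h holomorphic_on disc" if "h \<in> H" for h using that hd by (auto simp: H_def)
      show "\<exists>B. \<forall>h\<in>H. \<forall>z\<in>K. norm (h z) \<le> B" if K: "compact K" "K \<subseteq> disc" for K
      proof (cases "K = {}")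
        case False
        have "continuous_on K norm" by (intro continuous_intros)
        from continuous_attains_sup[OF K(1) False this]
        obtain z0 where z0: "z0 \<in> K" "\<And>z. z \<in> K \<Longrightarrow> norm z \<le> norm z0" by blast
        have "norm z0 < 1" using z0 K by (auto simp: disc_def)
        from Ap_ball_locally_bounded[OF w p this, of k] obtain B where
          "\<And>f z. f holomorphic_on disc \<Longrightarrow> Ap_int \<omega> p f \<le> 1 \<Longrightarrow> norm z \<le> norm z0 \<Longrightarrow> norm ((deriv ^^ k) f z) \<le> B" by blast
        then show ?thesis using z0 unfolding H_def by blast
      qed auto
      show "range (\<lambda>n. (deriv ^^ k) (F n)) \<subseteq> H" using F by (auto simp: H_def)
    qed blast
    have ul': "uniform_limit (cball 0 R) (\<lambda>n. (deriv ^^ k) (F (r n))) g sequentially"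
      using ul[OF compact_cball cb] by (simp add: comp_def)
    have "((\<lambda>n. Lq_norm \<upsilon> q (\<lambda>z. trunc_op u \<tau> k R (F (r n)) z - A g z)) \<longlongrightarrow> 0) sequentially"
    proof (rule Lq_norm_tendsto_0I[OF q])
      fix e :: real assume e: "0 < e"
      define x where "x = enn2real (Lq_int \<upsilon> q u)"
      have x: "Lq_int \<upsilon> q u = ennreal x" "0 \<le> x" using u(2) by (auto simp: x_def)
      define d where "d = (e / (x + 1)) powr (1 / q)"
      have d: "0 < d" using e x by (simp add: d_def)
      have dq: "d powr q * x \<le> e"
      proof -
        have "d powr q = e / (x + 1)" using e x q by (simp add: d_def powr_powr)
        then have "d powr q * x = e * (x / (x + 1))" by simp
        also have "\<dots> \<le> e * 1" using e x by (intro mult_left_mono) auto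
        finally show ?thesis by simp
      qed
      have "eventually (\<lambda>n. \<forall>z\<in>cball 0 R. dist ((deriv ^^ k) (F (r n)) z) (g z) < d) sequentially"
        by (rule uniform_limitD[OF ul' d])
      then show "eventually (\<lambda>n. Lq_int \<upsilon> q (\<lambda>z. trunc_op u \<tau> k R (F (r n)) z - A g z) \<le> ennreal e) sequentially"
      proof eventually_elim
        case (elim n)
        have "Lq_int \<upsilon> q (\<lambda>z. trunc_op u \<tau> k R (F (r n)) z - A g z) \<le> (\<integral>\<^sup>+z\<in>disc. ennreal (norm (of_real d * u z) powr q) \<partial>\<upsilon>)"
          unfolding Lq_int_def
        proof (intro nn_integral_mono mult_right_mono ennreal_leI powr_mono2)
          fix z
          show "norm (trunc_op u \<tau> k R (F (r n)) z - A g z) \<le> norm (of_real d * u z)"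
          proof (cases "z \<in> E")
            case True
            then have "norm ((deriv ^^ k) (F (r n)) (\<tau> z) - g (\<tau> z)) \<le> d"
              using elim by (auto simp: E_def dist_norm intro: less_imp_le)
            then have "norm (u z) * norm ((deriv ^^ k) (F (r n)) (\<tau> z) - g (\<tau> z)) \<le> norm (u z) * d"
              by (intro mult_left_mono) auto
            then show ?thesis unfolding KA A_def using True d
              by (simp add: norm_mult mult.commute flip: right_diff_distrib)
          qed (simp add: KA A_def)
        qed (use q in auto)
        also have "\<dots> = ennreal (norm (of_real d :: complex) powr q) * Lq_int \<upsilon> q u"
          using Lq_int_cmult[OF s disc_measurable_continuous[OF holomorphic_on_imp_continuous_on[OF u(1)]], of q "of_real d"] by (simp add: Lq_int_def)
        also have "\<dots> = ennreal (d powr q * x)" using d x by (simp add: ennreal_mult)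
        also have "\<dots> \<le> ennreal e" by (rule ennreal_leI[OF dq])
        finally show ?case .
      qed
    qed
    then show "\<exists>r h. strict_mono r \<and> h \<in> Lq_space \<upsilon> q \<and>
        ((\<lambda>n. Lq_norm \<upsilon> q (\<lambda>z. trunc_op u \<tau> k R (F (r n)) z - h z)) \<longlongrightarrow> 0) sequentially"
      using r A[OF g] by blast
  qed
qed

section \<open>Separation of the two summands\<close>

text \<open>Since 1 - cnj(a) z = (1 - |a|^2) + cnj(a) (a - z) and |a - z| is at most half of 1 - |a|
  <= 1 - |a|^2, the denominator is at most a fixed multiple of the numerator.\<close>

lemma bergman_sigma_ge:
  assumes a: "norm a < 1" and z: "dist a z < (1 - norm a) / 2"
  shows "2/5 \<le> norm (bergman_sigma a z)"
proof -
  have "norm (1 - cnj a * z) = norm (of_real (1 - (norm a)\<^sup>2) + cnj a * (a - z))"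
  proof -
    have "of_real (1 - (norm a)\<^sup>2) = 1 - cnj a * a"
      by (simp only: of_real_diff of_real_1 complex_norm_square mult.commute)
    then show ?thesis by (simp add: algebra_simps)
  qed
  also have "\<dots> \<le> \<bar>1 - (norm a)\<^sup>2\<bar> + norm a * norm (a - z)"
    by (rule norm_triangle_le) (simp only: norm_of_real norm_mult complex_mod_cnj order_refl)
  also have "\<dots> \<le> (1 + norm a) * (1 - norm a) + 1 * ((1 - norm a) / 2)"
  proof (intro add_mono mult_mono)
    show "\<bar>1 - (norm a)\<^sup>2\<bar> \<le> (1 + norm a) * (1 - norm a)"
      using a power_le_one[of "norm a" 2] by (simp add: algebra_simps power2_eq_square)
  qed (use a z in \<open>auto simp: dist_norm\<close>)
  also have "\<dots> \<le> 5/2 * ((1 + norm a) * (1 - norm a))"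
  proof -
    define y where "y = (1 + norm a) * (1 - norm a)"
    have "1 * (1 - norm a) \<le> y" unfolding y_def using a by (intro mult_right_mono) auto
    then show ?thesis using a unfolding y_def[symmetric] by simp
  qed
  finally have le: "norm (1 - cnj a * z) \<le> 5/2 * ((1 + norm a) * (1 - norm a))" .
  have "norm z < 1"
  proof -
    have "norm z \<le> norm a + dist a z" using norm_triangle_sub[of z a] by (simp add: dist_norm norm_minus_commute)
    then show ?thesis using z a by simp
  qed
  then have pos: "0 < norm (1 - cnj a * z)" using one_minus_cnj_mult_ge(1)[OF a] a by (meson less_le_trans diff_gt_0_iff_gt)
  have "norm (bergman_sigma a z) = (1 + norm a) * (1 - norm a) / norm (1 - cnj a * z)"
  proof -
    have "\<bar>1 - (norm a)\<^sup>2\<bar> = (1 + norm a) * (1 - norm a)"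
      using a power_le_one[of "norm a" 2] by (simp add: algebra_simps power2_eq_square)
    then show ?thesis unfolding bergman_sigma_def norm_divide norm_of_real by simp
  qed
  then show ?thesis using le pos by (simp add: pos_le_divide_eq)
qed

lemma bergman_sigma_holomorphic:
  assumes a: "norm a < 1"
  shows "(\<lambda>z. bergman_sigma a z ^ n) holomorphic_on disc"
proof -
  have "1 - cnj a * z \<noteq> 0" if "z \<in> disc" for z
    using one_minus_cnj_mult_ge(1)[OF a, of z] that a by (auto simp: disc_def)
  then show ?thesis unfolding bergman_sigma_def by (intro holomorphic_intros) auto
qed

lemma deriv_bergman_sigma_power:
  assumes a: "norm a < 1" and z: "norm z < 1"
  shows "deriv (\<lambda>z. bergman_sigma a z ^ n) z = of_nat n * (cnj a / of_real (1 - (norm a)\<^sup>2)) * bergman_sigma a z ^ Suc n"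
proof -
  define D :: complex where "D = of_real (1 - (norm a)\<^sup>2)"
  have "(norm a)\<^sup>2 < 1" using a by (simp add: power_less_one_iff abs_square_less_1)
  then have D: "D \<noteq> 0" unfolding D_def of_real_eq_0_iff by simp
  have nz: "1 - cnj a * z \<noteq> 0" using one_minus_cnj_mult_ge(1)[OF a z] a by auto
  have "((\<lambda>z. (D / (1 - cnj a * z)) ^ n) has_field_derivative
      of_nat n * (D / (1 - cnj a * z)) ^ (n - 1) * (D * cnj a / (1 - cnj a * z)\<^sup>2)) (at z)"
    using nz by (auto intro!: derivative_eq_intros simp: power2_eq_square)
  then have "deriv (\<lambda>z. bergman_sigma a z ^ n) z = of_nat n * (D / (1 - cnj a * z)) ^ (n - 1) * (D * cnj a / (1 - cnj a * z)\<^sup>2)"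
    unfolding bergman_sigma_def D_def by (rule DERIV_imp_deriv)
  also have "D * cnj a / (1 - cnj a * z)\<^sup>2 = (cnj a / D) * (D / (1 - cnj a * z))\<^sup>2"
    using D by (simp add: power2_eq_square)
  also have "of_nat n * (D / (1 - cnj a * z)) ^ (n - 1) * ((cnj a / D) * (D / (1 - cnj a * z))\<^sup>2) = of_nat n * (cnj a / D) * (D / (1 - cnj a * z)) ^ Suc n"
    by (cases n) (simp_all add: power2_eq_square)
  finally show ?thesis unfolding bergman_sigma_def D_def .
qed

text \<open>The vectors \<open>(1, s, s\<^sup>2)\<close> and \<open>(m, (m+1) t, (m+2) t\<^sup>2)\<close> are never parallel, because
  \<open>(m+1)\<^sup>2 \<noteq> m (m+2)\<close>; hence three exponents suffice to separate the two summands of the operator.\<close>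

lemma separation_bound:
  fixes m :: nat and X Y s t :: complex
  assumes st: "norm s \<le> 2" "norm t \<le> 2"
  defines "T \<equiv> norm (X + of_nat m * Y) + norm (X * s + of_nat (m + 1) * Y * t) + norm (X * s\<^sup>2 + of_nat (m + 2) * Y * t\<^sup>2)"
  shows "norm X * (norm s)\<^sup>2 \<le> 4 * (real m + 2)\<^sup>2 * T" and "norm Y * (norm t)\<^sup>2 \<le> 4 * (real m + 2)\<^sup>2 * T"
proof -
  define T0 T1 T2 where "T0 = X + of_nat m * Y" and "T1 = X * s + of_nat (m + 1) * Y * t" and "T2 = X * s\<^sup>2 + of_nat (m + 2) * Y * t\<^sup>2"
  have T: "T = norm T0 + norm T1 + norm T2" by (simp add: T_def T0_def T1_def T2_def)
  define B where "B = 4 * (real m + 2)\<^sup>2"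
  have nm: "norm (of_nat m + 1 :: complex) = real m + 1" "norm (of_nat m + 2 :: complex) = real m + 2"
    by (metis norm_of_nat of_nat_Suc add.commute) (metis norm_of_nat of_nat_add of_nat_numeral)
  have st4: "norm s * norm t \<le> 2 * 2" using st by (intro mult_mono) auto
  have lin: "norm ((of_nat m + 1) * t + of_nat m * s) \<le> 4 * real m + 2"
  proof -
    have "norm ((of_nat m + 1) * t + of_nat m * s) \<le> (real m + 1) * norm t + real m * norm s"
      by (rule norm_triangle_le) (simp only: norm_mult nm norm_of_nat order_refl)
    also have "\<dots> \<le> (real m + 1) * 2 + real m * 2" using st by (intro add_mono mult_left_mono) auto
    finally show ?thesis by simp
  qed
  \<comment> \<open>Eliminating one unknown from three equations: the surviving coefficient is
    (m+1)^2 - m (m+2) = 1. The left sides contain s alone or t alone, so a lower bound is needed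
    only for the variable belonging to the wanted weight.\<close>
  have id: "X * s\<^sup>2 = (of_nat m + 1)\<^sup>2 * T2 - (of_nat m + 2) * ((of_nat m + 1) * t + of_nat m * s) * T1 + (of_nat m + 2) * (of_nat m + 1) * (s * t) * T0"
    "Y * t\<^sup>2 = ((of_nat m + 1) * t + of_nat m * s) * T1 - (of_nat m + 1) * (s * t) * T0 - of_nat m * T2"
    by (simp_all add: T0_def T1_def T2_def power2_eq_square algebra_simps)
  have n3: "norm (c * x - d * y + e * z) \<le> B * (norm x + norm y + norm z)" "norm (d * y - e * z - c * x) \<le> B * (norm x + norm y + norm z)"
    if "norm c \<le> B" "norm d \<le> B" "norm e \<le> B" for c d e x y z :: complex
  proof -
    have "norm (c * x) \<le> B * norm x" "norm (d * y) \<le> B * norm y" "norm (e * z) \<le> B * norm z"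
      using that by (auto simp: norm_mult intro: mult_right_mono)
    moreover have "norm (c * x - d * y + e * z) \<le> norm (c * x) + norm (d * y) + norm (e * z)"
      by (rule norm_triangle_le[OF add_right_mono[OF norm_triangle_ineq4]])
    moreover have "norm (d * y - e * z - c * x) \<le> norm (d * y) + norm (e * z) + norm (c * x)"
      by (rule order_trans[OF norm_triangle_ineq4 add_right_mono[OF norm_triangle_ineq4]])
    ultimately show "norm (c * x - d * y + e * z) \<le> B * (norm x + norm y + norm z)" "norm (d * y - e * z - c * x) \<le> B * (norm x + norm y + norm z)"
      by (simp_all add: distrib_left)
  qed
  have "norm ((of_nat m + 1)\<^sup>2 :: complex) \<le> B"
    unfolding norm_power nm B_def by (simp add: power2_eq_square algebra_simps)
  moreover have "norm ((of_nat m + 2) * ((of_nat m + 1) * t + of_nat m * s)) \<le> B"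
  proof -
    have "(real m + 2) * norm ((of_nat m + 1) * t + of_nat m * s) \<le> (real m + 2) * (4 * real m + 2)"
      by (intro mult_left_mono lin) simp
    then show ?thesis unfolding norm_mult nm B_def by (simp add: power2_eq_square algebra_simps)
  qed
  moreover have "norm ((of_nat m + 2) * (of_nat m + 1) * (s * t)) \<le> B"
  proof -
    have "(real m + 2) * (real m + 1) * (norm s * norm t) \<le> (real m + 2) * (real m + 1) * (2 * 2)"
      by (intro mult_left_mono st4) simp
    then show ?thesis unfolding norm_mult nm B_def by (simp add: power2_eq_square algebra_simps)
  qed
  ultimately have "norm (X * s\<^sup>2) \<le> B * (norm T2 + norm T1 + norm T0)"
    unfolding id(1) by (intro n3(1))
  then show "norm X * (norm s)\<^sup>2 \<le> 4 * (real m + 2)\<^sup>2 * T" by (simp add: norm_mult norm_power T B_def ac_simps)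
  have "norm ((of_nat m + 1) * t + of_nat m * s) \<le> B"
    using lin unfolding B_def by (rule order_trans) (simp add: power2_eq_square algebra_simps)
  moreover have "norm ((of_nat m + 1) * (s * t)) \<le> B"
  proof -
    have "(real m + 1) * (norm s * norm t) \<le> (real m + 1) * (2 * 2)"
      by (intro mult_left_mono st4) simp
    also have "\<dots> \<le> B" unfolding B_def by (simp add: power2_eq_square algebra_simps)
    finally show ?thesis unfolding norm_mult nm .
  qed
  moreover have "norm (of_nat m :: complex) \<le> B"
    unfolding norm_of_nat B_def by (simp add: power2_eq_square algebra_simps)
  ultimately have "norm (Y * t\<^sup>2) \<le> B * (norm T2 + norm T1 + norm T0)"
    unfolding id(2) by (intro n3(2))
  then show "norm Y * (norm t)\<^sup>2 \<le> 4 * (real m + 2)\<^sup>2 * T" by (simp add: norm_mult norm_power T B_def ac_simps)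
qed

text \<open>Apply \<open>separation_bound\<close> to X = b0 s^m and Y = b1 (cnj(a) / (1 - |a|^2))
  t^(m+1). Only the variable near \<open>a\<close> is bounded below, by 2/5, and undoing its powers
  m + 2 or m + 3 costs (5/2)^(m+3) at most. The assumption |a| >= 1/2 bounds the factor cnj(a) away
  from 0, as the derivatives vanish identically for a = 0; it gives |a| / (1 - |a|^2) >= 1 / (4 (1 -
  |a|)), and this 4 times the 4 of \<open>separation_bound\<close> is the 16.\<close>

lemma weights_le_test_functions:
  fixes m :: nat and a z z' b0 b1 :: complex
  assumes a: "norm a < 1" "1/2 \<le> norm a" and z: "norm z < 1" "norm z' < 1"
  defines "T \<equiv> \<Sum>j<3. norm (b0 * bergman_sigma a z ^ (m + j) + b1 * deriv (\<lambda>z. bergman_sigma a z ^ (m + j)) z')"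
    and "c \<equiv> 16 * (real m + 2)\<^sup>2 * (5/2) ^ (m + 3)"
  shows "dist a z < (1 - norm a) / 2 \<Longrightarrow> norm b0 \<le> c * T"
    and "dist a z' < (1 - norm a) / 2 \<Longrightarrow> norm b1 \<le> c * (1 - norm a) * T"
proof -
  define s t where "s = bergman_sigma a z" and "t = bergman_sigma a z'"
  define D :: real where "D = 1 - (norm a)\<^sup>2"
  define X Y where "X = b0 * s ^ m" and "Y = b1 * (cnj a / of_real D) * t ^ Suc m"
  have eq: "b0 * bergman_sigma a z ^ (m + j) + b1 * deriv (\<lambda>z. bergman_sigma a z ^ (m + j)) z' = X * s ^ j + of_nat (m + j) * Y * t ^ j" for j
    unfolding deriv_bergman_sigma_power[OF a(1) z(2)] X_def Y_def s_def t_def D_def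
    by (simp add: power_add algebra_simps)
  have T: "T = norm (X + of_nat m * Y) + norm (X * s + of_nat (m + 1) * Y * t) + norm (X * s\<^sup>2 + of_nat (m + 2) * Y * t\<^sup>2)"
    unfolding T_def eq by (simp add: numeral_3_eq_3 power2_eq_square ac_simps)
  have T0: "0 \<le> T" by (simp add: T)
  note sb = separation_bound[OF norm_bergman_sigma_le(2)[OF a(1) z(1), folded s_def] norm_bergman_sigma_le(2)[OF a(1) z(2), folded t_def], where X=X and Y=Y and m=m, folded T]
  have inv: "y \<le> (5/2) ^ n * x" if "y * r ^ n \<le> x" "2/5 \<le> r" "0 \<le> y" for x y r :: real and n
  proof -
    have "y = y * (2/5) ^ n * (5/2) ^ n" by (simp add: mult.assoc flip: power_mult_distrib)
    also have "\<dots> \<le> y * r ^ n * (5/2) ^ n" using that by (intro mult_right_mono mult_left_mono power_mono) auto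
    also have "\<dots> \<le> x * (5/2) ^ n" using that by (intro mult_right_mono) auto
    finally show ?thesis by (simp add: mult.commute)
  qed
  {
    assume "dist a z < (1 - norm a) / 2"
    then have s: "2/5 \<le> norm s" unfolding s_def by (rule bergman_sigma_ge[OF a(1)])
    have "norm b0 * norm s ^ (m + 2) \<le> 4 * (real m + 2)\<^sup>2 * T"
      using sb(1) by (simp add: X_def norm_mult norm_power power_add power2_eq_square ac_simps)
    from inv[OF this s] have "norm b0 \<le> (5/2) ^ (m + 2) * (4 * (real m + 2)\<^sup>2 * T)" by simp
    also have "\<dots> \<le> c * T"
    proof -
      have "(5/2) ^ (m + 2) * 4 \<le> (16 * (5/2) ^ (m + 3) :: real)"
        by (simp add: power_add power3_eq_cube)
      then have "(5/2) ^ (m + 2) * 4 * ((real m + 2)\<^sup>2 * T) \<le> 16 * (5/2) ^ (m + 3) * ((real m + 2)\<^sup>2 * T)"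
        using T0 by (intro mult_right_mono) auto
      then show ?thesis by (simp add: c_def ac_simps)
    qed
    finally show "norm b0 \<le> c * T" .
  }
  {
    assume "dist a z' < (1 - norm a) / 2"
    then have t: "2/5 \<le> norm t" unfolding t_def by (rule bergman_sigma_ge[OF a(1)])
    have D: "0 < D" "D \<le> 2 * (1 - norm a)"
    proof -
      have "D = (1 + norm a) * (1 - norm a)" by (simp add: D_def algebra_simps power2_eq_square)
      moreover have "\<dots> \<le> 2 * (1 - norm a)" using a by (intro mult_right_mono) auto
      ultimately show "0 < D" "D \<le> 2 * (1 - norm a)" using a by (auto intro: mult_pos_pos add_pos_nonneg)
    qed
    have nY: "norm Y = norm b1 * (norm a / D) * norm t ^ Suc m"
      unfolding Y_def norm_mult norm_divide norm_of_real norm_power using D by simp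
    have "norm b1 * (norm a / D) * norm t ^ (m + 3) \<le> 4 * (real m + 2)\<^sup>2 * T"
      using sb(2) unfolding nY by (simp add: power_add numeral_3_eq_3 power2_eq_square ac_simps)
    from inv[OF this t] have "norm b1 * (norm a / D) \<le> (5/2) ^ (m + 3) * (4 * (real m + 2)\<^sup>2 * T)" using D by simp
    moreover have "norm b1 * (1 / (4 * (1 - norm a))) \<le> norm b1 * (norm a / D)"
    proof (rule mult_left_mono)
      have "1 / (4 * (1 - norm a)) \<le> (1/2) / D" using D a by (simp add: field_simps)
      also have "\<dots> \<le> norm a / D" using D a by (intro divide_right_mono) auto
      finally show "1 / (4 * (1 - norm a)) \<le> norm a / D" .
    qed simp
    ultimately have "norm b1 / (4 * (1 - norm a)) \<le> (5/2) ^ (m + 3) * (4 * (real m + 2)\<^sup>2 * T)" by simp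
    then show "norm b1 \<le> c * (1 - norm a) * T" using a by (simp add: c_def field_simps)
  }
qed

text \<open>The normalising scalar is independent of the exponent n, with one c large enough for all
  exponents in use; so it factors out of the three values of the operator before they are
  combined.\<close>

definition test_fun :: "(real \<Rightarrow> real) \<Rightarrow> real \<Rightarrow> real \<Rightarrow> nat \<Rightarrow> complex \<Rightarrow> complex \<Rightarrow> complex" where
  "test_fun \<omega> p c n a z = of_real ((c * (omega_hat \<omega> (norm a) * (1 - norm a))) powr (- 1 / p)) * bergman_sigma a z ^ n"

lemma test_fun_Ap:
  assumes w: "radial_weight \<omega>" and C: "1 \<le> C" "\<And>r. 0 \<le> r \<Longrightarrow> r < 1 \<Longrightarrow> omega_hat \<omega> r \<le> C * omega_hat \<omega> ((1 + r) / 2)"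
    and p: "0 < p" and n: "4 * C \<le> 2 powr (n * p)" and c: "4 powr (n * p) * 32 / pi \<le> c" and a: "norm a < 1"
  shows "test_fun \<omega> p c n a \<in> Ap_space \<omega> p" "Ap_int \<omega> p (test_fun \<omega> p c n a) \<le> 1"
proof -
  define W where "W = omega_hat \<omega> (norm a) * (1 - norm a)"
  have W: "0 < W" unfolding W_def using omega_hat_pos[OF w] a by (intro mult_pos_pos) auto
  have "0 < 4 powr (n * p) * 32 / pi" by simp
  then have c0: "0 < c" using c by linarith
  have hol: "(\<lambda>z. bergman_sigma a z ^ n) holomorphic_on disc" by (rule bergman_sigma_holomorphic[OF a])
  define x where "x = (c * W) powr (- 1 / p)"
  have xp: "x powr p = 1 / (c * W)"
  proof -
    have "- 1 / p * p = - 1" using p by simp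
    then show ?thesis unfolding x_def powr_powr using c0 W by (simp add: powr_minus_divide)
  qed
  have tf: "test_fun \<omega> p c n a = (\<lambda>z. of_real x * bergman_sigma a z ^ n)"
    by (simp add: fun_eq_iff test_fun_def x_def W_def)
  have "Ap_int \<omega> p (test_fun \<omega> p c n a) = ennreal (norm (of_real x :: complex) powr p) * Ap_int \<omega> p (\<lambda>z. bergman_sigma a z ^ n)"
    unfolding tf by (rule Ap_int_cmult[OF hol w])
  also have "norm (of_real x :: complex) powr p = 1 / (c * W)" using xp by (simp add: x_def)
  also have "ennreal (1 / (c * W)) * Ap_int \<omega> p (\<lambda>z. bergman_sigma a z ^ n) \<le> ennreal (1 / (c * W)) * ennreal (c * W)"
  proof (rule mult_left_mono)
    have "Ap_int \<omega> p (\<lambda>z. bergman_sigma a z ^ n) \<le> ennreal (4 powr (n * p) * 32 / pi * W)"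
      unfolding W_def by (rule Ap_int_bergman_sigma_le[OF w C p n a])
    also have "\<dots> \<le> ennreal (c * W)" using c W by (intro ennreal_leI mult_right_mono) auto
    finally show "Ap_int \<omega> p (\<lambda>z. bergman_sigma a z ^ n) \<le> ennreal (c * W)" .
  qed simp
  also have "\<dots> = 1" using c0 W by (simp flip: ennreal_mult)
  finally show 1: "Ap_int \<omega> p (test_fun \<omega> p c n a) \<le> 1" .
  have "test_fun \<omega> p c n a holomorphic_on disc" unfolding tf by (intro holomorphic_intros hol)
  then show "test_fun \<omega> p c n a \<in> Ap_space \<omega> p"
    using le_less_trans[OF 1, of \<infinity>] by (simp add: Ap_space_def)
qed

text \<open>For |z| <= R the base function is at most 2 (1 - |a|) / (1 - R), so the p-th power of
  the test function is of order (1 - |a|)^(np) over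
  \<open>omega_hat \<omega> (norm a) * (1 - norm a)\<close>. By
  \<open>one_minus_norm_powr_le\<close> this is O(1 - |a|).\<close>

lemma test_fun_null:
  assumes w: "radial_weight \<omega>" and C: "1 \<le> C" "\<And>r. 0 \<le> r \<Longrightarrow> r < 1 \<Longrightarrow> omega_hat \<omega> r \<le> C * omega_hat \<omega> ((1 + r) / 2)"
    and p: "0 < p" and n: "4 * C \<le> 2 powr (n * p)" and c: "0 < c" and a: "\<And>i. norm (a i) < 1"
    and lim: "(\<lambda>i. norm (a i)) \<longlonglongrightarrow> 1" and R: "R < 1"
  shows "uniform_limit (cball 0 R) (\<lambda>i. test_fun \<omega> p c n (a i)) (\<lambda>_. 0) sequentially"
proof -
  define Q where "Q = (2 / (1 - R)) powr (n * p) * (2 powr (n * p) / omega_hat \<omega> 0) / c"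
  have bound: "norm (test_fun \<omega> p c n (a i) z) \<le> (Q * (1 - norm (a i))) powr (1 / p)" if z: "norm z \<le> R" for i z
  proof -
    define r where "r = norm (a i)"
    define W where "W = omega_hat \<omega> r * (1 - r)"
    have r: "0 \<le> r" "r < 1" using a by (auto simp: r_def)
    have W: "0 < W" unfolding W_def using omega_hat_pos[OF w] r by (intro mult_pos_pos) auto
    have z1: "norm z < 1" using z R by simp
    have "norm (bergman_sigma (a i) z) \<le> 2 * (1 - r) / norm (1 - cnj (a i) * z)"
      using norm_bergman_sigma_le(1)[OF a z1] by (simp add: r_def)
    also have "\<dots> \<le> 2 * (1 - r) / (1 - R)"
      using one_minus_cnj_mult_ge(2)[OF a z1, of i] z R r by (intro divide_left_mono mult_pos_pos) auto
    finally have s: "norm (bergman_sigma (a i) z) \<le> 2 / (1 - R) * (1 - r)" by simp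
    have "norm (test_fun \<omega> p c n (a i) z) = (c * W) powr (- 1 / p) * norm (bergman_sigma (a i) z) ^ n"
      by (simp add: test_fun_def norm_mult norm_power W_def r_def)
    also have "\<dots> \<le> (c * W) powr (- 1 / p) * (2 / (1 - R) * (1 - r)) ^ n"
      by (intro mult_left_mono power_mono s) auto
    finally have "norm (test_fun \<omega> p c n (a i) z) powr p \<le> ((c * W) powr (- 1 / p) * (2 / (1 - R) * (1 - r)) ^ n) powr p"
      using p by (intro powr_mono2) auto
    also have "\<dots> = 1 / (c * W) * ((2 / (1 - R)) powr (n * p) * (1 - r) powr (n * p))"
    proof -
      have "- 1 / p * p = - 1" using p by simp
      then have 1: "((c * W) powr (- 1 / p)) powr p = 1 / (c * W)"
        unfolding powr_powr using c W by (simp add: powr_minus_divide)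
      have 2: "((2 / (1 - R) * (1 - r)) ^ n) powr p = (2 / (1 - R) * (1 - r)) powr (n * p)"
        using R r by (subst powr_realpow[symmetric]) (auto simp: powr_powr)
      show ?thesis unfolding powr_mult[of "(c * W) powr (- 1 / p)"] 1 2 powr_mult[of "2 / (1 - R)"] ..
    qed
    also have "\<dots> \<le> 1 / (c * W) * ((2 / (1 - R)) powr (n * p) * (2 powr (n * p) / omega_hat \<omega> 0 * (1 - r) * W))"
      using one_minus_norm_powr_le[OF w C p n r] c W unfolding W_def by (intro mult_left_mono) auto
    also have "\<dots> = Q * (1 - r)" using c W by (simp add: Q_def ac_simps)
    finally have "(norm (test_fun \<omega> p c n (a i) z) powr p) powr (1 / p) \<le> (Q * (1 - r)) powr (1 / p)"
      using p by (intro powr_mono2) auto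
    then show ?thesis using p by (simp add: powr_powr r_def)
  qed
  have "(\<lambda>i. (Q * (1 - norm (a i))) powr (1 / p)) \<longlonglongrightarrow> (Q * (1 - 1)) powr (1 / p)"
  proof (rule tendsto_powr')
    show "(\<lambda>i. Q * (1 - norm (a i))) \<longlonglongrightarrow> Q * (1 - 1)" by (intro tendsto_intros lim)
    have "0 \<le> Q" unfolding Q_def using c omega_hat_pos[OF w, of 0] by simp
    then have "0 \<le> Q * (1 - norm (a i))" for i using a[of i] by simp
    then show "Q * (1 - 1) \<noteq> 0 \<or> 0 < 1 / p \<and> eventually (\<lambda>i. 0 \<le> Q * (1 - norm (a i))) sequentially"
      using p by simp
  qed simp
  then have lim0: "(\<lambda>i. (Q * (1 - norm (a i))) powr (1 / p)) \<longlonglongrightarrow> 0" by simp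
  show ?thesis
  proof (rule uniform_limitI)
    fix e :: real assume "0 < e"
    then have "eventually (\<lambda>i. (Q * (1 - norm (a i))) powr (1 / p) < e) sequentially"
      by (rule order_tendstoD(2)[OF lim0])
    then show "eventually (\<lambda>i. \<forall>z\<in>cball 0 R. dist (test_fun \<omega> p c n (a i) z) 0 < e) sequentially"
    proof eventually_elim
      case (elim i)
      show ?case
      proof
        fix z :: complex assume "z \<in> cball 0 R"
        then show "dist (test_fun \<omega> p c n (a i) z) 0 < e" using bound[of z i] elim by simp
      qed
    qed
  qed
qed

text \<open>Otherwise points tending to the circle would violate the bound along a null sequence in
  the unit ball. The single index supplied by \<open>compact_op_null\<close> contradicts this, as
  every member violates the bound.\<close>

lemma compact_op_test_fun_small:
  assumes s: "sets \<upsilon> = sets borel" and w: "radial_weight \<omega>"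
    and C: "1 \<le> C" "\<And>r. 0 \<le> r \<Longrightarrow> r < 1 \<Longrightarrow> omega_hat \<omega> r \<le> C * omega_hat \<omega> ((1 + r) / 2)"
    and p: "1 < p" "0 < q" and n: "4 * C \<le> 2 powr (n * p)" and c: "4 powr (n * p) * 32 / pi \<le> c"
    and K: "compact_op \<omega> p \<upsilon> q K" and e: "0 < e"
  shows "\<exists>R<1. \<forall>a. R \<le> norm a \<longrightarrow> norm a < 1 \<longrightarrow> Lq_int \<upsilon> q (K (test_fun \<omega> p c n a)) \<le> ennreal e"
proof (rule ccontr)
  assume neg: "\<not> ?thesis"
  have "\<exists>a. 1 - 1 / real (Suc i) \<le> norm a \<and> norm a < 1 \<and> \<not> Lq_int \<upsilon> q (K (test_fun \<omega> p c n a)) \<le> ennreal e" for i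
  proof -
    have "1 - 1 / real (Suc i) < 1" by simp
    then show ?thesis using neg by blast
  qed
  then have "\<exists>a. \<forall>i. 1 - 1 / real (Suc i) \<le> norm (a i) \<and> norm (a i) < 1 \<and> \<not> Lq_int \<upsilon> q (K (test_fun \<omega> p c n (a i))) \<le> ennreal e"
    by (intro choice allI)
  then obtain a where a: "\<And>i. 1 - 1 / real (Suc i) \<le> norm (a i)" "\<And>i. norm (a i) < 1"
    "\<And>i. \<not> Lq_int \<upsilon> q (K (test_fun \<omega> p c n (a i))) \<le> ennreal e" by blast
  have "0 < 4 powr (n * p) * 32 / pi" by simp
  then have c0: "0 < c" using c by linarith
  have lim: "(\<lambda>i. norm (a i)) \<longlonglongrightarrow> 1"
  proof (rule tendsto_sandwich)
    have "(\<lambda>i. 1 - 1 / real (Suc i)) \<longlonglongrightarrow> 1 - 0"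
      by (intro tendsto_intros LIMSEQ_Suc[OF lim_inverse_n'])
    then show "(\<lambda>i. 1 - 1 / real (Suc i)) \<longlonglongrightarrow> 1" by simp
    show "eventually (\<lambda>i. 1 - 1 / real (Suc i) \<le> norm (a i)) sequentially" using a(1) by simp
    show "eventually (\<lambda>i. norm (a i) \<le> 1) sequentially" using a(2) by (simp add: less_imp_le)
  qed simp
  have p0: "0 < p" using p by simp
  have "\<exists>i. Lq_int \<upsilon> q (K (test_fun \<omega> p c n (a i))) \<le> ennreal e"
    by (rule compact_op_null[OF s w K p test_fun_Ap[OF w C p0 n c a(2)] test_fun_null[OF w C p0 n c0 a(2) lim] e])
  then show False using a(3) by blast
qed

section \<open>Essential norms\<close>

lemma norm_powr_le_sum3:
  fixes b q B :: real and x :: "nat \<Rightarrow> real"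
  assumes "0 \<le> q" "0 \<le> b" "0 \<le> B" "\<And>j. 0 \<le> x j" "b \<le> B * (\<Sum>j<3. x j)"
  shows "b powr q \<le> (3 * B) powr q * (\<Sum>j<3. x j powr q)"
proof -
  obtain i where i: "i < 3" "\<And>j. j < 3 \<Longrightarrow> x j \<le> x i"
  proof -
    define M where "M = Max (x ` {..<3::nat})"
    have fin: "finite (x ` {..<3::nat})" "x ` {..<3::nat} \<noteq> {}" by (simp_all add: lessThan_empty_iff)
    then have "M \<in> x ` {..<3}" unfolding M_def by (rule Max_in)
    then obtain i where "i < 3" "x i = M" by auto
    moreover have "x j \<le> M" if "j < 3" for j unfolding M_def using that by (intro Max_ge) auto
    ultimately show ?thesis using that by auto
  qed
  have "(\<Sum>j<3. x j) \<le> (\<Sum>j<(3::nat). x i)" using i by (intro sum_mono) auto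
  then have "B * (\<Sum>j<3. x j) \<le> B * (3 * x i)" using assms by (intro mult_left_mono) auto
  then have "b \<le> (3 * B) * x i" using assms(5) by simp
  then have "b powr q \<le> ((3 * B) * x i) powr q" using assms by (intro powr_mono2) auto
  also have "\<dots> = (3 * B) powr q * x i powr q" by (rule powr_mult)
  also have "x i powr q \<le> (\<Sum>j<3. x j powr q)" using i by (intro member_le_sum) auto
  finally show ?thesis by (simp add: mult_left_mono)
qed

lemma disc_measurable_weighted:
  assumes "self_map \<tau>" "u holomorphic_on disc" "f holomorphic_on disc"
  shows "disc_measurable (\<lambda>z. u z * (deriv ^^ k) f (\<tau> z))"
proof (intro disc_measurable_continuous continuous_on_mult)
  show "continuous_on disc u" using assms by (intro holomorphic_on_imp_continuous_on)
  have d: "(deriv ^^ k) f holomorphic_on disc" by (rule holomorphic_higher_deriv[OF assms(3)]) (simp add: disc_def)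
  have t: "\<tau> holomorphic_on disc" "\<tau> ` disc \<subseteq> disc" using assms(1) by (auto simp: self_map_def)
  show "continuous_on disc (\<lambda>z. (deriv ^^ k) f (\<tau> z))"
    by (rule continuous_on_compose2[OF holomorphic_on_imp_continuous_on[OF d] holomorphic_on_imp_continuous_on[OF t(1)] t(2)])
qed

text \<open>Only the sum is known to be bounded. Applied to f = 1 it gives \<open>u0\<close>,
  applied to f(z) = z it gives \<open>u0 * \<phi> + u1\<close>, and |\<phi>| < 1 on the disc. The
  result makes |u|^q d\<upsilon> a finite measure and the truncated operators compact.\<close>

lemma weight_functions_in_Lq:
  assumes w: "radial_weight \<omega>" and p: "0 < p" "0 < q" and s: "sets \<upsilon> = sets borel" and maps: "self_map \<phi>" "self_map \<psi>"
    and u: "u0 holomorphic_on disc" "u1 holomorphic_on disc"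
    and bd: "bounded_op \<omega> p \<upsilon> q (\<lambda>f z. wC u0 \<phi> f z + wD u1 \<psi> f z)"
  shows "Lq_int \<upsilon> q u0 < \<infinity>" "Lq_int \<upsilon> q u1 < \<infinity>"
proof -
  define T where "T = (\<lambda>f z. wC u0 \<phi> f z + wD u1 \<psi> f z)"
  have fin: "Lq_int \<upsilon> q (T f) < \<infinity>" if f: "f \<in> Ap_space \<omega> p" for f
  proof -
    obtain M where "Lq_norm \<upsilon> q (T f) \<le> ennreal M * Ap_norm \<omega> p f"
      using bd f unfolding bounded_op_def T_def by blast
    also have "\<dots> < \<infinity>" using f by (auto simp: Ap_norm_def root_enn_def Ap_space_def ennreal_mult_less_top)
    finally show ?thesis by (auto simp: Lq_norm_def root_enn_def top.not_eq_extremum split: if_splits)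
  qed
  have bounded_mem: "f \<in> Ap_space \<omega> p" if "f holomorphic_on disc" "\<And>z. z \<in> disc \<Longrightarrow> norm (f z) \<le> 1" for f
  proof -
    have "Ap_int \<omega> p f \<le> (\<integral>\<^sup>+z. ennreal (\<omega> (norm z) / pi) * indicator disc z \<partial>lborel)"
      unfolding Ap_int_weight(2)[OF w]
    proof (rule nn_integral_mono)
      fix z
      show "ennreal (norm (f z) powr p) * (ennreal (\<omega> (norm z) / pi) * indicator disc z) \<le> ennreal (\<omega> (norm z) / pi) * indicator disc z"
      proof (cases "z \<in> disc")
        case True
        have "norm (f z) powr p \<le> 1 powr p" using that(2)[OF True] p by (intro powr_mono2) auto
        then have "ennreal (norm (f z) powr p) \<le> 1" by simp
        from mult_right_mono[OF this, of "ennreal (\<omega> (norm z) / pi)"] show ?thesis using True by simp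
      qed simp
    qed
    also have "\<dots> < \<infinity>" by (rule Ap_int_weight(3)[OF w])
    finally show ?thesis using that by (simp add: Ap_space_def)
  qed
  have "Lq_int \<upsilon> q (T (\<lambda>_. 1)) < \<infinity>" by (intro fin bounded_mem) auto
  then show 0: "Lq_int \<upsilon> q u0 < \<infinity>" by (simp add: T_def wC_def wD_def)
  have m0: "disc_measurable (\<lambda>z. u0 z * \<phi> z)"
    using disc_measurable_weighted[OF maps(1) u(1), of "\<lambda>z. z" 0] by (simp add: holomorphic_on_id[unfolded id_def])
  have m1: "disc_measurable u1" by (intro disc_measurable_continuous holomorphic_on_imp_continuous_on u)
  have "T (\<lambda>z. z) = (\<lambda>z. u0 z * \<phi> z + u1 z)" by (simp add: T_def wC_def wD_def)
  moreover have "Lq_int \<upsilon> q (T (\<lambda>z. z)) < \<infinity>"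
    by (intro fin bounded_mem) (auto simp: disc_def intro: holomorphic_intros)
  ultimately have F: "Lq_int \<upsilon> q (\<lambda>z. u0 z * \<phi> z + u1 z) < \<infinity>" by simp
  have "Lq_int \<upsilon> q (\<lambda>z. u0 z * \<phi> z) \<le> Lq_int \<upsilon> q u0"
    unfolding Lq_int_def
  proof (rule nn_integral_mono)
    fix z
    show "ennreal (norm (u0 z * \<phi> z) powr q) * indicator disc z \<le> ennreal (norm (u0 z) powr q) * indicator disc z"
    proof (cases "z \<in> disc")
      case True
      then have "\<phi> z \<in> disc" using maps by (auto simp: self_map_def)
      then have "norm (u0 z * \<phi> z) \<le> norm (u0 z)" by (auto simp: norm_mult disc_def intro!: mult_left_le)
      then have "norm (u0 z * \<phi> z) powr q \<le> norm (u0 z) powr q" using p by (intro powr_mono2) auto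
      then show ?thesis using True by (simp add: ennreal_leI)
    qed simp
  qed
  then have G: "Lq_int \<upsilon> q (\<lambda>z. (-1) * (u0 z * \<phi> z)) < \<infinity>"
    using 0 Lq_int_cmult[OF s m0, of q "-1"] by (simp add: le_less_trans)
  have "Lq_int \<upsilon> q u1 = Lq_int \<upsilon> q (\<lambda>z. (u0 z * \<phi> z + u1 z) + (-1) * (u0 z * \<phi> z))" by simp
  also have "\<dots> \<le> ennreal (2 powr q) * (Lq_int \<upsilon> q (\<lambda>z. u0 z * \<phi> z + u1 z) + Lq_int \<upsilon> q (\<lambda>z. (-1) * (u0 z * \<phi> z)))"
    using p by (intro Lq_int_add_le[OF s] disc_measurable_add disc_measurable_cmult m0 m1) auto
  also have "\<dots> < \<infinity>" using F G by (simp add: ennreal_mult_less_top)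
  finally show "Lq_int \<upsilon> q u1 < \<infinity>" .
qed

text \<open>One argument for both components, selected by k, u and \<tau>. The estimate is made
  against each compact \<open>K\<close> separately, with a constant independent of \<open>K\<close>,
  so that the infimum over \<open>K\<close> can be taken afterwards.\<close>

lemma ess_norm_component_le:
  assumes w: "weight_D \<omega>" and p: "1 < p" "p \<le> q"
  shows "\<exists>C>0. \<forall>\<upsilon> \<phi> \<psi> u0 u1 u \<tau> K. sets \<upsilon> = sets borel \<longrightarrow> self_map \<phi> \<longrightarrow> self_map \<psi> \<longrightarrow>
     u0 holomorphic_on disc \<longrightarrow> u1 holomorphic_on disc \<longrightarrow>
     bounded_op \<omega> p \<upsilon> q (\<lambda>f z. wC u0 \<phi> f z + wD u1 \<psi> f z) \<longrightarrow>
     k = 0 \<and> u = u0 \<and> \<tau> = \<phi> \<or> k = 1 \<and> u = u1 \<and> \<tau> = \<psi> \<longrightarrow>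
     compact_op \<omega> p \<upsilon> q K \<longrightarrow>
     ess_norm \<omega> p \<upsilon> q (\<lambda>f z. u z * (deriv ^^ k) f (\<tau> z))
       \<le> ennreal C * op_norm \<omega> p \<upsilon> q (\<lambda>f z. wC u0 \<phi> f z + wD u1 \<psi> f z - K f z)"
proof -
  have rw: "radial_weight \<omega>" using w by (simp add: weight_D_def weight_Dhat_def)
  have p0: "0 < p" and q: "1 < q" "0 < q" using p by auto
  obtain C1 where C1: "C1 \<ge> 1" "\<And>r. 0 \<le> r \<Longrightarrow> r < 1 \<Longrightarrow> omega_hat \<omega> r \<le> C1 * omega_hat \<omega> ((1 + r) / 2)"
    using w unfolding weight_D_def weight_Dhat_def by auto
  obtain C2 where C2: "C2 > 0" and emb: "\<forall>(\<nu>::complex measure) \<tau> M R f.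
    sets \<nu> = sets borel \<longrightarrow> finite_measure \<nu> \<longrightarrow> \<tau> \<in> borel_measurable borel \<longrightarrow> range \<tau> \<subseteq> disc \<longrightarrow> 0 \<le> M \<longrightarrow>
    (\<forall>a. R \<le> norm a \<longrightarrow> norm a < 1 \<longrightarrow>
       emeasure \<nu> {z. dist a (\<tau> z) < (1 - norm a) / 2} \<le> ennreal (M * carleson_gauge \<omega> p q k (norm a))) \<longrightarrow>
    f holomorphic_on disc \<longrightarrow> Ap_int \<omega> p f \<le> 1 \<longrightarrow>
    (\<integral>\<^sup>+z. ennreal (norm ((deriv ^^ k) f (\<tau> z)) powr q) * indicator {z. 1 - 4/5 * (1 - R) < norm (\<tau> z)} z \<partial>\<nu>) \<le> ennreal (C2 * M)"
    using carleson_embedding[OF w p, of k] by (elim exE conjE)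
  \<comment> \<open>The decay threshold for kernel powers, met by all larger exponents as well; m
    depends on p and the doubling constant only.\<close>
  obtain m :: nat where m: "4 * C1 \<le> 2 powr (m * p)"
  proof -
    obtain m :: nat where "log 2 (4 * C1) / p < real m" using reals_Archimedean2 by blast
    then have "log 2 (4 * C1) \<le> m * p" using p0 by (simp add: field_simps)
    then have "2 powr (log 2 (4 * C1)) \<le> 2 powr (m * p)" by (intro powr_mono) auto
    then show ?thesis using that C1 by simp
  qed
  \<comment> \<open>The norm constant of the largest exponent m + 2; it dominates those of m and m +
    1.\<close>
  define c where "c = 4 powr ((m + 2) * p) * 32 / pi"
  have c0: "0 < c" by (simp add: c_def)
  have mj: "4 * C1 \<le> 2 powr ((m + j) * p)" for j :: nat
  proof -
    have "2 powr (m * p) \<le> 2 powr ((m + j) * p)" using p0 by (intro powr_mono mult_right_mono) auto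
    then show ?thesis using m by linarith
  qed
  have cj: "4 powr ((m + j) * p) * 32 / pi \<le> c" if "j < 3" for j :: nat
    unfolding c_def using that p0 by (intro divide_right_mono mult_right_mono powr_mono) auto
  define h where "h = (\<lambda>j a. test_fun \<omega> p c (m + j) a)"
  have hA: "h j a \<in> Ap_space \<omega> p" "Ap_int \<omega> p (h j a) \<le> 1" if "j < 3" "norm a < 1" for j a
    unfolding h_def using test_fun_Ap[OF rw C1 p0 mj cj[OF that(1)] that(2)] by auto
  define cm where "cm = 16 * (real m + 2)\<^sup>2 * (5/2) ^ (m + 3)"
  have cm: "0 < cm" by (simp add: cm_def)
  define c' where "c' = (3 * (cm * c powr (1 / p))) powr q"
  have c': "0 < c'" using cm c0 by (simp add: c'_def)
  \<comment> \<open>Collected backwards: C2 from the embedding, c' from the separation, 3 exponents,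
    2^q for splitting off \<open>K\<close>, and 2 from \<alpha>^q + e^q <= 2 (\<alpha> +
    e)^q.\<close>
  define C where "C = (C2 * (c' * (3 * (2 powr q * 2)))) powr (1 / q)"
  have C: "0 < C" unfolding C_def using C2 c' by simp
  show ?thesis
  proof (intro exI[of _ C] conjI allI impI C)
    fix \<upsilon> :: "complex measure" and \<phi> \<psi> u0 u1 u \<tau> K
    assume s: "sets \<upsilon> = sets borel" and maps: "self_map \<phi>" "self_map \<psi>" and hol: "u0 holomorphic_on disc" "u1 holomorphic_on disc"
      and bd: "bounded_op \<omega> p \<upsilon> q (\<lambda>f z. wC u0 \<phi> f z + wD u1 \<psi> f z)"
      and cases: "k = 0 \<and> u = u0 \<and> \<tau> = \<phi> \<or> k = 1 \<and> u = u1 \<and> \<tau> = \<psi>"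
      and K: "compact_op \<omega> p \<upsilon> q K"
    define T where "T = (\<lambda>f z. wC u0 \<phi> f z + wD u1 \<psi> f z)"
    define A where "A = op_norm \<omega> p \<upsilon> q (\<lambda>f z. T f z - K f z)"
    have \<tau>: "self_map \<tau>" and u: "u holomorphic_on disc" and uL: "Lq_int \<upsilon> q u < \<infinity>"
      using cases maps hol weight_functions_in_Lq[OF rw p0 q(2) s maps hol bd] by auto
    have \<tau>d: "\<tau> z \<in> disc" "\<phi> z \<in> disc" "\<psi> z \<in> disc" if "z \<in> disc" for z using \<tau> maps that by (auto simp: self_map_def)
    have Tm: "disc_measurable (T f)" if "f holomorphic_on disc" for f
      using disc_measurable_add[OF disc_measurable_weighted[OF maps(1) hol(1) that, of 0] disc_measurable_weighted[OF maps(2) hol(2) that, of 1]]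
      by (simp add: T_def wC_def wD_def)
    have Km: "disc_measurable (K f)" if "f \<in> Ap_space \<omega> p" for f
      by (rule disc_measurable_Lq[OF s compact_opD(1)[OF K that]])
    show "ess_norm \<omega> p \<upsilon> q (\<lambda>f z. u z * (deriv ^^ k) f (\<tau> z))
       \<le> ennreal C * op_norm \<omega> p \<upsilon> q (\<lambda>f z. wC u0 \<phi> f z + wD u1 \<psi> f z - K f z)"
      unfolding T_def[symmetric] A_def[unfolded T_def, symmetric]
    proof (rule ennreal_le_epsilon)
      fix \<epsilon> :: real assume fin: "ennreal C * A < top" and \<epsilon>: "0 < \<epsilon>"
      have "A \<noteq> top" using fin C by (auto simp: ennreal_mult_top)
      define \<alpha> where "\<alpha> = enn2real A"
      have \<alpha>: "A = ennreal \<alpha>" "0 \<le> \<alpha>" using \<open>A \<noteq> top\<close> by (auto simp: \<alpha>_def less_top)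
      \<comment> \<open>\<open>K\<close> is made smaller than e in norm on the test functions. The
        final bound is C (\<alpha> + e), so its contribution is exactly \<epsilon>.\<close>
      define e where "e = \<epsilon> / C"
      have e: "0 < e" using \<epsilon> C by (simp add: e_def)
      then have eq: "0 < e powr q" by simp
      have "\<exists>R<1. \<forall>a. R \<le> norm a \<longrightarrow> norm a < 1 \<longrightarrow> Lq_int \<upsilon> q (K (h j a)) \<le> ennreal (e powr q)" if "j < 3" for j
        unfolding h_def by (rule compact_op_test_fun_small[OF s rw C1 p(1) q(2) mj cj[OF that] K eq])
      then have "\<forall>j\<in>{..<3::nat}. \<exists>R. R < 1 \<and> (\<forall>a. R \<le> norm a \<longrightarrow> norm a < 1 \<longrightarrow> Lq_int \<upsilon> q (K (h j a)) \<le> ennreal (e powr q))" by simp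
      from bchoice[OF this] obtain Rj where Rj: "\<And>j. j < 3 \<Longrightarrow> Rj j < 1"
        "\<And>j a. j < 3 \<Longrightarrow> Rj j \<le> norm a \<Longrightarrow> norm a < 1 \<Longrightarrow> Lq_int \<upsilon> q (K (h j a)) \<le> ennreal (e powr q)"
        by auto
      \<comment> \<open>One radius for the three exponents; 1/2 is the lower bound on |a| in
        \<open>weights_le_test_functions\<close>.\<close>
      define R where "R = Max (insert (1/2) (Rj ` {..<3}))"
      have R: "R < 1" "1/2 \<le> R" "\<And>j. j < 3 \<Longrightarrow> Rj j \<le> R"
      proof -
        show "R < 1" unfolding R_def using Rj(1) by (subst Max_less_iff) auto
        show "1/2 \<le> R" unfolding R_def by (rule Max_ge) auto
        show "Rj j \<le> R" if "j < 3" for j unfolding R_def using that by (intro Max_ge) auto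
      qed
      have Th: "Lq_int \<upsilon> q (T (h j a)) \<le> ennreal (2 powr q * (\<alpha> powr q + e powr q))" if j: "j < 3" and a: "R \<le> norm a" "norm a < 1" for j a
      proof -
        note hj = hA[OF j a(2)]
        have "Lq_norm \<upsilon> q (\<lambda>z. T (h j a) z - K (h j a) z) \<le> A"
          unfolding A_def op_norm_def by (rule SUP_upper) (use hj Ap_norm_le_1_iff[OF p0] in auto)
        then have 1: "Lq_int \<upsilon> q (\<lambda>z. T (h j a) z - K (h j a) z) \<le> ennreal (\<alpha> powr q)"
          unfolding \<alpha>(1) Lq_norm_def root_enn_le_iff[OF q(2) \<alpha>(2)] .
        have 2: "Lq_int \<upsilon> q (K (h j a)) \<le> ennreal (e powr q)" by (rule Rj(2)[OF j]) (use R(3)[OF j] a in auto)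
        have "Lq_int \<upsilon> q (T (h j a)) \<le> ennreal (2 powr q) * (Lq_int \<upsilon> q (\<lambda>z. T (h j a) z - K (h j a) z) + Lq_int \<upsilon> q (K (h j a)))"
          using hj q by (intro Lq_int_le_diff[OF s] Tm Km) (auto simp: Ap_space_def)
        also have "\<dots> \<le> ennreal (2 powr q) * (ennreal (\<alpha> powr q) + ennreal (e powr q))"
          by (intro mult_left_mono add_mono 1 2) simp
        also have "\<dots> = ennreal (2 powr q * (\<alpha> powr q + e powr q))" by (simp add: ennreal_mult)
        finally show ?thesis .
      qed
      define M where "M = c' * (3 * (2 powr q * (\<alpha> powr q + e powr q)))"
      have M: "0 \<le> M" using c' by (simp add: M_def)
      \<comment> \<open>A Borel map of the whole plane into the disc, as the embedding requires. Its
        value 0 off the disc is harmless, since the density g vanishes there.\<close>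
      define \<tau>' where "\<tau>' = (\<lambda>z. indicator disc z *\<^sub>R \<tau> z)"
      have \<tau>'m: "\<tau>' \<in> borel_measurable borel"
        unfolding \<tau>'_def using \<tau> by (intro borel_measurable_continuous_on_indicator disc_sets holomorphic_on_imp_continuous_on) (simp add: self_map_def)
      have \<tau>'d: "range \<tau>' \<subseteq> disc" using \<tau>d by (auto simp: \<tau>'_def indicator_def) (simp add: disc_def)
      define g where "g = (\<lambda>z. ennreal (norm (u z) powr q) * indicator disc z)"
      have g: "g \<in> borel_measurable borel"
        unfolding g_def by (intro disc_measurable_powr disc_measurable_continuous holomorphic_on_imp_continuous_on u)
      then have g\<upsilon>: "g \<in> borel_measurable \<upsilon>" using measurable_cong_sets[OF s refl] by blast
      define \<nu> where "\<nu> = density \<upsilon> g"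
      have \<nu>s: "sets \<nu> = sets borel" using s by (simp add: \<nu>_def)
      have \<nu>f: "finite_measure \<nu>"
      proof (rule finite_measureI)
        have "emeasure \<nu> (space \<nu>) = (\<integral>\<^sup>+z. g z * indicator (space \<upsilon>) z \<partial>\<upsilon>)"
          unfolding \<nu>_def by (simp add: emeasure_density[OF g\<upsilon>])
        also have "\<dots> = Lq_int \<upsilon> q u" unfolding Lq_int_def g_def by (intro nn_integral_cong) simp
        finally show "emeasure \<nu> (space \<nu>) \<noteq> \<infinity>" using uL by simp
      qed
      have car: "emeasure \<nu> {z. dist a (\<tau>' z) < (1 - norm a) / 2} \<le> ennreal (M * carleson_gauge \<omega> p q k (norm a))"
        if a: "R \<le> norm a" "norm a < 1" for a
      proof -
        define \<delta> where "\<delta> = 1 - norm a"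
        define W where "W = omega_hat \<omega> (norm a) * \<delta>"
        have \<delta>: "0 < \<delta>" using a by (simp add: \<delta>_def)
        have W: "0 < W" unfolding W_def using omega_hat_pos[OF rw, of "norm a"] a \<delta> by simp
        define E where "E = {z. dist a (\<tau>' z) < (1 - norm a) / 2}"
        have E: "E \<in> sets \<upsilon>"
        proof -
          have "{z\<in>space borel. dist a (\<tau>' z) < (1 - norm a) / 2} \<in> sets borel" using \<tau>'m by measurable
          then show ?thesis by (simp add: E_def s)
        qed
        define \<Gamma> where "\<Gamma> = carleson_gauge \<omega> p q k (norm a)"
        have \<Gamma>: "0 < \<Gamma>" unfolding \<Gamma>_def by (rule carleson_gauge_pos[OF rw]) (use a in auto)
        \<comment> \<open>The factor (1 - |a|)^k from \<open>weights_le_test_functions\<close>, none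
          for \<open>u0\<close> and one for \<open>u1\<close>, and the inverse \<open>N\<close> of
          the normalising scalar combine, after taking q-th powers, to the gauge \<Gamma> up to the
          constant c'.\<close>
        have pw: "norm (u z) powr q \<le> c' * \<Gamma> * (\<Sum>j<3. norm (T (h j a) z) powr q)" if z: "z \<in> disc" "dist a (\<tau> z) < (1 - norm a) / 2" for z
        proof -
          define y where "y = (c * W) powr (- 1 / p)"
          have y: "0 < y" using c0 W by (simp add: y_def)
          define N where "N = (c * W) powr (1 / p)"
          have Ny: "N * y = 1"
          proof -
            have "1 / p + - 1 / p = 0" by simp
            then show ?thesis unfolding N_def y_def powr_add[symmetric] using c0 W by simp
          qed
          have N: "0 < N" using c0 W by (simp add: N_def)
          have zz: "norm (\<phi> z) < 1" "norm (\<psi> z) < 1" using \<tau>d[OF z(1)] by (auto simp: disc_def)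
          have Te: "T (h j a) z = of_real y * (u0 z * bergman_sigma a (\<phi> z) ^ (m + j) + u1 z * deriv (\<lambda>z. bergman_sigma a z ^ (m + j)) (\<psi> z))" for j
          proof -
            have hh: "h j a = (\<lambda>z. of_real y * bergman_sigma a z ^ (m + j))"
              by (simp add: h_def test_fun_def fun_eq_iff y_def W_def \<delta>_def)
            have "deriv (\<lambda>z. of_real y * bergman_sigma a z ^ (m + j)) (\<psi> z) = of_real y * deriv (\<lambda>z. bergman_sigma a z ^ (m + j)) (\<psi> z)"
              by (intro deriv_cmult holomorphic_on_imp_differentiable_at[OF bergman_sigma_holomorphic[OF a(2)]])
                (use \<tau>d(3)[OF z(1)] in \<open>auto simp: disc_def\<close>)
            then show ?thesis unfolding T_def wC_def wD_def hh by (simp add: algebra_simps)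
          qed
          have a2: "1/2 \<le> norm a" using R(2) a by simp
          define \<Sigma> where "\<Sigma> = (\<Sum>j<3. norm (u0 z * bergman_sigma a (\<phi> z) ^ (m + j) + u1 z * deriv (\<lambda>z. bergman_sigma a z ^ (m + j)) (\<psi> z)))"
          have sumT: "(\<Sum>j<3. norm (T (h j a) z)) = y * \<Sigma>"
            unfolding Te \<Sigma>_def norm_mult sum_distrib_left using y by simp
          have "norm (u z) \<le> cm * \<delta> ^ k * \<Sigma>"
            using cases weights_le_test_functions[OF a(2) a2 zz, where ?b0.0="u0 z" and ?b1.0="u1 z" and m=m] z(2)
            unfolding \<Sigma>_def cm_def \<delta>_def by auto
          also have "\<Sigma> = N * (\<Sum>j<3. norm (T (h j a) z))" unfolding sumT using Ny by (simp flip: mult.assoc)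
          finally have "norm (u z) \<le> (cm * \<delta> ^ k * N) * (\<Sum>j<3. norm (T (h j a) z))" by (simp add: mult.assoc)
          then have "norm (u z) powr q \<le> (3 * (cm * \<delta> ^ k * N)) powr q * (\<Sum>j<3. norm (T (h j a) z) powr q)"
            using q cm \<delta> N by (intro norm_powr_le_sum3) auto
          also have "(3 * (cm * \<delta> ^ k * N)) powr q = c' * \<Gamma>"
          proof -
            have 1: "(\<delta> ^ k) powr q = \<delta> powr (k * q)" using \<delta> by (subst powr_realpow[symmetric]) (auto simp: powr_powr)
            have 2: "(W powr (1 / p)) powr q = W powr (q / p)" by (simp add: powr_powr)
            have 3: "N = c powr (1 / p) * W powr (1 / p)" unfolding N_def by (rule powr_mult)
            have "3 * (cm * \<delta> ^ k * N) = 3 * (cm * c powr (1 / p)) * (\<delta> ^ k * W powr (1 / p))" unfolding 3 by simp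
            then show ?thesis
              unfolding c'_def \<Gamma>_def carleson_gauge_def \<delta>_def[symmetric] W_def[symmetric] by (simp only: powr_mult 1 2)
          qed
          finally show ?thesis .
        qed
        have mT: "(\<lambda>z. ennreal (norm (T (h j a) z) powr q) * indicator disc z) \<in> borel_measurable \<upsilon>" if "j < 3" for j
          using disc_measurable_powr[OF Tm, of "h j a" q] hA[OF that a(2)] measurable_cong_sets[OF s refl]
          by (auto simp: Ap_space_def)
        have "emeasure \<nu> E = (\<integral>\<^sup>+z. g z * indicator E z \<partial>\<upsilon>)"
          unfolding \<nu>_def by (rule emeasure_density[OF g\<upsilon> E])
        also have "\<dots> \<le> (\<integral>\<^sup>+z. ennreal (c' * \<Gamma>) * (\<Sum>j<3. ennreal (norm (T (h j a) z) powr q) * indicator disc z) \<partial>\<upsilon>)"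
        proof (rule nn_integral_mono)
          fix z
          show "g z * indicator E z \<le> ennreal (c' * \<Gamma>) * (\<Sum>j<3. ennreal (norm (T (h j a) z) powr q) * indicator disc z)"
          proof (cases "z \<in> disc \<and> z \<in> E")
            case True
            then have "norm (u z) powr q \<le> c' * \<Gamma> * (\<Sum>j<3. norm (T (h j a) z) powr q)"
              by (intro pw) (auto simp: E_def \<tau>'_def)
            then have "ennreal (norm (u z) powr q) \<le> ennreal (c' * \<Gamma> * (\<Sum>j<3. norm (T (h j a) z) powr q))" by (rule ennreal_leI)
            also have "\<dots> = ennreal (c' * \<Gamma>) * (\<Sum>j<3. ennreal (norm (T (h j a) z) powr q))"
              using c' \<Gamma> by (subst ennreal_mult) (auto intro: sum_nonneg)
            finally show ?thesis using True by (simp add: g_def)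
          qed (auto simp: g_def)
        qed
        also have "\<dots> = ennreal (c' * \<Gamma>) * (\<Sum>j<3. Lq_int \<upsilon> q (T (h j a)))"
        proof -
          have "(\<integral>\<^sup>+z. ennreal (c' * \<Gamma>) * (\<Sum>j<3. ennreal (norm (T (h j a) z) powr q) * indicator disc z) \<partial>\<upsilon>)
             = ennreal (c' * \<Gamma>) * (\<integral>\<^sup>+z. (\<Sum>j<3. ennreal (norm (T (h j a) z) powr q) * indicator disc z) \<partial>\<upsilon>)"
            by (rule nn_integral_cmult) (intro borel_measurable_sum mT, simp)
          also have "(\<integral>\<^sup>+z. (\<Sum>j<3. ennreal (norm (T (h j a) z) powr q) * indicator disc z) \<partial>\<upsilon>) = (\<Sum>j<3. Lq_int \<upsilon> q (T (h j a)))"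
            unfolding Lq_int_def by (rule nn_integral_sum) (use mT in simp)
          finally show ?thesis .
        qed
        also have "\<dots> \<le> ennreal (c' * \<Gamma>) * (\<Sum>j<(3::nat). ennreal (2 powr q * (\<alpha> powr q + e powr q)))"
          using a by (intro mult_left_mono sum_mono Th) auto
        also have "(\<Sum>j<(3::nat). ennreal (2 powr q * (\<alpha> powr q + e powr q))) = ennreal (3 * (2 powr q * (\<alpha> powr q + e powr q)))"
          by (subst sum_ennreal) auto
        also have "ennreal (c' * \<Gamma>) * \<dots> = ennreal (c' * \<Gamma> * (3 * (2 powr q * (\<alpha> powr q + e powr q))))"
          using c' \<Gamma> by (subst ennreal_mult) auto
        also have "c' * \<Gamma> * (3 * (2 powr q * (\<alpha> powr q + e powr q))) = M * \<Gamma>" by (simp add: M_def)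
        finally show ?thesis unfolding E_def \<Gamma>_def .
      qed
      define R' where "R' = 1 - 4/5 * (1 - R)"
      have R': "R' < 1" using R by (simp add: R'_def)
      have main: "Lq_norm \<upsilon> q (\<lambda>z. u z * (deriv ^^ k) f (\<tau> z) - trunc_op u \<tau> k R' f z) \<le> ennreal (C * (\<alpha> + e))"
        if f: "f \<in> Ap_space \<omega> p" "Ap_norm \<omega> p f \<le> 1" for f
      proof -
        have fh: "f holomorphic_on disc" and f1: "Ap_int \<omega> p f \<le> 1" using f Ap_norm_le_1_iff[OF p0] by (auto simp: Ap_space_def)
        have fd: "(deriv ^^ k) f holomorphic_on disc" by (rule holomorphic_higher_deriv[OF fh]) (simp add: disc_def)
        define F where "F = (\<lambda>z. ennreal (norm ((deriv ^^ k) f (\<tau>' z)) powr q) * indicator {z. R' < norm (\<tau>' z)} z)"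
        have Fm: "F \<in> borel_measurable \<upsilon>"
        proof -
          have 1: "(\<lambda>w. ennreal (norm ((deriv ^^ k) f w) powr q) * indicator disc w) \<in> borel_measurable borel"
            by (intro disc_measurable_powr disc_measurable_continuous holomorphic_on_imp_continuous_on fd)
          have 2: "(\<lambda>z. ennreal (norm ((deriv ^^ k) f (\<tau>' z)) powr q)) \<in> borel_measurable borel"
            using measurable_compose[OF \<tau>'m 1] \<tau>'d by (auto simp: indicator_def image_subset_iff)
          have "{z\<in>space borel. R' < norm (\<tau>' z)} \<in> sets borel" using \<tau>'m by measurable
          then have 3: "{z. R' < norm (\<tau>' z)} \<in> sets borel" by simp
          have "F \<in> borel_measurable borel"
            unfolding F_def by (intro borel_measurable_times_ennreal 2 borel_measurable_indicator 3)
          then show ?thesis using measurable_cong_sets[OF s refl] by blast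
        qed
        \<comment> \<open>On the disc the truncation removes exactly the part with |\<tau>| <= R',
          the cut-off of the embedding; what is left is |u|^q times the embedded integrand, that is,
          its integral against \<nu>.\<close>
        have "Lq_int \<upsilon> q (\<lambda>z. u z * (deriv ^^ k) f (\<tau> z) - trunc_op u \<tau> k R' f z) = (\<integral>\<^sup>+z. g z * F z \<partial>\<upsilon>)"
          unfolding Lq_int_def
        proof (rule nn_integral_cong)
          fix z
          show "ennreal (norm (u z * (deriv ^^ k) f (\<tau> z) - trunc_op u \<tau> k R' f z) powr q) * indicator disc z = g z * F z"
            by (auto simp: g_def F_def trunc_op_def \<tau>'_def indicator_def norm_mult powr_mult ennreal_mult)
        qed
        also have "\<dots> = (\<integral>\<^sup>+z. F z \<partial>\<nu>)" unfolding \<nu>_def by (rule nn_integral_density[OF g\<upsilon> Fm, symmetric])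
        also have "\<dots> \<le> ennreal (C2 * M)"
          unfolding F_def R'_def by (rule emb[rule_format, OF \<nu>s \<nu>f \<tau>'m \<tau>'d M car fh f1])
        also have "\<dots> \<le> ennreal ((C * (\<alpha> + e)) powr q)"
        proof (rule ennreal_leI)
          have "\<alpha> powr q + e powr q \<le> (\<alpha> + e) powr q + (\<alpha> + e) powr q"
            using \<alpha> e q by (intro add_mono powr_mono2) auto
          then have "C2 * M \<le> C2 * (c' * (3 * (2 powr q * (2 * (\<alpha> + e) powr q))))"
            unfolding M_def using C2 c' by (intro mult_left_mono) auto
          also have "\<dots> = C powr q * (\<alpha> + e) powr q"
            unfolding C_def using q C2 c' by (simp add: powr_powr)
          also have "\<dots> = (C * (\<alpha> + e)) powr q" by (rule powr_mult[symmetric])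
          finally show "C2 * M \<le> (C * (\<alpha> + e)) powr q" .
        qed
        finally show ?thesis unfolding Lq_norm_def using C \<alpha> e q by (subst root_enn_le_iff) auto
      qed
      have "ess_norm \<omega> p \<upsilon> q (\<lambda>f z. u z * (deriv ^^ k) f (\<tau> z)) \<le> op_norm \<omega> p \<upsilon> q (\<lambda>f z. u z * (deriv ^^ k) f (\<tau> z) - trunc_op u \<tau> k R' f z)"
        unfolding ess_norm_def by (rule INF_lower) (use compact_trunc_op[OF w p(1) q(2) s \<tau> u uL R'] in simp)
      also have "\<dots> \<le> ennreal (C * (\<alpha> + e))"
        unfolding op_norm_def by (rule SUP_least) (use main in auto)
      also have "\<dots> = ennreal C * A + ennreal \<epsilon>"
      proof -
        have "C * (\<alpha> + e) = C * \<alpha> + \<epsilon>" using C by (simp add: e_def distrib_left)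
        then show ?thesis using C \<alpha> \<epsilon> by (simp add: ennreal_mult)
      qed
      finally show "ess_norm \<omega> p \<upsilon> q (\<lambda>f z. u z * (deriv ^^ k) f (\<tau> z)) \<le> ennreal C * A + ennreal \<epsilon>" .
    qed
  qed
qed

text \<open>Near-optimal compact operators for the two summands add up to an admissible one for the
  sum. With excess \<epsilon>/8 for each, the constant 4 of the quasi-triangle inequality yields a
  total excess \<epsilon>.\<close>

lemma ess_norm_add_le:
  assumes s: "sets \<upsilon> = sets borel" and p: "0 < p" "1 \<le> q"
    and S: "\<And>f. f \<in> Ap_space \<omega> p \<Longrightarrow> disc_measurable (S f)" "\<And>f. f \<in> Ap_space \<omega> p \<Longrightarrow> disc_measurable (T f)"
  shows "ess_norm \<omega> p \<upsilon> q (\<lambda>f z. S f z + T f z) \<le> ennreal 4 * (ess_norm \<omega> p \<upsilon> q S + ess_norm \<omega> p \<upsilon> q T)"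
proof (rule ennreal_le_epsilon)
  fix \<epsilon> :: real assume fin: "ennreal 4 * (ess_norm \<omega> p \<upsilon> q S + ess_norm \<omega> p \<upsilon> q T) < top" and \<epsilon>: "0 < \<epsilon>"
  have q: "0 < q" using p by simp
  have near: "\<exists>K b. compact_op \<omega> p \<upsilon> q K \<and> 0 \<le> b \<and> op_norm \<omega> p \<upsilon> q (\<lambda>f z. U f z - K f z) \<le> ennreal b \<and> ennreal b \<le> ess_norm \<omega> p \<upsilon> q U + ennreal (\<epsilon> / 8)"
    if "ess_norm \<omega> p \<upsilon> q U < top" for U
  proof -
    have "ess_norm \<omega> p \<upsilon> q U < ess_norm \<omega> p \<upsilon> q U + ennreal (\<epsilon> / 8)"
      using that \<epsilon> by (cases "ess_norm \<omega> p \<upsilon> q U") (auto simp: ennreal_less_iff simp flip: ennreal_plus)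
    then obtain K where K: "compact_op \<omega> p \<upsilon> q K" "op_norm \<omega> p \<upsilon> q (\<lambda>f z. U f z - K f z) < ess_norm \<omega> p \<upsilon> q U + ennreal (\<epsilon> / 8)"
      unfolding ess_norm_def INF_less_iff by auto
    define b where "b = enn2real (ess_norm \<omega> p \<upsilon> q U + ennreal (\<epsilon> / 8))"
    have "ess_norm \<omega> p \<upsilon> q U + ennreal (\<epsilon> / 8) = ennreal b" using that by (simp add: b_def)
    then show ?thesis using K by (intro exI[of _ K] exI[of _ b]) (auto simp: b_def)
  qed
  have "ess_norm \<omega> p \<upsilon> q S < top" "ess_norm \<omega> p \<upsilon> q T < top" using fin by (auto simp: ennreal_mult_less_top)
  then obtain K a L b where K: "compact_op \<omega> p \<upsilon> q K" "0 \<le> a" "op_norm \<omega> p \<upsilon> q (\<lambda>f z. S f z - K f z) \<le> ennreal a" "ennreal a \<le> ess_norm \<omega> p \<upsilon> q S + ennreal (\<epsilon> / 8)"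
    and L: "compact_op \<omega> p \<upsilon> q L" "0 \<le> b" "op_norm \<omega> p \<upsilon> q (\<lambda>f z. T f z - L f z) \<le> ennreal b" "ennreal b \<le> ess_norm \<omega> p \<upsilon> q T + ennreal (\<epsilon> / 8)"
    using near by meson
  have "ess_norm \<omega> p \<upsilon> q (\<lambda>f z. S f z + T f z) \<le> op_norm \<omega> p \<upsilon> q (\<lambda>f z. S f z + T f z - (K f z + L f z))"
    unfolding ess_norm_def by (rule INF_lower) (use compact_op_add[OF s p(1) q K(1) L(1)] in simp)
  also have "\<dots> \<le> ennreal (4 * (a + b))"
    unfolding op_norm_def
  proof (rule SUP_least)
    fix f assume f: "f \<in> {f \<in> Ap_space \<omega> p. Ap_norm \<omega> p f \<le> 1}"
    then have fA: "f \<in> Ap_space \<omega> p" by simp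
    have "Lq_norm \<upsilon> q (\<lambda>z. S f z - K f z) \<le> op_norm \<omega> p \<upsilon> q (\<lambda>f z. S f z - K f z)"
      unfolding op_norm_def by (rule SUP_upper[OF f])
    then have 1: "Lq_norm \<upsilon> q (\<lambda>z. S f z - K f z) \<le> ennreal a" using K(3) by (rule order_trans)
    have "Lq_norm \<upsilon> q (\<lambda>z. T f z - L f z) \<le> op_norm \<omega> p \<upsilon> q (\<lambda>f z. T f z - L f z)"
      unfolding op_norm_def by (rule SUP_upper[OF f])
    then have 2: "Lq_norm \<upsilon> q (\<lambda>z. T f z - L f z) \<le> ennreal b" using L(3) by (rule order_trans)
    have "Lq_norm \<upsilon> q (\<lambda>z. S f z + T f z - (K f z + L f z)) = Lq_norm \<upsilon> q (\<lambda>z. (S f z - K f z) + (T f z - L f z))"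
      by (simp add: algebra_simps)
    also have "\<dots> \<le> ennreal (4 * (a + b))"
      by (rule Lq_norm_add_le[OF s p(2)
          disc_measurable_diff[OF S(1)[OF fA] disc_measurable_Lq[OF s compact_opD(1)[OF K(1) fA]]]
          disc_measurable_diff[OF S(2)[OF fA] disc_measurable_Lq[OF s compact_opD(1)[OF L(1) fA]]] 1 2 K(2) L(2)])
    finally show "Lq_norm \<upsilon> q (\<lambda>z. S f z + T f z - (K f z + L f z)) \<le> ennreal (4 * (a + b))" .
  qed
  also have "\<dots> = ennreal 4 * (ennreal a + ennreal b)" using K(2) L(2) by (simp add: ennreal_mult)
  also have "\<dots> \<le> ennreal 4 * ((ess_norm \<omega> p \<upsilon> q S + ennreal (\<epsilon> / 8)) + (ess_norm \<omega> p \<upsilon> q T + ennreal (\<epsilon> / 8)))"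
    by (intro mult_left_mono add_mono K(4) L(4)) simp
  also have "\<dots> = ennreal 4 * (ess_norm \<omega> p \<upsilon> q S + ess_norm \<omega> p \<upsilon> q T) + ennreal 4 * (ennreal (\<epsilon> / 8) + ennreal (\<epsilon> / 8))"
    by (simp only: distrib_left ac_simps)
  also have "ennreal 4 * (ennreal (\<epsilon> / 8) + ennreal (\<epsilon> / 8)) = ennreal \<epsilon>"
  proof -
    have "ennreal (\<epsilon> / 8) + ennreal (\<epsilon> / 8) = ennreal (\<epsilon> / 4)" using \<epsilon> by (subst ennreal_plus[symmetric]) auto
    then show ?thesis using \<epsilon> by (simp only:) (subst ennreal_mult[symmetric], auto)
  qed
  finally show "ess_norm \<omega> p \<upsilon> q (\<lambda>f z. S f z + T f z) \<le> ennreal 4 * (ess_norm \<omega> p \<upsilon> q S + ess_norm \<omega> p \<upsilon> q T) + ennreal \<epsilon>" .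
qed

text \<open>Multiplication by a positive finite constant is an order isomorphism of the extended
  half-line, with inverse multiplication by 1/C, so it passes through infima.\<close>

lemma ennreal_le_mult_INF:
  fixes a :: ennreal
  assumes C: "0 < C" and le: "\<And>x. x \<in> X \<Longrightarrow> a \<le> ennreal C * f x"
  shows "a \<le> ennreal C * (INF x\<in>X. f x)"
proof -
  have inv: "ennreal (1 / C) * (ennreal C * y) = y" "ennreal C * (ennreal (1 / C) * y) = y" for y
  proof -
    have "ennreal (1 / C) * ennreal C = 1" "ennreal C * ennreal (1 / C) = 1"
      using C by (simp_all flip: ennreal_mult)
    then show "ennreal (1 / C) * (ennreal C * y) = y" "ennreal C * (ennreal (1 / C) * y) = y"
      by (simp_all flip: mult.assoc)
  qed
  have "ennreal (1 / C) * a \<le> (INF x\<in>X. f x)"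
  proof (rule INF_greatest)
    fix x assume "x \<in> X"
    from mult_left_mono[OF le[OF this], of "ennreal (1 / C)"] show "ennreal (1 / C) * a \<le> f x" by (simp add: inv)
  qed
  from mult_left_mono[OF this, of "ennreal C"] show ?thesis by (simp add: inv)
qed

theorem theorem3p1:
  fixes p q :: real and \<omega> :: "real \<Rightarrow> real"
  assumes "1 < p" and "p \<le> q" and "weight_D \<omega>"
  shows "\<exists>C>0. \<forall>(\<upsilon>::complex measure) \<phi> \<psi> u0 u1.
     sets \<upsilon> = sets borel \<and> self_map \<phi> \<and> self_map \<psi> \<and>
     u0 holomorphic_on disc \<and> u1 holomorphic_on disc \<and>
     bounded_op \<omega> p \<upsilon> q (\<lambda>f z. wC u0 \<phi> f z + wD u1 \<psi> f z) \<longrightarrow>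
       ess_norm \<omega> p \<upsilon> q (\<lambda>f z. wC u0 \<phi> f z + wD u1 \<psi> f z)
         \<le> ennreal C * (ess_norm \<omega> p \<upsilon> q (wC u0 \<phi>) + ess_norm \<omega> p \<upsilon> q (wD u1 \<psi>)) \<and>
       ess_norm \<omega> p \<upsilon> q (wC u0 \<phi>) + ess_norm \<omega> p \<upsilon> q (wD u1 \<psi>)
         \<le> ennreal C * ess_norm \<omega> p \<upsilon> q (\<lambda>f z. wC u0 \<phi> f z + wD u1 \<psi> f z)"
proof -
  \<comment> \<open>The two instances k = 0 and k = 1 of the component estimate; in each, the false
    equation between 0 and 1 rules out the other component.\<close>
  obtain C0 where C0: "C0 > 0" "\<forall>\<upsilon> \<phi> \<psi> u0 u1 u \<tau> K. sets \<upsilon> = sets borel \<longrightarrow> self_map \<phi> \<longrightarrow> self_map \<psi> \<longrightarrow>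
     u0 holomorphic_on disc \<longrightarrow> u1 holomorphic_on disc \<longrightarrow>
     bounded_op \<omega> p \<upsilon> q (\<lambda>f z. wC u0 \<phi> f z + wD u1 \<psi> f z) \<longrightarrow>
     0 = (0::nat) \<and> u = u0 \<and> \<tau> = \<phi> \<or> 0 = (1::nat) \<and> u = u1 \<and> \<tau> = \<psi> \<longrightarrow>
     compact_op \<omega> p \<upsilon> q K \<longrightarrow>
     ess_norm \<omega> p \<upsilon> q (\<lambda>f z. u z * (deriv ^^ 0) f (\<tau> z))
       \<le> ennreal C0 * op_norm \<omega> p \<upsilon> q (\<lambda>f z. wC u0 \<phi> f z + wD u1 \<psi> f z - K f z)"
    using ess_norm_component_le[OF assms(3,1,2), of 0] by (elim exE conjE)
  obtain C1 where C1: "C1 > 0" "\<forall>\<upsilon> \<phi> \<psi> u0 u1 u \<tau> K. sets \<upsilon> = sets borel \<longrightarrow> self_map \<phi> \<longrightarrow> self_map \<psi> \<longrightarrow>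
     u0 holomorphic_on disc \<longrightarrow> u1 holomorphic_on disc \<longrightarrow>
     bounded_op \<omega> p \<upsilon> q (\<lambda>f z. wC u0 \<phi> f z + wD u1 \<psi> f z) \<longrightarrow>
     1 = (0::nat) \<and> u = u0 \<and> \<tau> = \<phi> \<or> 1 = (1::nat) \<and> u = u1 \<and> \<tau> = \<psi> \<longrightarrow>
     compact_op \<omega> p \<upsilon> q K \<longrightarrow>
     ess_norm \<omega> p \<upsilon> q (\<lambda>f z. u z * (deriv ^^ 1) f (\<tau> z))
       \<le> ennreal C1 * op_norm \<omega> p \<upsilon> q (\<lambda>f z. wC u0 \<phi> f z + wD u1 \<psi> f z - K f z)"
    using ess_norm_component_le[OF assms(3,1,2), of 1] by (elim exE conjE)
  define C where "C = 4 + C0 + C1"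
  have C: "0 < C" using C0 C1 by (simp add: C_def)
  show ?thesis
  proof (intro exI[of _ C] conjI allI impI C; elim conjE)
    fix \<upsilon> :: "complex measure" and \<phi> \<psi> u0 u1
    assume H: "sets \<upsilon> = sets borel" "self_map \<phi>" "self_map \<psi>" "u0 holomorphic_on disc" "u1 holomorphic_on disc"
      "bounded_op \<omega> p \<upsilon> q (\<lambda>f z. wC u0 \<phi> f z + wD u1 \<psi> f z)"
    have e0: "wC u0 \<phi> = (\<lambda>f z. u0 z * (deriv ^^ 0) f (\<phi> z))" and e1: "wD u1 \<psi> = (\<lambda>f z. u1 z * (deriv ^^ 1) f (\<psi> z))"
      by (simp_all add: wC_def wD_def fun_eq_iff)
    have "ess_norm \<omega> p \<upsilon> q (\<lambda>f z. wC u0 \<phi> f z + wD u1 \<psi> f z) \<le> ennreal 4 * (ess_norm \<omega> p \<upsilon> q (wC u0 \<phi>) + ess_norm \<omega> p \<upsilon> q (wD u1 \<psi>))"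
    proof (rule ess_norm_add_le[OF H(1)])
      fix f assume "f \<in> Ap_space \<omega> p"
      then have f: "f holomorphic_on disc" by (simp add: Ap_space_def)
      show "disc_measurable (wC u0 \<phi> f)" unfolding e0 by (rule disc_measurable_weighted[OF H(2,4) f])
      show "disc_measurable (wD u1 \<psi> f)" unfolding e1 by (rule disc_measurable_weighted[OF H(3,5) f])
    qed (use assms in auto)
    also have "\<dots> \<le> ennreal C * (ess_norm \<omega> p \<upsilon> q (wC u0 \<phi>) + ess_norm \<omega> p \<upsilon> q (wD u1 \<psi>))"
      using C0 C1 by (intro mult_right_mono ennreal_leI) (auto simp: C_def)
    finally show "ess_norm \<omega> p \<upsilon> q (\<lambda>f z. wC u0 \<phi> f z + wD u1 \<psi> f z) \<le> \<dots>" .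
    have "ess_norm \<omega> p \<upsilon> q (wC u0 \<phi>) \<le> ennreal C0 * ess_norm \<omega> p \<upsilon> q (\<lambda>f z. wC u0 \<phi> f z + wD u1 \<psi> f z)"
      unfolding ess_norm_def[of \<omega> p \<upsilon> q "\<lambda>f z. wC u0 \<phi> f z + wD u1 \<psi> f z"]
    proof (rule ennreal_le_mult_INF[OF C0(1)])
      fix K assume "K \<in> {K. compact_op \<omega> p \<upsilon> q K}"
      then have "ess_norm \<omega> p \<upsilon> q (\<lambda>f z. u0 z * (deriv ^^ 0) f (\<phi> z))
         \<le> ennreal C0 * op_norm \<omega> p \<upsilon> q (\<lambda>f z. wC u0 \<phi> f z + wD u1 \<psi> f z - K f z)"
        by (intro C0(2)[rule_format, OF H]) auto
      then show "ess_norm \<omega> p \<upsilon> q (wC u0 \<phi>)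
         \<le> ennreal C0 * op_norm \<omega> p \<upsilon> q (\<lambda>f z. wC u0 \<phi> f z + wD u1 \<psi> f z - K f z)"
        unfolding e0[symmetric] .
    qed
    moreover have "ess_norm \<omega> p \<upsilon> q (wD u1 \<psi>) \<le> ennreal C1 * ess_norm \<omega> p \<upsilon> q (\<lambda>f z. wC u0 \<phi> f z + wD u1 \<psi> f z)"
      unfolding ess_norm_def[of \<omega> p \<upsilon> q "\<lambda>f z. wC u0 \<phi> f z + wD u1 \<psi> f z"]
    proof (rule ennreal_le_mult_INF[OF C1(1)])
      fix K assume "K \<in> {K. compact_op \<omega> p \<upsilon> q K}"
      then have "ess_norm \<omega> p \<upsilon> q (\<lambda>f z. u1 z * (deriv ^^ 1) f (\<psi> z))
         \<le> ennreal C1 * op_norm \<omega> p \<upsilon> q (\<lambda>f z. wC u0 \<phi> f z + wD u1 \<psi> f z - K f z)"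
        by (intro C1(2)[rule_format, OF H]) auto
      then show "ess_norm \<omega> p \<upsilon> q (wD u1 \<psi>)
         \<le> ennreal C1 * op_norm \<omega> p \<upsilon> q (\<lambda>f z. wC u0 \<phi> f z + wD u1 \<psi> f z - K f z)"
        unfolding e1[symmetric] .
    qed
    ultimately have "ess_norm \<omega> p \<upsilon> q (wC u0 \<phi>) + ess_norm \<omega> p \<upsilon> q (wD u1 \<psi>)
      \<le> ennreal C0 * ess_norm \<omega> p \<upsilon> q (\<lambda>f z. wC u0 \<phi> f z + wD u1 \<psi> f z) + ennreal C1 * ess_norm \<omega> p \<upsilon> q (\<lambda>f z. wC u0 \<phi> f z + wD u1 \<psi> f z)"
      by (rule add_mono)
    also have "\<dots> = ennreal (C0 + C1) * ess_norm \<omega> p \<upsilon> q (\<lambda>f z. wC u0 \<phi> f z + wD u1 \<psi> f z)"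
      using C0 C1 by (simp add: distrib_right)
    also have "\<dots> \<le> ennreal C * ess_norm \<omega> p \<upsilon> q (\<lambda>f z. wC u0 \<phi> f z + wD u1 \<psi> f z)"
      by (intro mult_right_mono ennreal_leI) (auto simp: C_def)
    finally show "ess_norm \<omega> p \<upsilon> q (wC u0 \<phi>) + ess_norm \<omega> p \<upsilon> q (wD u1 \<psi>) \<le> \<dots>" .
  qed
qed

end
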